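(* Let $K$ be a field. (i) Let $\mathbb A$ be a reflexive functor of commutative $\mathcal K$-algebras. If $\mathbb A$ is a proquasi-coherent algebra, then $\operatorname{Spec}\mathbb A$ is an affine functor and $\mathbb A_{\operatorname{Spec}\mathbb A}=\mathbb A$. (ii) If $\mathbb X$ is an affine functor, then $\mathbb A_{\mathbb X}$ is a proquasi-coherent algebra.
   Context: All functors are covariant functors on the category of commutative (associative, unital) $K$-algebras; limits are taken objectwise. $\mathcal K(S)=S$. A functor of $\mathcal K$-modules is a functor $\mathbb M$ with functorial $S$-module structures on $\mathbb M(S)$; functors of $\mathcal K$-algebras are defined analogously. For a $K$-module $M$, $\mathcal M(S):=M\otimes_K S$ is the quasi-coherent module associated with $M$; if $A$ is a $K$-algebra, $\mathcal A(S)=A\otimes_KS$ is called a quasi-coherent algebra. $\mathbb{H}om_{\mathcal K}(\mathbb M,\mathbb M')(S):=\operatorname{Hom}_{\mathcal S}(\mathbb M_{|S},\mathbb M'_{|S})$ where $|S$ denotes restriction to commutative $S$-algebras, and $\mathbb M^*:=\mathbb{H}om_{\mathcal K}(\mathbb M,\mathcal K)$ (only functors for which these are sets are considered). $\mathbb M$ is reflexive if the canonical morphism $\mathbb M\to\mathbb M^{**}$ is an isomorphism. A functor of algebras $\mathbb A$ is a proquasi-coherent algebra if it is the inverse limit of its quasi-coherent algebra quotients (functors of algebras $\mathcal A_i$ that are quasi-coherent algebras, with an epimorphism of functors of algebras $\mathbb A\to\mathcal A_i$). For a functor of commutative $\mathcal K$-algebras $\mathbb A$, $(\operatorname{Spec}\mathbb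 A)(S):=\operatorname{Hom}_{\mathcal K\text{-alg}}(\mathbb A,\mathcal S)$. For a functor of sets $\mathbb X$, $\mathbb A_{\mathbb X}:=\mathbb{H}om(\mathbb X,\mathcal K)$, $\mathbb A_{\mathbb X}(S)=\operatorname{Hom}(\mathbb X_{|S},\mathcal K_{|S})$, is its functor of functions. $\mathbb X$ is an affine functor if $\mathbb A_{\mathbb X}$ is reflexive and the canonical morphism $\mathbb X\to\operatorname{Spec}\mathbb A_{\mathbb X}$, $x\mapsto(f\mapsto f(x))$, is an isomorphism. *)

theory Defs
  imports "HOL-Algebra.Module" "HOL-Algebra.Free_Abelian_Groups"
begin

text \<open>
  The universe is an arbitrary infinite type \<open>'u\<close>: the base field \<open>K\<close>, the commutative
  \<open>K\<close>-algebras on which the functors are defined, and the modules and algebras defining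
  quasi-coherent functors all have their carriers in \<open>'u\<close>.  The values of a functor may lie in
  any type, so that every functor of morphisms exists.  Maps between carriers that are
  collected in sets are taken extensional, so that equality of maps is equality of functions.
\<close>

section \<open>Algebras\<close>

type_synonym 'u alg = "('u, 'u) module"

text \<open>Associative unital algebras; the library's \<^term>\<open>algebra\<close> is the commutative notion.\<close>

definition assoc_algebra :: "('r, 'c) ring_scheme \<Rightarrow> ('r, 'a, 'd) module_scheme \<Rightarrow> bool" where
  "assoc_algebra R A \<longleftrightarrow> module R A \<and> ring A \<and>
     (\<forall>r\<in>carrier R. \<forall>x\<in>carrier A. \<forall>y\<in>carrier A.
        (r \<odot>\<^bsub>A\<^esub> x) \<otimes>\<^bsub>A\<^esub> y = r \<odot>\<^bsub>A\<^esub> (x \<otimes>\<^bsub>A\<^esub> y) \<and>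
        x \<otimes>\<^bsub>A\<^esub> (r \<odot>\<^bsub>A\<^esub> y) = r \<odot>\<^bsub>A\<^esub> (x \<otimes>\<^bsub>A\<^esub> y))"

definition linear_map ::
  "('r, 'c) ring_scheme \<Rightarrow> ('r, 'a, 'd) module_scheme \<Rightarrow> ('r, 'b, 'e) module_scheme \<Rightarrow>
   ('a \<Rightarrow> 'b) \<Rightarrow> bool" where
  "linear_map R M N f \<longleftrightarrow> f \<in> carrier M \<rightarrow> carrier N \<and>
     (\<forall>x\<in>carrier M. \<forall>y\<in>carrier M. f (x \<oplus>\<^bsub>M\<^esub> y) = f x \<oplus>\<^bsub>N\<^esub> f y) \<and>
     (\<forall>r\<in>carrier R. \<forall>x\<in>carrier M. f (r \<odot>\<^bsub>M\<^esub> x) = r \<odot>\<^bsub>N\<^esub> f x)"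

definition algebra_map ::
  "('r, 'c) ring_scheme \<Rightarrow> ('r, 'a, 'd) module_scheme \<Rightarrow> ('r, 'b, 'e) module_scheme \<Rightarrow>
   ('a \<Rightarrow> 'b) \<Rightarrow> bool" where
  "algebra_map R A B f \<longleftrightarrow> f \<in> ring_hom A B \<and> linear_map R A B f"

definition kalgs :: "'u ring \<Rightarrow> 'u alg set" where
  "kalgs K = {S. algebra K S}"

definition khom :: "'u ring \<Rightarrow> 'u alg \<Rightarrow> 'u alg \<Rightarrow> ('u \<Rightarrow> 'u) set" where
  "khom K S T = {h \<in> extensional (carrier S). algebra_map K S T h}"

text \<open>
  A commutative \<open>S\<close>-algebra is a commutative \<open>K\<close>-algebra \<open>T\<close> with a structure
  morphism \<open>h\<close> from \<open>S\<close> to \<open>T\<close>.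
\<close>

definition salgs :: "'u ring \<Rightarrow> 'u alg \<Rightarrow> ('u alg \<times> ('u \<Rightarrow> 'u)) set" where
  "salgs K S = {(T, h). T \<in> kalgs K \<and> h \<in> khom K S T}"


section \<open>Functors\<close>

text \<open>
  \<open>on_hom F S T h\<close> is the image under \<open>F\<close> of the morphism \<open>h\<close> from \<open>S\<close> to \<open>T\<close>.
  A functor of modules or of algebras takes values in module records; for functors of modules
  the fields \<^const>\<open>monoid.mult\<close> and \<^const>\<open>monoid.one\<close> of the values are irrelevant, as they are
  for the library's \<^term>\<open>module\<close>.
\<close>

record ('u, 'o, 'v) kfunctor =
  on_obj :: "'u alg \<Rightarrow> 'o"
  on_hom :: "'u alg \<Rightarrow> 'u alg \<Rightarrow> ('u \<Rightarrow> 'u) \<Rightarrow> 'v \<Rightarrow> 'v"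

type_synonym ('u, 'v) sfunctor = "('u, 'v set, 'v) kfunctor"
type_synonym ('u, 'v) mfunctor = "('u, ('u, 'v) module, 'v) kfunctor"

definition underlying :: "('u, 'v) mfunctor \<Rightarrow> ('u, 'v) sfunctor" where
  "underlying M = \<lparr>on_obj = (\<lambda>S. carrier (on_obj M S)), on_hom = on_hom M\<rparr>"

definition set_functor :: "'u ring \<Rightarrow> ('u, 'v) sfunctor \<Rightarrow> bool" where
  "set_functor K X \<longleftrightarrow>
     (\<forall>S\<in>kalgs K. \<forall>T\<in>kalgs K. \<forall>h\<in>khom K S T. on_hom X S T h \<in> on_obj X S \<rightarrow> on_obj X T) \<and>
     (\<forall>S\<in>kalgs K. \<forall>x\<in>on_obj X S. on_hom X S S (\<lambda>s\<in>carrier S. s) x = x) \<and>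
     (\<forall>S\<in>kalgs K. \<forall>T\<in>kalgs K. \<forall>U\<in>kalgs K. \<forall>h\<in>khom K S T. \<forall>g\<in>khom K T U. \<forall>x\<in>on_obj X S.
        on_hom X S U (compose (carrier S) g h) x = on_hom X T U g (on_hom X S T h x))"

definition module_functor :: "'u ring \<Rightarrow> ('u, 'v) mfunctor \<Rightarrow> bool" where
  "module_functor K M \<longleftrightarrow> set_functor K (underlying M) \<and>
     (\<forall>S\<in>kalgs K. module S (on_obj M S)) \<and>
     (\<forall>S\<in>kalgs K. \<forall>T\<in>kalgs K. \<forall>h\<in>khom K S T.
        (\<forall>x\<in>carrier (on_obj M S). \<forall>y\<in>carrier (on_obj M S).
           on_hom M S T h (x \<oplus>\<^bsub>on_obj M S\<^esub> y)
             = on_hom M S T h x \<oplus>\<^bsub>on_obj M T\<^esub> on_hom M S T h y) \<and>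
        (\<forall>s\<in>carrier S. \<forall>x\<in>carrier (on_obj M S).
           on_hom M S T h (s \<odot>\<^bsub>on_obj M S\<^esub> x) = h s \<odot>\<^bsub>on_obj M T\<^esub> on_hom M S T h x))"

definition algebra_functor :: "'u ring \<Rightarrow> ('u, 'v) mfunctor \<Rightarrow> bool" where
  "algebra_functor K A \<longleftrightarrow> module_functor K A \<and>
     (\<forall>S\<in>kalgs K. assoc_algebra S (on_obj A S)) \<and>
     (\<forall>S\<in>kalgs K. \<forall>T\<in>kalgs K. \<forall>h\<in>khom K S T.
        on_hom A S T h \<in> ring_hom (on_obj A S) (on_obj A T))"

definition comm_algebra_functor :: "'u ring \<Rightarrow> ('u, 'v) mfunctor \<Rightarrow> bool" where
  "comm_algebra_functor K A \<longleftrightarrow> algebra_functor K A \<and> (\<forall>S\<in>kalgs K. cring (on_obj A S))"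

definition set_morphism ::
  "'u ring \<Rightarrow> ('u, 'v) sfunctor \<Rightarrow> ('u, 'w) sfunctor \<Rightarrow> ('u alg \<Rightarrow> 'v \<Rightarrow> 'w) \<Rightarrow> bool" where
  "set_morphism K X Y \<phi> \<longleftrightarrow>
     (\<forall>S\<in>kalgs K. \<phi> S \<in> on_obj X S \<rightarrow> on_obj Y S) \<and>
     (\<forall>S\<in>kalgs K. \<forall>T\<in>kalgs K. \<forall>h\<in>khom K S T. \<forall>x\<in>on_obj X S.
        \<phi> T (on_hom X S T h x) = on_hom Y S T h (\<phi> S x))"

definition module_morphism ::
  "'u ring \<Rightarrow> ('u, 'v) mfunctor \<Rightarrow> ('u, 'w) mfunctor \<Rightarrow> ('u alg \<Rightarrow> 'v \<Rightarrow> 'w) \<Rightarrow> bool" where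
  "module_morphism K M N \<phi> \<longleftrightarrow> set_morphism K (underlying M) (underlying N) \<phi> \<and>
     (\<forall>S\<in>kalgs K. linear_map S (on_obj M S) (on_obj N S) (\<phi> S))"

definition algebra_morphism ::
  "'u ring \<Rightarrow> ('u, 'v) mfunctor \<Rightarrow> ('u, 'w) mfunctor \<Rightarrow> ('u alg \<Rightarrow> 'v \<Rightarrow> 'w) \<Rightarrow> bool" where
  "algebra_morphism K A B \<phi> \<longleftrightarrow> set_morphism K (underlying A) (underlying B) \<phi> \<and>
     (\<forall>S\<in>kalgs K. algebra_map S (on_obj A S) (on_obj B S) (\<phi> S))"

definition set_iso where
  "set_iso K X Y \<phi> \<longleftrightarrow> set_morphism K X Y \<phi> \<and>
     (\<forall>S\<in>kalgs K. bij_betw (\<phi> S) (on_obj X S) (on_obj Y S))"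

definition module_iso where
  "module_iso K M N \<phi> \<longleftrightarrow> module_morphism K M N \<phi> \<and>
     (\<forall>S\<in>kalgs K. bij_betw (\<phi> S) (carrier (on_obj M S)) (carrier (on_obj N S)))"

definition algebra_iso where
  "algebra_iso K A B \<phi> \<longleftrightarrow> algebra_morphism K A B \<phi> \<and>
     (\<forall>S\<in>kalgs K. bij_betw (\<phi> S) (carrier (on_obj A S)) (carrier (on_obj B S)))"


section \<open>Functors of morphisms\<close>

text \<open>The functor of rings \<open>\<K>\<close>, whose value at \<open>S\<close> is \<open>S\<close> as an algebra over itself.\<close>

definition base_functor :: "('u, 'u) mfunctor" where
  "base_functor = \<lparr>on_obj = (\<lambda>S. S\<lparr>smult := (\<otimes>\<^bsub>S\<^esub>)\<rparr>), on_hom = (\<lambda>S T h. h)\<rparr>"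

text \<open>
  Morphisms from \<open>X\<close> to \<open>Y\<close>, both restricted to commutative \<open>S\<close>-algebras: families
  indexed by the \<open>S\<close>-algebras.
\<close>

definition set_homs ::
  "'u ring \<Rightarrow> ('u, 'v) sfunctor \<Rightarrow> ('u, 'w) sfunctor \<Rightarrow> 'u alg \<Rightarrow>
   ('u alg \<times> ('u \<Rightarrow> 'u) \<Rightarrow> 'v \<Rightarrow> 'w) set" where
  "set_homs K X Y S =
     {\<phi> \<in> (\<Pi>\<^sub>E p\<in>salgs K S. on_obj X (fst p) \<rightarrow>\<^sub>E on_obj Y (fst p)).
        \<forall>T h T'. (T, h) \<in> salgs K S \<longrightarrow> T' \<in> kalgs K \<longrightarrow>
          (\<forall>g\<in>khom K T T'. \<forall>x\<in>on_obj X T.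
             \<phi> (T', compose (carrier S) g h) (on_hom X T T' g x) = on_hom Y T T' g (\<phi> (T, h) x))}"

definition module_homs ::
  "'u ring \<Rightarrow> ('u, 'v) mfunctor \<Rightarrow> ('u, 'w) mfunctor \<Rightarrow> 'u alg \<Rightarrow>
   ('u alg \<times> ('u \<Rightarrow> 'u) \<Rightarrow> 'v \<Rightarrow> 'w) set" where
  "module_homs K M N S =
     {\<phi> \<in> set_homs K (underlying M) (underlying N) S.
        \<forall>(T, h)\<in>salgs K S. linear_map T (on_obj M T) (on_obj N T) (\<phi> (T, h))}"

text \<open>
  The pointwise operations on a set \<open>H\<close> of such families.  When \<open>H\<close> consists of linear
  morphisms only the module part is meaningful.
\<close>

definition pointwise ::
  "'u ring \<Rightarrow> ('u, 'v) sfunctor \<Rightarrow> ('u, 'w) mfunctor \<Rightarrow> 'u alg \<Rightarrow>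
   ('u alg \<times> ('u \<Rightarrow> 'u) \<Rightarrow> 'v \<Rightarrow> 'w) set \<Rightarrow>
   ('u, 'u alg \<times> ('u \<Rightarrow> 'u) \<Rightarrow> 'v \<Rightarrow> 'w) module" where
  "pointwise K X N S H =
     \<lparr>carrier = H,
      mult = (\<lambda>\<phi> \<psi>. \<lambda>p\<in>salgs K S. \<lambda>x\<in>on_obj X (fst p). \<phi> p x \<otimes>\<^bsub>on_obj N (fst p)\<^esub> \<psi> p x),
      one = (\<lambda>p\<in>salgs K S. \<lambda>x\<in>on_obj X (fst p). \<one>\<^bsub>on_obj N (fst p)\<^esub>),
      ring.zero = (\<lambda>p\<in>salgs K S. \<lambda>x\<in>on_obj X (fst p). \<zero>\<^bsub>on_obj N (fst p)\<^esub>),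
      add = (\<lambda>\<phi> \<psi>. \<lambda>p\<in>salgs K S. \<lambda>x\<in>on_obj X (fst p). \<phi> p x \<oplus>\<^bsub>on_obj N (fst p)\<^esub> \<psi> p x),
      smult = (\<lambda>s \<phi>. \<lambda>p\<in>salgs K S. \<lambda>x\<in>on_obj X (fst p). snd p s \<odot>\<^bsub>on_obj N (fst p)\<^esub> \<phi> p x)\<rparr>"

definition base_change ::
  "'u ring \<Rightarrow> 'u alg \<Rightarrow> 'u alg \<Rightarrow> ('u \<Rightarrow> 'u) \<Rightarrow>
   ('u alg \<times> ('u \<Rightarrow> 'u) \<Rightarrow> 'v \<Rightarrow> 'w) \<Rightarrow> ('u alg \<times> ('u \<Rightarrow> 'u) \<Rightarrow> 'v \<Rightarrow> 'w)" where
  "base_change K S S' g \<phi> = (\<lambda>p\<in>salgs K S'. \<phi> (fst p, compose (carrier S) (snd p) g))"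

definition module_Hom ::
  "'u ring \<Rightarrow> ('u, 'v) mfunctor \<Rightarrow> ('u, 'w) mfunctor \<Rightarrow>
   ('u, 'u alg \<times> ('u \<Rightarrow> 'u) \<Rightarrow> 'v \<Rightarrow> 'w) mfunctor" where
  "module_Hom K M N =
     \<lparr>on_obj = (\<lambda>S. pointwise K (underlying M) N S (module_homs K M N S)),
      on_hom = base_change K\<rparr>"

definition dual ::
  "'u ring \<Rightarrow> ('u, 'v) mfunctor \<Rightarrow> ('u, 'u alg \<times> ('u \<Rightarrow> 'u) \<Rightarrow> 'v \<Rightarrow> 'u) mfunctor" where
  "dual K M = module_Hom K M base_functor"

definition to_bidual where
  "to_bidual K M S = (\<lambda>m\<in>carrier (on_obj M S). \<lambda>p\<in>salgs K S.
     \<lambda>w\<in>carrier (on_obj (dual K M) (fst p)).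
       w (fst p, \<lambda>t\<in>carrier (fst p). t) (on_hom M S (fst p) (snd p) m))"

definition reflexive :: "'u ring \<Rightarrow> ('u, 'v) mfunctor \<Rightarrow> bool" where
  "reflexive K M \<longleftrightarrow> module_functor K M \<and> module_iso K M (dual K (dual K M)) (to_bidual K M)"

text \<open>The functor of functions \<open>\<A>\<close> of a functor of sets \<open>X\<close>.\<close>

definition function_algebra ::
  "'u ring \<Rightarrow> ('u, 'v) sfunctor \<Rightarrow> ('u, 'u alg \<times> ('u \<Rightarrow> 'u) \<Rightarrow> 'v \<Rightarrow> 'u) mfunctor" where
  "function_algebra K X =
     \<lparr>on_obj = (\<lambda>S. pointwise K X base_functor S (set_homs K X (underlying base_functor) S)),
      on_hom = base_change K\<rparr>"


section \<open>Tensor products and quasi-coherent functors\<close>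

text \<open>
  \<open>M \<otimes> N\<close> over \<open>K\<close> is the quotient of the free abelian group on pairs by the usual
  relations.  To obtain an object of the category again, its classes are named by elements of
  \<open>'u\<close> through an arbitrarily chosen quotient map \<open>tensor_class\<close>; such a map exists because
  \<open>'u\<close> is infinite (lemma \<open>tensor_class_eq_iff\<close>).  The operations are those induced
  by formulas on formal sums.
\<close>

definition formal_sums :: "'u alg \<Rightarrow> 'u alg \<Rightarrow> ('u \<times> 'u \<Rightarrow>\<^sub>0 int) monoid" where
  "formal_sums M N = free_Abelian_group (carrier M \<times> carrier N)"

definition tensor_relations :: "'u ring \<Rightarrow> 'u alg \<Rightarrow> 'u alg \<Rightarrow> ('u \<times> 'u \<Rightarrow>\<^sub>0 int) set" where
  "tensor_relations K M N =
     {frag_of (x \<oplus>\<^bsub>M\<^esub> x', y) - frag_of (x, y) - frag_of (x', y) | x x' y.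
        x \<in> carrier M \<and> x' \<in> carrier M \<and> y \<in> carrier N} \<union>
     {frag_of (x, y \<oplus>\<^bsub>N\<^esub> y') - frag_of (x, y) - frag_of (x, y') | x y y'.
        x \<in> carrier M \<and> y \<in> carrier N \<and> y' \<in> carrier N} \<union>
     {frag_of (k \<odot>\<^bsub>M\<^esub> x, y) - frag_of (x, k \<odot>\<^bsub>N\<^esub> y) | k x y.
        k \<in> carrier K \<and> x \<in> carrier M \<and> y \<in> carrier N}"

definition tensor_kernel :: "'u ring \<Rightarrow> 'u alg \<Rightarrow> 'u alg \<Rightarrow> ('u \<times> 'u \<Rightarrow>\<^sub>0 int) set" where
  "tensor_kernel K M N = generate (formal_sums M N) (tensor_relations K M N)"

definition tensor_class :: "'u ring \<Rightarrow> 'u alg \<Rightarrow> 'u alg \<Rightarrow> ('u \<times> 'u \<Rightarrow>\<^sub>0 int) \<Rightarrow> 'u" where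
  "tensor_class K M N = (SOME q. \<forall>u\<in>carrier (formal_sums M N). \<forall>v\<in>carrier (formal_sums M N).
     q u = q v \<longleftrightarrow> u - v \<in> tensor_kernel K M N)"

definition tensor_rep :: "'u ring \<Rightarrow> 'u alg \<Rightarrow> 'u alg \<Rightarrow> 'u \<Rightarrow> ('u \<times> 'u \<Rightarrow>\<^sub>0 int)" where
  "tensor_rep K M N = inv_into (carrier (formal_sums M N)) (tensor_class K M N)"

definition tensor_map ::
  "'u ring \<Rightarrow> 'u alg \<Rightarrow> 'u alg \<Rightarrow> 'u alg \<Rightarrow> 'u alg \<Rightarrow> ('u \<Rightarrow> 'u) \<Rightarrow> ('u \<Rightarrow> 'u) \<Rightarrow> 'u \<Rightarrow> 'u" where
  "tensor_map K M N M' N' f g z =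
     tensor_class K M' N' (frag_extend (\<lambda>(x, y). frag_of (f x, g y)) (tensor_rep K M N z))"

definition tensor :: "'u ring \<Rightarrow> 'u alg \<Rightarrow> 'u alg \<Rightarrow> 'u alg" where
  "tensor K M N =
     \<lparr>carrier = tensor_class K M N ` carrier (formal_sums M N),
      mult = (\<lambda>z w. tensor_class K M N
        (frag_extend (\<lambda>(x, y). frag_extend (\<lambda>(x', y'). frag_of (x \<otimes>\<^bsub>M\<^esub> x', y \<otimes>\<^bsub>N\<^esub> y'))
          (tensor_rep K M N w)) (tensor_rep K M N z))),
      one = tensor_class K M N (frag_of (\<one>\<^bsub>M\<^esub>, \<one>\<^bsub>N\<^esub>)),
      ring.zero = tensor_class K M N 0,
      add = (\<lambda>z w. tensor_class K M N (tensor_rep K M N z + tensor_rep K M N w)),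
      smult = (\<lambda>k. tensor_map K M N M N (\<lambda>x. k \<odot>\<^bsub>M\<^esub> x) (\<lambda>y. y))\<rparr>"

definition tensor_left :: "'u ring \<Rightarrow> 'u alg \<Rightarrow> 'u alg \<Rightarrow> 'u \<Rightarrow> 'u" where
  "tensor_left K S T = (\<lambda>s\<in>carrier S. tensor_class K S T (frag_of (s, \<one>\<^bsub>T\<^esub>)))"

definition tensor_right :: "'u ring \<Rightarrow> 'u alg \<Rightarrow> 'u alg \<Rightarrow> 'u \<Rightarrow> 'u" where
  "tensor_right K S T = (\<lambda>t\<in>carrier T. tensor_class K S T (frag_of (\<one>\<^bsub>S\<^esub>, t)))"

text \<open>The multiplication map from \<open>T \<otimes> T\<close> to \<open>T\<close>.\<close>

definition tensor_codiagonal :: "'u ring \<Rightarrow> 'u alg \<Rightarrow> 'u \<Rightarrow> 'u" where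
  "tensor_codiagonal K T z =
     (\<Oplus>\<^bsub>T\<^esub>p\<in>Poly_Mapping.keys (tensor_rep K T T z).
        [Poly_Mapping.lookup (tensor_rep K T T z) p] \<cdot>\<^bsub>T\<^esub> (fst p \<otimes>\<^bsub>T\<^esub> snd p))"

text \<open>The quasi-coherent functor of \<open>M\<close>, with value \<open>M \<otimes> S\<close> as an \<open>S\<close>-module at \<open>S\<close>.\<close>

definition quasi_coherent :: "'u ring \<Rightarrow> 'u alg \<Rightarrow> ('u, 'u) mfunctor" where
  "quasi_coherent K M =
     \<lparr>on_obj = (\<lambda>S. (tensor K M S)\<lparr>smult := (\<lambda>s. tensor_map K M S M S (\<lambda>x. x) (\<lambda>t. s \<otimes>\<^bsub>S\<^esub> t))\<rparr>),
      on_hom = (\<lambda>S T h. tensor_map K M S M T (\<lambda>x. x) h)\<rparr>"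


section \<open>Proquasi-coherent algebras\<close>

text \<open>Epimorphisms are the morphisms that are surjective at every algebra.\<close>

definition algebra_quotients ::
  "'u ring \<Rightarrow> ('u, 'v) mfunctor \<Rightarrow> ('u alg \<times> ('u alg \<Rightarrow> 'v \<Rightarrow> 'u)) set" where
  "algebra_quotients K A =
     {(B, \<pi>). assoc_algebra K B \<and>
        \<pi> \<in> (\<Pi>\<^sub>E S\<in>kalgs K. carrier (on_obj A S) \<rightarrow>\<^sub>E carrier (on_obj (quasi_coherent K B) S)) \<and>
        algebra_morphism K A (quasi_coherent K B) \<pi> \<and>
        (\<forall>S\<in>kalgs K. \<pi> S ` carrier (on_obj A S) = carrier (on_obj (quasi_coherent K B) S))}"

text \<open>Morphisms of quotients, that is, morphisms of functors of algebras under \<open>A\<close>.\<close>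

definition quotient_morphism where
  "quotient_morphism K A i j \<tau> \<longleftrightarrow>
     algebra_morphism K (quasi_coherent K (fst i)) (quasi_coherent K (fst j)) \<tau> \<and>
     (\<forall>S\<in>kalgs K. \<forall>a\<in>carrier (on_obj A S). \<tau> S (snd i S a) = snd j S a)"

definition limit_of_quotients ::
  "'u ring \<Rightarrow> ('u, 'v) mfunctor \<Rightarrow> ('u, 'u alg \<times> ('u alg \<Rightarrow> 'v \<Rightarrow> 'u) \<Rightarrow> 'u) mfunctor" where
  "limit_of_quotients K A =
     (let Q = algebra_quotients K A; V = (\<lambda>i. on_obj (quasi_coherent K (fst i))) in
     \<lparr>on_obj = (\<lambda>S.
        \<lparr>carrier = {c \<in> (\<Pi>\<^sub>E i\<in>Q. carrier (V i S)).
           \<forall>i\<in>Q. \<forall>j\<in>Q. \<forall>\<tau>. quotient_morphism K A i j \<tau> \<longrightarrow> \<tau> S (c i) = c j},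
         mult = (\<lambda>c d. \<lambda>i\<in>Q. c i \<otimes>\<^bsub>V i S\<^esub> d i),
         one = (\<lambda>i\<in>Q. \<one>\<^bsub>V i S\<^esub>),
         ring.zero = (\<lambda>i\<in>Q. \<zero>\<^bsub>V i S\<^esub>),
         add = (\<lambda>c d. \<lambda>i\<in>Q. c i \<oplus>\<^bsub>V i S\<^esub> d i),
         smult = (\<lambda>s c. \<lambda>i\<in>Q. s \<odot>\<^bsub>V i S\<^esub> c i)\<rparr>),
      on_hom = (\<lambda>S T h c. \<lambda>i\<in>Q. on_hom (quasi_coherent K (fst i)) S T h (c i))\<rparr>)"

definition proquasi_coherent :: "'u ring \<Rightarrow> ('u, 'v) mfunctor \<Rightarrow> bool" where
  "proquasi_coherent K A \<longleftrightarrow> algebra_functor K A \<and>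
     algebra_iso K A (limit_of_quotients K A) (\<lambda>S a. \<lambda>i\<in>algebra_quotients K A. snd i S a)"


section \<open>Spectra and affine functors\<close>

definition Spec ::
  "'u ring \<Rightarrow> ('u, 'v) mfunctor \<Rightarrow> ('u, 'u alg \<Rightarrow> 'v \<Rightarrow> 'u) sfunctor" where
  "Spec K A =
     \<lparr>on_obj = (\<lambda>S.
        {\<phi> \<in> (\<Pi>\<^sub>E T\<in>kalgs K. carrier (on_obj A T) \<rightarrow>\<^sub>E carrier (on_obj (quasi_coherent K S) T)).
           algebra_morphism K A (quasi_coherent K S) \<phi>}),
      on_hom = (\<lambda>S S' g \<phi>. \<lambda>T\<in>kalgs K. \<lambda>a\<in>carrier (on_obj A T).
        tensor_map K S T S' T g (\<lambda>t. t) (\<phi> T a))\<rparr>"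

text \<open>
  The morphism from \<open>X\<close> to the spectrum of its functions sends \<open>x \<in> X(S)\<close> to \<open>f \<mapsto> f(x)\<close>.
  For a function \<open>f\<close> defined over \<open>T\<close>, the value \<open>f(x) \<in> S \<otimes> T\<close> is obtained
  by evaluating \<open>f\<close> at the \<open>T\<close>-algebra \<open>S \<otimes> T\<close> on the image of \<open>x\<close> in
  \<open>X(S \<otimes> T)\<close>.
\<close>

definition to_Spec_functions where
  "to_Spec_functions K X S x =
     (\<lambda>T\<in>kalgs K. \<lambda>f\<in>carrier (on_obj (function_algebra K X) T).
        f (tensor K S T, tensor_right K S T) (on_hom X S (tensor K S T) (tensor_left K S T) x))"

text \<open>
  The morphism from \<open>A\<close> to the functions on its spectrum sends \<open>a \<in> A(S)\<close> to
  \<open>x \<mapsto> x(a)\<close>.  For a point \<open>x\<close> with values in an \<open>S\<close>-algebra \<open>T\<close>, the map \<open>x\<close> at \<open>T\<close>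
  takes the image of \<open>a\<close> in \<open>A(T)\<close> to \<open>T \<otimes> T\<close>, which is multiplied into \<open>T\<close>.
\<close>

definition to_functions_Spec where
  "to_functions_Spec K A S a =
     (\<lambda>p\<in>salgs K S. \<lambda>x\<in>on_obj (Spec K A) (fst p).
        tensor_codiagonal K (fst p) (x (fst p) (on_hom A S (fst p) (snd p) a)))"

definition affine_functor :: "'u ring \<Rightarrow> ('u, 'v) sfunctor \<Rightarrow> bool" where
  "affine_functor K X \<longleftrightarrow> set_functor K X \<and> reflexive K (function_algebra K X) \<and>
     set_iso K X (Spec K (function_algebra K X)) (to_Spec_functions K X)"


section \<open>Adequacy of the tensor product\<close>

lemma carrier_formal_sums_lepoll:
  fixes M N :: "'u alg"
  assumes "infinite (UNIV :: 'u set)"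
  shows "carrier (formal_sums M N) \<lesssim> (UNIV :: 'u set)"
proof -
  have sq: "(UNIV :: 'u set) \<times> (UNIV :: 'u set) \<approx> (UNIV :: 'u set)"
    using card_of_Times_same_infinite[OF assms] eqpoll_iff_card_of_ordIso by blast
  have inf: "infinite ((UNIV :: 'u set) \<times> (UNIV :: 'u set))"
    using assms by (simp add: finite_prod)
  have "carrier (formal_sums M N) \<subseteq> carrier (free_Abelian_group ((UNIV :: 'u set) \<times> UNIV))"
    by (auto simp: formal_sums_def)
  then have "carrier (formal_sums M N) \<lesssim> carrier (free_Abelian_group ((UNIV :: 'u set) \<times> (UNIV :: 'u set)))"
    by (rule subset_imp_lepoll)
  also have "\<dots> \<approx> (UNIV :: 'u set) \<times> (UNIV :: 'u set)"
    by (rule eqpoll_free_Abelian_group_infinite[OF inf])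
  also note sq
  finally show ?thesis .
qed

lemma subgroup_tensor_kernel:
  assumes "module K M" "module K N"
  shows "subgroup (tensor_kernel K M N) (formal_sums M N)"
proof -
  interpret M: module K M by fact
  interpret N: module K N by fact
  have diff: "u - v \<in> carrier (formal_sums M N)"
    if "u \<in> carrier (formal_sums M N)" "v \<in> carrier (formal_sums M N)" for u v
    using that keys_diff[of u v] by (auto simp: formal_sums_def)
  have gen: "frag_of (x, y) \<in> carrier (formal_sums M N)"
    if "x \<in> carrier M" "y \<in> carrier N" for x y
    using that by (simp add: formal_sums_def)
  have "tensor_relations K M N \<subseteq> carrier (formal_sums M N)"
    unfolding tensor_relations_def by (auto intro!: diff gen)
  moreover have "group (formal_sums M N)"
    by (simp add: formal_sums_def)
  ultimately show ?thesis
    unfolding tensor_kernel_def by (intro group.generate_is_subgroup)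
qed

lemma tensor_class_eq_iff:
  fixes M N :: "'u alg"
  assumes inf: "infinite (UNIV :: 'u set)" and mods: "module K M" "module K N"
    and uv: "u \<in> carrier (formal_sums M N)" "v \<in> carrier (formal_sums M N)"
  shows "tensor_class K M N u = tensor_class K M N v \<longleftrightarrow> u - v \<in> tensor_kernel K M N"
proof -
  let ?F = "carrier (formal_sums M N)" and ?I = "tensor_kernel K M N"
  obtain f :: "('u \<times> 'u \<Rightarrow>\<^sub>0 int) \<Rightarrow> 'u" where f: "inj_on f ?F"
    using carrier_formal_sums_lepoll[OF inf] unfolding lepoll_def by blast
  interpret I: subgroup ?I "formal_sums M N"
    using subgroup_tensor_kernel[OF mods] .
  have zero: "0 \<in> ?I"
    using I.one_closed by (simp add: formal_sums_def)
  have add: "x + y \<in> ?I" if "x \<in> ?I" "y \<in> ?I" for x y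
    using I.m_closed[OF that] by (simp add: formal_sums_def)
  have minus: "- x \<in> ?I" if "x \<in> ?I" for x
    using I.m_inv_closed[OF that] I.mem_carrier[OF that] by (simp add: formal_sums_def)
  define c where "c u = (SOME w. w \<in> ?F \<and> u - w \<in> ?I)" for u
  have c: "c u \<in> ?F \<and> u - c u \<in> ?I" if "u \<in> ?F" for u
    unfolding c_def by (rule someI[of _ u]) (use that zero in simp)
  have "f (c u) = f (c v) \<longleftrightarrow> u - v \<in> ?I" if u: "u \<in> ?F" and v: "v \<in> ?F" for u v
  proof
    assume "f (c u) = f (c v)"
    then have "c u = c v"
      using f c[OF u] c[OF v] by (auto dest: inj_onD)
    then have "(u - c u) + - (v - c v) = u - v"
      by simp
    then show "u - v \<in> ?I"
      using add[OF _ minus, of "u - c u" "v - c v"] c[OF u] c[OF v] by simp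
  next
    assume d: "u - v \<in> ?I"
    have "u - w \<in> ?I \<longleftrightarrow> v - w \<in> ?I" for w
    proof
      assume "u - w \<in> ?I"
      then have "(u - w) + - (u - v) \<in> ?I" by (intro add minus d)
      then show "v - w \<in> ?I" by simp
    next
      assume "v - w \<in> ?I"
      then have "(v - w) + (u - v) \<in> ?I" by (intro add d)
      then show "u - w \<in> ?I" by simp
    qed
    then show "f (c u) = f (c v)"
      by (simp add: c_def)
  qed
  then have "\<exists>q :: _ \<Rightarrow> 'u. \<forall>u\<in>?F. \<forall>v\<in>?F. q u = q v \<longleftrightarrow> u - v \<in> ?I"
    by (intro exI[of _ "\<lambda>u. f (c u)"]) blast
  from someI_ex[OF this] show ?thesis
    unfolding tensor_class_def using uv by blast
qed

end

theory Submission
  imports Defs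
begin

text \<open>
  The proof rests on one property of a reflexive functor \<open>A\<close>: an element \<open>a\<close> of \<open>A(S)\<close> can be
  pushed forward along every \<open>K\<close>-linear map \<open>l\<close> from \<open>S\<close> to \<open>K\<close>. Indeed \<open>A\<close> is the dual of its
  dual, and \<open>w \<mapsto> l(w(a))\<close> is a linear form on the dual. Hence a linear form on \<open>A\<close> that
  vanishes on \<open>A(K)\<close> vanishes, and since \<open>K\<close> is a field, the image of a morphism from \<open>A\<close> to a
  quasi-coherent module \<open>V\<close> is the quasi-coherent submodule generated by the image of \<open>A(K)\<close>.

  So every point \<open>x\<close> of \<open>Spec A\<close> with values in \<open>T\<close> factors through a quasi-coherent quotient \<open>B\<close> of
  \<open>A\<close> with \<open>B \<subseteq> T\<close>. A function \<open>f\<close> over \<open>S\<close> on \<open>Spec A\<close> is therefore the same as a compatible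
  family of elements of \<open>B \<otimes> S\<close>, its values at the universal points of the quotients \<open>B\<close>; that
  is, the functions on \<open>Spec A\<close> are the limit of the quasi-coherent quotients of \<open>A\<close>. This gives
  both statements: in the first the limit is \<open>A\<close> by hypothesis, in the second \<open>A\<close> is the functor of
  functions on \<open>X = Spec A\<close>.
\<close>

section \<open>Tensor products\<close>

text \<open>That \<open>K\<close> is a field enters through functionals that separate a vector from
  a subspace. They also show that \<open>W \<otimes> S\<close> embeds into
  \<open>V \<otimes> S\<close> for a submodule \<open>W\<close> of \<open>V\<close>, so that a point
  can be factored through its image by inverting an inclusion.

  The limit runs over all quasi-coherent quotients and all morphisms between them, with no
  directedness assumed, and a point \<open>x\<close> may factor through many quotients. A value at
  \<open>x\<close> read off from a point of the limit must not depend on the quotient that is used.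
  The image \<open>B\<close> of \<open>x\<close> settles this: every quotient through which
  \<open>x\<close> factors has a morphism to \<open>B\<close> under \<open>A\<close>, and
  compatibility along that single morphism suffices.

  A quotient \<open>(B, \<pi>)\<close> is itself a point of \<open>Spec A\<close> with values in
  \<open>B\<close>. Evaluating a function over \<open>S\<close> at its extension to
  \<open>B \<otimes> S\<close> inverts the passage from the limit to functions; in the second
  statement affineness turns this point into one of \<open>X\<close>. Finally, \<open>A\<close> and
  the functions on \<open>Spec A\<close> have values in different types, so reflexivity is carried
  over along the isomorphism.\<close>

definition additive_map where
  "additive_map G H f \<longleftrightarrow> f \<in> carrier G \<rightarrow> carrier H \<and>
     (\<forall>x\<in>carrier G. \<forall>y\<in>carrier G. f (x \<oplus>\<^bsub>G\<^esub> y) = f x \<oplus>\<^bsub>H\<^esub> f y)"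

text \<open>The last condition only moves scalars across, so the target need only be an abelian
  group. Linearity over \<open>K\<close>, or over \<open>S\<close> for quasi-coherent functors, is
  checked afterwards on pure tensors.\<close>

definition balanced_map where
  "balanced_map R M N P \<beta> \<longleftrightarrow>
     (\<forall>x\<in>carrier M. \<forall>y\<in>carrier N. \<beta> x y \<in> carrier P) \<and>
     (\<forall>x\<in>carrier M. \<forall>x'\<in>carrier M. \<forall>y\<in>carrier N. \<beta> (x \<oplus>\<^bsub>M\<^esub> x') y = \<beta> x y \<oplus>\<^bsub>P\<^esub> \<beta> x' y) \<and>
     (\<forall>x\<in>carrier M. \<forall>y\<in>carrier N. \<forall>y'\<in>carrier N. \<beta> x (y \<oplus>\<^bsub>N\<^esub> y') = \<beta> x y \<oplus>\<^bsub>P\<^esub> \<beta> x y') \<and>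
     (\<forall>k\<in>carrier R. \<forall>x\<in>carrier M. \<forall>y\<in>carrier N. \<beta> (k \<odot>\<^bsub>M\<^esub> x) y = \<beta> x (k \<odot>\<^bsub>N\<^esub> y))"

lemma additive_mapD:
  assumes "additive_map G H f" "x \<in> carrier G"
  shows additive_map_closed: "f x \<in> carrier H"
    and additive_map_add: "y \<in> carrier G \<Longrightarrow> f (x \<oplus>\<^bsub>G\<^esub> y) = f x \<oplus>\<^bsub>H\<^esub> f y"
  using assms by (auto simp: additive_map_def)

lemma additive_map_group_hom:
  assumes "additive_map G H f" "abelian_group G" "abelian_group H"
  shows "group_hom (add_monoid G) (add_monoid H) f"
proof -
  interpret G: abelian_group G by fact
  interpret H: abelian_group H by fact
  show ?thesis
    using assms(1) G.a_group H.a_group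
    by (auto simp: group_hom_def group_hom_axioms_def hom_def additive_map_def)
qed

lemma additive_map_zero:
  assumes "additive_map G H f" "abelian_group G" "abelian_group H"
  shows "f \<zero>\<^bsub>G\<^esub> = \<zero>\<^bsub>H\<^esub>"
  using group_hom.hom_one[OF additive_map_group_hom[OF assms]] by simp

lemma additive_map_minus:
  assumes "additive_map G H f" "abelian_group G" "abelian_group H" "x \<in> carrier G"
  shows "f (\<ominus>\<^bsub>G\<^esub> x) = \<ominus>\<^bsub>H\<^esub> f x"
  using group_hom.hom_inv[OF additive_map_group_hom[OF assms(1-3)], of x] assms(4)
  by (simp add: a_inv_def)

lemma additive_map_compose:
  "additive_map G H f \<Longrightarrow> additive_map H I g \<Longrightarrow> additive_map G I (\<lambda>x. g (f x))"
  by (auto simp: additive_map_def Pi_iff)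

lemma linear_map_additive: "linear_map R M N f \<Longrightarrow> additive_map M N f"
  by (simp add: linear_map_def additive_map_def)

lemma linear_mapD:
  assumes "linear_map R M N f" "x \<in> carrier M"
  shows linear_map_closed: "f x \<in> carrier N"
    and linear_map_add: "y \<in> carrier M \<Longrightarrow> f (x \<oplus>\<^bsub>M\<^esub> y) = f x \<oplus>\<^bsub>N\<^esub> f y"
    and linear_map_smult: "r \<in> carrier R \<Longrightarrow> f (r \<odot>\<^bsub>M\<^esub> x) = r \<odot>\<^bsub>N\<^esub> f x"
  using assms by (auto simp: linear_map_def)

lemma linear_map_id: "linear_map R M M (\<lambda>x. x)"
  by (simp add: linear_map_def)

lemma linear_map_compose:
  "linear_map R M N f \<Longrightarrow> linear_map R N P g \<Longrightarrow> linear_map R M P (\<lambda>x. g (f x))"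
  by (auto simp: linear_map_def Pi_iff)

lemma frag_extend_keys:
  assumes "\<And>x. x \<in> Poly_Mapping.keys u \<Longrightarrow> Poly_Mapping.keys (b x) \<subseteq> S"
  shows "Poly_Mapping.keys (frag_extend b u) \<subseteq> S"
  using keys_frag_extend[of b u] assms by fastforce

section \<open>The tensor product as an abelian group\<close>

locale base_field =
  fixes K :: "'u ring"
  assumes infinite_universe: "infinite (UNIV :: 'u set)" and field_K: "field K"
begin

abbreviation fsum where "fsum M N \<equiv> carrier (formal_sums M N)"
abbreviation tp where "tp M N x y \<equiv> tensor_class K M N (frag_of (x, y))"
abbreviation tensor_prod (infixl "\<otimes>\<^sub>K" 70) where "M \<otimes>\<^sub>K N \<equiv> tensor K M N"

lemma cring_K: "cring K"
  using field_K by (simp add: field_def domain_def)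

lemma fsum_iff: "u \<in> fsum M N \<longleftrightarrow> Poly_Mapping.keys u \<subseteq> carrier M \<times> carrier N"
  by (simp add: formal_sums_def)

lemma fsum_add: "u \<in> fsum M N \<Longrightarrow> v \<in> fsum M N \<Longrightarrow> u + v \<in> fsum M N"
  unfolding fsum_iff using keys_add[of u v] by blast

lemma fsum_diff: "u \<in> fsum M N \<Longrightarrow> v \<in> fsum M N \<Longrightarrow> u - v \<in> fsum M N"
  unfolding fsum_iff using keys_diff[of u v] by blast

lemma fsum_minus: "u \<in> fsum M N \<Longrightarrow> - u \<in> fsum M N"
  unfolding fsum_iff by simp

lemma fsum_zero: "0 \<in> fsum M N"
  unfolding fsum_iff by simp

lemma fsum_of: "x \<in> carrier M \<Longrightarrow> y \<in> carrier N \<Longrightarrow> frag_of (x, y) \<in> fsum M N"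
  unfolding fsum_iff by simp

lemmas fsum_intros = fsum_add fsum_diff fsum_minus fsum_zero fsum_of

lemma group_formal_sums: "group (formal_sums M N)"
  by (simp add: formal_sums_def)

lemma formal_sums_mult [simp]: "u \<otimes>\<^bsub>formal_sums M N\<^esub> v = u + v"
  by (simp add: formal_sums_def)

lemma hom_fsum:
  assumes "abelian_group P" "h \<in> hom (formal_sums M N) (add_monoid P)"
  shows "u \<in> fsum M N \<Longrightarrow> h u \<in> carrier P"
    and "u \<in> fsum M N \<Longrightarrow> v \<in> fsum M N \<Longrightarrow> h (u + v) = h u \<oplus>\<^bsub>P\<^esub> h v"
    and "u \<in> fsum M N \<Longrightarrow> h (- u) = \<ominus>\<^bsub>P\<^esub> h u"
    and "u \<in> fsum M N \<Longrightarrow> v \<in> fsum M N \<Longrightarrow> h (u - v) = h u \<ominus>\<^bsub>P\<^esub> h v"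
    and "h 0 = \<zero>\<^bsub>P\<^esub>"
proof -
  interpret P: abelian_group P by fact
  interpret h: group_hom "formal_sums M N" "add_monoid P" h
    using assms(2) P.a_group group_formal_sums by (simp add: group_hom_def group_hom_axioms_def)
  show c: "u \<in> fsum M N \<Longrightarrow> h u \<in> carrier P" for u
    using h.hom_closed[of u] by simp
  show a: "u \<in> fsum M N \<Longrightarrow> v \<in> fsum M N \<Longrightarrow> h (u + v) = h u \<oplus>\<^bsub>P\<^esub> h v" for u v
    using h.hom_mult[of u v] by simp
  show m: "u \<in> fsum M N \<Longrightarrow> h (- u) = \<ominus>\<^bsub>P\<^esub> h u" for u
    using h.hom_inv[of u] by (simp add: a_inv_def formal_sums_def)
  show "u \<in> fsum M N \<Longrightarrow> v \<in> fsum M N \<Longrightarrow> h (u - v) = h u \<ominus>\<^bsub>P\<^esub> h v"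
    using a[of u "- v"] m[of v] by (simp add: a_minus_def fsum_minus)
  show "h 0 = \<zero>\<^bsub>P\<^esub>"
    using h.hom_one by (simp add: formal_sums_def)
qed

text \<open>The three kinds of relations correspond to the three equations of
  \<open>balanced_map\<close>, so each of them is killed by \<open>h\<close>; the kernel of
  \<open>h\<close> is a subgroup and thus contains all that they generate.\<close>

lemma hom_fsum_kernel:
  assumes P: "abelian_group P" and h: "h \<in> hom (formal_sums M N) (add_monoid P)"
    and bal: "balanced_map K M N P (\<lambda>x y. h (frag_of (x, y)))"
    and mods: "module K M" "module K N"
    and u: "u \<in> tensor_kernel K M N"
  shows "h u = \<zero>\<^bsub>P\<^esub>"
proof -
  interpret P: abelian_group P by fact
  interpret M: module K M by fact
  interpret N: module K N by fact
  note hs = hom_fsum[OF P h]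
  interpret h: group_hom "formal_sums M N" "add_monoid P" h
    using h P.a_group group_formal_sums by (simp add: group_hom_def group_hom_axioms_def)
  have [simp]: "a \<ominus>\<^bsub>P\<^esub> a = \<zero>\<^bsub>P\<^esub>" if "a \<in> carrier P" for a
    using that by (simp add: P.minus_eq P.r_neg)
  have *: "(a \<oplus>\<^bsub>P\<^esub> b) \<ominus>\<^bsub>P\<^esub> a \<ominus>\<^bsub>P\<^esub> b = \<zero>\<^bsub>P\<^esub>" if "a \<in> carrier P" "b \<in> carrier P" for a b
    using that by (metis P.add.m_comm P.add.m_closed P.minus_eq P.r_neg P.add.inv_solve_right P.a_inv_closed)
  have "tensor_relations K M N \<subseteq> kernel (formal_sums M N) (add_monoid P) h"
    using bal unfolding tensor_relations_def balanced_map_def kernel_def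
    by (auto simp: hs fsum_intros *)
  then have "tensor_kernel K M N \<subseteq> kernel (formal_sums M N) (add_monoid P) h"
    unfolding tensor_kernel_def
    by (rule group.generate_subgroup_incl[OF group_formal_sums _ h.subgroup_kernel])
  then show ?thesis
    using u by (auto simp: kernel_def)
qed

context
  fixes M N :: "'u alg"
  assumes modM: "module K M" and modN: "module K N"
begin

interpretation M: module K M by (rule modM)
interpretation N: module K N by (rule modN)

lemma class_eq_iff:
  "u \<in> fsum M N \<Longrightarrow> v \<in> fsum M N \<Longrightarrow>
     tensor_class K M N u = tensor_class K M N v \<longleftrightarrow> u - v \<in> tensor_kernel K M N"
  by (rule tensor_class_eq_iff[OF infinite_universe modM modN])

lemma rep_closed: "z \<in> carrier (M \<otimes>\<^sub>K N) \<Longrightarrow> tensor_rep K M N z \<in> fsum M N"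
  by (simp add: tensor_def tensor_rep_def inv_into_into)

lemma class_rep: "z \<in> carrier (M \<otimes>\<^sub>K N) \<Longrightarrow> tensor_class K M N (tensor_rep K M N z) = z"
  by (simp add: tensor_def tensor_rep_def f_inv_into_f)

lemma class_closed: "u \<in> fsum M N \<Longrightarrow> tensor_class K M N u \<in> carrier (M \<otimes>\<^sub>K N)"
  by (simp add: tensor_def)

lemma kernel_add: "u \<in> tensor_kernel K M N \<Longrightarrow> v \<in> tensor_kernel K M N \<Longrightarrow> u + v \<in> tensor_kernel K M N"
  using subgroup.m_closed[OF subgroup_tensor_kernel[OF modM modN]] by simp

text \<open>The representative chosen for the class of \<open>u\<close> need not be
  \<open>u\<close>, but it stays in the same coset of the kernel. Operations given by formulas on
  representatives are well defined for this reason.\<close>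

lemma rep_class:
  assumes "u \<in> fsum M N"
  shows "tensor_rep K M N (tensor_class K M N u) \<in> fsum M N"
    and "tensor_rep K M N (tensor_class K M N u) - u \<in> tensor_kernel K M N"
proof -
  show r: "tensor_rep K M N (tensor_class K M N u) \<in> fsum M N"
    by (intro rep_closed class_closed assms)
  show "tensor_rep K M N (tensor_class K M N u) - u \<in> tensor_kernel K M N"
    using class_rep[OF class_closed[OF assms]] class_eq_iff[OF r assms] by simp
qed

lemma class_add:
  assumes "u \<in> fsum M N" "v \<in> fsum M N"
  shows "tensor_class K M N u \<oplus>\<^bsub>M \<otimes>\<^sub>K N\<^esub> tensor_class K M N v = tensor_class K M N (u + v)"
proof -
  let ?r = "\<lambda>u. tensor_rep K M N (tensor_class K M N u)"
  note r = rep_class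
  have "(?r u - u) + (?r v - v) \<in> tensor_kernel K M N"
    using r assms kernel_add by blast
  moreover have "(?r u - u) + (?r v - v) = (?r u + ?r v) - (u + v)"
    by simp
  ultimately have "tensor_class K M N (?r u + ?r v) = tensor_class K M N (u + v)"
    using r assms by (subst class_eq_iff) (auto intro: fsum_add)
  then show ?thesis
    by (simp add: tensor_def)
qed

lemma class_zero: "\<zero>\<^bsub>M \<otimes>\<^sub>K N\<^esub> = tensor_class K M N 0"
  by (simp add: tensor_def)

lemma tensor_carrierE:
  assumes "z \<in> carrier (M \<otimes>\<^sub>K N)"
  obtains u where "u \<in> fsum M N" "z = tensor_class K M N u"
  using assms by (auto simp: tensor_def)

lemma abelian_group_tensor: "abelian_group (M \<otimes>\<^sub>K N)"
proof (rule abelian_groupI)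
  fix x assume "x \<in> carrier (M \<otimes>\<^sub>K N)"
  then obtain u where u: "u \<in> fsum M N" "x = tensor_class K M N u"
    by (rule tensor_carrierE)
  show "\<exists>y\<in>carrier (M \<otimes>\<^sub>K N). y \<oplus>\<^bsub>M \<otimes>\<^sub>K N\<^esub> x = \<zero>\<^bsub>M \<otimes>\<^sub>K N\<^esub>"
    by (rule bexI[of _ "tensor_class K M N (- u)"])
       (simp_all add: u class_add class_zero fsum_intros class_closed)
qed (auto elim!: tensor_carrierE simp: class_add class_zero fsum_intros class_closed add_ac)

lemma tp_closed: "x \<in> carrier M \<Longrightarrow> y \<in> carrier N \<Longrightarrow> tp M N x y \<in> carrier (M \<otimes>\<^sub>K N)"
  by (intro class_closed fsum_of)

lemma kernel_generators:
  "c \<in> tensor_relations K M N \<Longrightarrow> c \<in> tensor_kernel K M N"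
  unfolding tensor_kernel_def by (rule generate.incl)

lemma tp_add_left:
  assumes "x \<in> carrier M" "x' \<in> carrier M" "y \<in> carrier N"
  shows "tp M N (x \<oplus>\<^bsub>M\<^esub> x') y = tp M N x y \<oplus>\<^bsub>M \<otimes>\<^sub>K N\<^esub> tp M N x' y"
proof -
  have "frag_of (x \<oplus>\<^bsub>M\<^esub> x', y) - frag_of (x, y) - frag_of (x', y) \<in> tensor_kernel K M N"
    using assms by (intro kernel_generators) (auto simp: tensor_relations_def)
  then show ?thesis
    using assms by (simp add: class_add fsum_of class_eq_iff fsum_intros diff_diff_eq)
qed

lemma tp_add_right:
  assumes "x \<in> carrier M" "y \<in> carrier N" "y' \<in> carrier N"
  shows "tp M N x (y \<oplus>\<^bsub>N\<^esub> y') = tp M N x y \<oplus>\<^bsub>M \<otimes>\<^sub>K N\<^esub> tp M N x y'"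
proof -
  have "frag_of (x, y \<oplus>\<^bsub>N\<^esub> y') - frag_of (x, y) - frag_of (x, y') \<in> tensor_kernel K M N"
    using assms by (intro kernel_generators) (auto simp: tensor_relations_def)
  then show ?thesis
    using assms by (simp add: class_add fsum_of class_eq_iff fsum_intros diff_diff_eq)
qed

lemma tp_smult:
  assumes "k \<in> carrier K" "x \<in> carrier M" "y \<in> carrier N"
  shows "tp M N (k \<odot>\<^bsub>M\<^esub> x) y = tp M N x (k \<odot>\<^bsub>N\<^esub> y)"
proof -
  have "frag_of (k \<odot>\<^bsub>M\<^esub> x, y) - frag_of (x, k \<odot>\<^bsub>N\<^esub> y) \<in> tensor_kernel K M N"
    using assms by (intro kernel_generators) (auto simp: tensor_relations_def)
  then show ?thesis
    using assms by (simp add: fsum_of class_eq_iff)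
qed

lemma balanced_tp: "balanced_map K M N (M \<otimes>\<^sub>K N) (tp M N)"
  by (simp add: balanced_map_def tp_closed tp_add_left tp_add_right tp_smult)

lemma tp_zero:
  assumes "x \<in> carrier M" "y \<in> carrier N"
  shows "tp M N \<zero>\<^bsub>M\<^esub> y = \<zero>\<^bsub>M \<otimes>\<^sub>K N\<^esub>" "tp M N x \<zero>\<^bsub>N\<^esub> = \<zero>\<^bsub>M \<otimes>\<^sub>K N\<^esub>"
proof -
  interpret T: abelian_group "M \<otimes>\<^sub>K N" by (rule abelian_group_tensor)
  have "additive_map M (M \<otimes>\<^sub>K N) (\<lambda>x. tp M N x y)" "additive_map N (M \<otimes>\<^sub>K N) (tp M N x)"
    using assms by (auto simp: additive_map_def tp_closed tp_add_left tp_add_right)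
  then show "tp M N \<zero>\<^bsub>M\<^esub> y = \<zero>\<^bsub>M \<otimes>\<^sub>K N\<^esub>" "tp M N x \<zero>\<^bsub>N\<^esub> = \<zero>\<^bsub>M \<otimes>\<^sub>K N\<^esub>"
    using additive_map_zero T.abelian_group_axioms M.abelian_group_axioms N.abelian_group_axioms by blast+
qed

lemma tp_minus_left:
  assumes "x \<in> carrier M" "y \<in> carrier N"
  shows "tp M N (\<ominus>\<^bsub>M\<^esub> x) y = \<ominus>\<^bsub>M \<otimes>\<^sub>K N\<^esub> tp M N x y"
proof -
  have "additive_map M (M \<otimes>\<^sub>K N) (\<lambda>x. tp M N x y)"
    using assms by (auto simp: additive_map_def tp_closed tp_add_left)
  from additive_map_minus[OF this M.abelian_group_axioms abelian_group_tensor assms(1)] show ?thesis .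
qed

lemma class_minus: "u \<in> fsum M N \<Longrightarrow> tensor_class K M N (- u) = \<ominus>\<^bsub>M \<otimes>\<^sub>K N\<^esub> tensor_class K M N u"
proof -
  interpret T: abelian_group "M \<otimes>\<^sub>K N" by (rule abelian_group_tensor)
  assume "u \<in> fsum M N"
  then show ?thesis
    by (intro T.minus_equality[symmetric]) (simp_all add: class_add class_zero class_closed fsum_intros)
qed

text \<open>There is no case for zero or negatives: both are absorbed by pure tensors, since
  \<open>0 = 0 \<otimes> 0\<close> and \<open>- (x \<otimes> y) = (- x) \<otimes> y\<close>.\<close>

lemma tensor_induct [consumes 1, case_names pure add]:
  assumes "z \<in> carrier (M \<otimes>\<^sub>K N)"
    and pure: "\<And>x y. x \<in> carrier M \<Longrightarrow> y \<in> carrier N \<Longrightarrow> Q (tp M N x y)"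
    and add: "\<And>z w. z \<in> carrier (M \<otimes>\<^sub>K N) \<Longrightarrow> w \<in> carrier (M \<otimes>\<^sub>K N) \<Longrightarrow> Q z \<Longrightarrow> Q w \<Longrightarrow>
                Q (z \<oplus>\<^bsub>M \<otimes>\<^sub>K N\<^esub> w)"
  shows "Q z"
proof -
  obtain u where u: "u \<in> fsum M N" "z = tensor_class K M N u"
    using assms(1) by (rule tensor_carrierE)
  have "Poly_Mapping.keys u \<subseteq> carrier M \<times> carrier N"
    using u by (simp add: fsum_iff)
  \<comment> \<open>\<open>frag_induction\<close> builds formal sums by differences, so the property
    is carried along for \<open>u\<close> and \<open>- u\<close> together.\<close>
  then have "u \<in> fsum M N \<and> Q (tensor_class K M N u) \<and> Q (tensor_class K M N (- u))"
  proof (induction u rule: frag_induction)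
    case zero
    show ?case
      using pure[OF M.zero_closed N.zero_closed] tp_zero(1)[OF M.zero_closed N.zero_closed]
      by (simp add: fsum_intros flip: class_zero)
  next
    case (one p)
    then obtain x y where p: "p = (x, y)" "x \<in> carrier M" "y \<in> carrier N" by auto
    have "Q (tp M N (\<ominus>\<^bsub>M\<^esub> x) y)"
      using p by (intro pure) auto
    then show ?case
      using p pure[of x y] by (simp add: fsum_of tp_minus_left class_minus)
  next
    case (diff a b)
    have "Q (tensor_class K M N (a + - b))" "Q (tensor_class K M N (b + - a))"
      using diff add[of "tensor_class K M N a" "tensor_class K M N (- b)"]
        add[of "tensor_class K M N b" "tensor_class K M N (- a)"]
      by (simp_all add: class_add class_closed fsum_intros)
    then show ?case
      using diff by (simp add: fsum_diff)
  qed
  then show ?thesis using u by simp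
qed

text \<open>Only additivity is required of the two maps, so this serves maps that are linear over
  \<open>K\<close> and over \<open>S\<close> alike.\<close>

lemma tensor_eqI:
  assumes "additive_map (M \<otimes>\<^sub>K N) P f" "additive_map (M \<otimes>\<^sub>K N) P g"
    and "\<And>x y. x \<in> carrier M \<Longrightarrow> y \<in> carrier N \<Longrightarrow> f (tp M N x y) = g (tp M N x y)"
    and "z \<in> carrier (M \<otimes>\<^sub>K N)"
  shows "f z = g z"
  using assms(4) by (induction rule: tensor_induct) (simp_all add: assms additive_mapD[OF assms(1)] additive_mapD[OF assms(2)])

text \<open>Multiplication by a fixed element, \<open>tensor_map\<close> and
  \<open>tensor_codiagonal\<close> all have the form \<open>h (tensor_rep K M N z)\<close> for a
  homomorphism \<open>h\<close> on formal sums. Once \<open>h\<close> is balanced on generators it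
  does not see the choice made by \<open>tensor_rep\<close>, since that choice varies only within a
  coset of the kernel.\<close>

lemma hom_rep:
  assumes P: "abelian_group P" and h: "h \<in> hom (formal_sums M N) (add_monoid P)"
    and bal: "balanced_map K M N P (\<lambda>x y. h (frag_of (x, y)))" and u: "u \<in> fsum M N"
  shows "h (tensor_rep K M N (tensor_class K M N u)) = h u"
proof -
  interpret P: abelian_group P by fact
  let ?r = "tensor_rep K M N (tensor_class K M N u)"
  have r: "?r \<in> fsum M N" "?r - u \<in> tensor_kernel K M N"
    using rep_class[OF u] by auto
  then have "h (?r - u) = \<zero>\<^bsub>P\<^esub>"
    using hom_fsum_kernel[OF P h bal modM modN] by simp
  then have "h ?r \<ominus>\<^bsub>P\<^esub> h u = \<zero>\<^bsub>P\<^esub>"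
    using hom_fsum(4)[OF P h r(1) u] by simp
  moreover have "h ?r \<in> carrier P" "h u \<in> carrier P"
    using hom_fsum(1)[OF P h] r u by blast+
  ultimately show ?thesis
    using P.minus_equality[of "h ?r" "\<ominus>\<^bsub>P\<^esub> h u"] by (simp add: P.minus_eq)
qed

lemma hom_rep_additive:
  assumes P: "abelian_group P" and h: "h \<in> hom (formal_sums M N) (add_monoid P)"
    and bal: "balanced_map K M N P (\<lambda>x y. h (frag_of (x, y)))"
  shows "additive_map (M \<otimes>\<^sub>K N) P (\<lambda>z. h (tensor_rep K M N z))"
  unfolding additive_map_def
  by (auto elim!: tensor_carrierE
      simp: class_add hom_rep[OF assms] fsum_intros hom_fsum[OF P h])

text \<open>The homomorphism on formal sums comes from the universal property of the free abelian
  group; composed with \<open>tensor_rep\<close> it becomes additive on the tensor product.\<close>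

lemma tensor_lift:
  assumes P: "abelian_group P" and bal: "balanced_map K M N P \<beta>"
  obtains L where "additive_map (M \<otimes>\<^sub>K N) P L"
    "\<And>x y. x \<in> carrier M \<Longrightarrow> y \<in> carrier N \<Longrightarrow> L (tp M N x y) = \<beta> x y"
proof -
  interpret P: abelian_group P by fact
  obtain h where h: "h \<in> hom (formal_sums M N) (add_monoid P)"
    and hb: "\<And>p. p \<in> carrier M \<times> carrier N \<Longrightarrow> h (frag_of p) = case_prod \<beta> p"
  proof (rule comm_group.free_Abelian_group_universal[OF P.a_comm_group, of "case_prod \<beta>" "carrier M \<times> carrier N"])
    show "case_prod \<beta> ` (carrier M \<times> carrier N) \<subseteq> carrier (add_monoid P)"
      using bal by (auto simp: balanced_map_def)
  qed (auto simp: formal_sums_def)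
  have bal': "balanced_map K M N P (\<lambda>x y. h (frag_of (x, y)))"
    using bal by (simp add: hb balanced_map_def)
  show ?thesis
    using that[OF hom_rep_additive[OF P h bal']] by (simp add: hom_rep[OF P h bal'] fsum_of hb)
qed

end

end

section \<open>Associative algebras and tensor products of linear maps\<close>

lemma assoc_algebraD:
  assumes "assoc_algebra R A"
  shows "module R A" "ring A"
    "\<And>r x y. r \<in> carrier R \<Longrightarrow> x \<in> carrier A \<Longrightarrow> y \<in> carrier A \<Longrightarrow>
       (r \<odot>\<^bsub>A\<^esub> x) \<otimes>\<^bsub>A\<^esub> y = r \<odot>\<^bsub>A\<^esub> (x \<otimes>\<^bsub>A\<^esub> y)"
    "\<And>r x y. r \<in> carrier R \<Longrightarrow> x \<in> carrier A \<Longrightarrow> y \<in> carrier A \<Longrightarrow>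
       x \<otimes>\<^bsub>A\<^esub> (r \<odot>\<^bsub>A\<^esub> y) = r \<odot>\<^bsub>A\<^esub> (x \<otimes>\<^bsub>A\<^esub> y)"
  using assms by (auto simp: assoc_algebra_def)

lemma algebra_imp_assoc_algebra:
  assumes "algebra R A"
  shows "assoc_algebra R A"
proof -
  interpret algebra R A by fact
  show ?thesis
    unfolding assoc_algebra_def
  proof (intro conjI ballI)
    fix r x y assume [simp]: "r \<in> carrier R" "x \<in> carrier A" "y \<in> carrier A"
    show "(r \<odot>\<^bsub>A\<^esub> x) \<otimes>\<^bsub>A\<^esub> y = r \<odot>\<^bsub>A\<^esub> (x \<otimes>\<^bsub>A\<^esub> y)"
      by (simp add: smult_assoc2)
    then show "x \<otimes>\<^bsub>A\<^esub> (r \<odot>\<^bsub>A\<^esub> y) = r \<odot>\<^bsub>A\<^esub> (x \<otimes>\<^bsub>A\<^esub> y)"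
      using smult_assoc2[of r y x] by (simp add: m_comm)
  qed (use is_cring in \<open>simp_all add: module_axioms cring_def\<close>)
qed

lemma linear_map_mult_left:
  assumes "assoc_algebra R A" "x \<in> carrier A"
  shows "linear_map R A A (\<lambda>y. x \<otimes>\<^bsub>A\<^esub> y)"
proof -
  interpret ring A by (rule assoc_algebraD[OF assms(1)])
  show ?thesis
    using assms assoc_algebraD[OF assms(1)] by (auto simp: linear_map_def r_distr)
qed

lemma linear_map_smult_module:
  assumes "module R A" "r \<in> carrier R"
  shows "linear_map R A A (\<lambda>y. r \<odot>\<^bsub>A\<^esub> y)"
proof -
  interpret module R A by fact
  show ?thesis
    using assms(2) by (auto simp: linear_map_def smult_r_distr R.m_comm simp flip: smult_assoc1)
qed

context base_field
begin

context
  fixes M N M' N' :: "'u alg" and f g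
  assumes mods: "module K M" "module K N" "module K M'" "module K N'"
    and fg: "linear_map K M M' f" "linear_map K N N' g"
begin

lemma tensor_map_aux:
  defines "h \<equiv> \<lambda>u. tensor_class K M' N' (frag_extend (\<lambda>(x, y). frag_of (f x, g y)) u)"
  shows "h \<in> hom (formal_sums M N) (add_monoid (M' \<otimes>\<^sub>K N'))"
    and "h (frag_of (x, y)) = tp M' N' (f x) (g y)"
    and "balanced_map K M N (M' \<otimes>\<^sub>K N') (\<lambda>x y. h (frag_of (x, y)))"
proof -
  have cl: "frag_extend (\<lambda>(x, y). frag_of (f x, g y)) u \<in> fsum M' N'" if "u \<in> fsum M N" for u
    using that linear_map_closed[OF fg(1)] linear_map_closed[OF fg(2)] unfolding fsum_iff
    by (intro frag_extend_keys) auto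
  show "h \<in> hom (formal_sums M N) (add_monoid (M' \<otimes>\<^sub>K N'))"
    by (auto simp: hom_def h_def class_closed[OF mods(3,4)] class_add[OF mods(3,4)] cl frag_extend_add)
  show h: "h (frag_of (x, y)) = tp M' N' (f x) (g y)" for x y
    by (simp add: h_def)
  show "balanced_map K M N (M' \<otimes>\<^sub>K N') (\<lambda>x y. h (frag_of (x, y)))"
    unfolding h
    using balanced_tp[OF mods(3,4)] linear_mapD[OF fg(1)] linear_mapD[OF fg(2)]
    by (auto simp: balanced_map_def)
qed

lemma additive_tensor_map: "additive_map (M \<otimes>\<^sub>K N) (M' \<otimes>\<^sub>K N') (tensor_map K M N M' N' f g)"
  using hom_rep_additive[OF mods(1,2) abelian_group_tensor[OF mods(3,4)] tensor_map_aux(1,3)]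
  by (simp add: tensor_map_def[abs_def])

lemma tensor_map_tp:
  "x \<in> carrier M \<Longrightarrow> y \<in> carrier N \<Longrightarrow> tensor_map K M N M' N' f g (tp M N x y) = tp M' N' (f x) (g y)"
  using hom_rep[OF mods(1,2) abelian_group_tensor[OF mods(3,4)] tensor_map_aux(1,3) fsum_of]
  by (simp add: tensor_map_def)

lemmas tensor_map_closed = additive_map_closed[OF additive_tensor_map]
lemmas tensor_map_add = additive_map_add[OF additive_tensor_map]

end

lemma tensor_map_compose:
  assumes "module K M" "module K N" "module K M'" "module K N'" "module K M''" "module K N''"
    "linear_map K M M' f" "linear_map K N N' g" "linear_map K M' M'' f'" "linear_map K N' N'' g'"
    "z \<in> carrier (M \<otimes>\<^sub>K N)"
  shows "tensor_map K M' N' M'' N'' f' g' (tensor_map K M N M' N' f g z) =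
    tensor_map K M N M'' N'' (\<lambda>x. f' (f x)) (\<lambda>y. g' (g y)) z"
proof (rule tensor_eqI[OF assms(1,2) _ _ _ assms(11)])
  note l = linear_map_compose[OF assms(7,9)] linear_map_compose[OF assms(8,10)]
  show "additive_map (M \<otimes>\<^sub>K N) (M'' \<otimes>\<^sub>K N'') (\<lambda>z. tensor_map K M' N' M'' N'' f' g' (tensor_map K M N M' N' f g z))"
    by (intro additive_map_compose[OF additive_tensor_map additive_tensor_map] assms)
  show "additive_map (M \<otimes>\<^sub>K N) (M'' \<otimes>\<^sub>K N'') (tensor_map K M N M'' N'' (\<lambda>x. f' (f x)) (\<lambda>y. g' (g y)))"
    by (intro additive_tensor_map l assms)
  show "tensor_map K M' N' M'' N'' f' g' (tensor_map K M N M' N' f g (tp M N x y)) =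
      tensor_map K M N M'' N'' (\<lambda>x. f' (f x)) (\<lambda>y. g' (g y)) (tp M N x y)"
    if "x \<in> carrier M" "y \<in> carrier N" for x y
    using that assms l by (simp add: tensor_map_tp linear_map_closed)
qed

lemma tensor_map_cong:
  assumes "module K M" "module K N" "module K M'" "module K N'"
    "linear_map K M M' f" "linear_map K N N' g" "linear_map K M M' f'" "linear_map K N N' g'"
    and "\<And>x. x \<in> carrier M \<Longrightarrow> f x = f' x" "\<And>y. y \<in> carrier N \<Longrightarrow> g y = g' y"
    "z \<in> carrier (M \<otimes>\<^sub>K N)"
  shows "tensor_map K M N M' N' f g z = tensor_map K M N M' N' f' g' z"
  by (rule tensor_eqI[OF assms(1,2) additive_tensor_map additive_tensor_map _ assms(11)])
     (simp_all add: assms tensor_map_tp)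

lemma tensor_map_id:
  assumes "module K M" "module K N" "z \<in> carrier (M \<otimes>\<^sub>K N)"
    "\<And>x. x \<in> carrier M \<Longrightarrow> f x = x" "\<And>y. y \<in> carrier N \<Longrightarrow> g y = y"
  shows "tensor_map K M N M N f g z = z"
proof -
  have l: "linear_map K M M f" "linear_map K N N g"
  proof -
    interpret M: module K M by fact
    interpret N: module K N by fact
    show "linear_map K M M f" "linear_map K N N g"
      using assms(4,5) by (auto simp: linear_map_def)
  qed
  have "additive_map (M \<otimes>\<^sub>K N) (M \<otimes>\<^sub>K N) (\<lambda>z. z)"
    by (simp add: additive_map_def)
  then show ?thesis
    by (rule tensor_eqI[OF assms(1,2) additive_tensor_map _ _ assms(3), of _ _ f g, rotated 6])
       (simp_all add: assms l tensor_map_tp)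
qed

section \<open>The algebra structure on a tensor product\<close>

context
  fixes M N :: "'u alg"
  assumes algM: "assoc_algebra K M" and algN: "assoc_algebra K N"
begin

interpretation M: module K M by (rule assoc_algebraD[OF algM])
interpretation N: module K N by (rule assoc_algebraD[OF algN])
interpretation M: ring M by (rule assoc_algebraD[OF algM])
interpretation N: ring N by (rule assoc_algebraD[OF algN])

lemmas mMN = M.module_axioms N.module_axioms

interpretation T: abelian_group "M \<otimes>\<^sub>K N"
  by (rule abelian_group_tensor[OF mMN])

lemmas tp_simps = tp_closed[OF mMN] tp_add_left[OF mMN] tp_add_right[OF mMN] tp_smult[OF mMN]

text \<open>Left multiplication by the pure tensor \<open>x \<otimes> y\<close>, written as a tensor
  product of linear maps; additivity in the argument is then already known.\<close>

abbreviation (input) mult_map where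
  "mult_map x y \<equiv> tensor_map K M N M N (\<lambda>x'. x \<otimes>\<^bsub>M\<^esub> x') (\<lambda>y'. y \<otimes>\<^bsub>N\<^esub> y')"

lemma additive_mult_map:
  "x \<in> carrier M \<Longrightarrow> y \<in> carrier N \<Longrightarrow> additive_map (M \<otimes>\<^sub>K N) (M \<otimes>\<^sub>K N) (mult_map x y)"
  by (intro additive_tensor_map linear_map_mult_left mMN algM algN)

lemma mult_map_tp:
  "\<lbrakk>x \<in> carrier M; y \<in> carrier N; x' \<in> carrier M; y' \<in> carrier N\<rbrakk> \<Longrightarrow>
     mult_map x y (tp M N x' y') = tp M N (x \<otimes>\<^bsub>M\<^esub> x') (y \<otimes>\<^bsub>N\<^esub> y')"
  by (intro tensor_map_tp linear_map_mult_left mMN algM algN)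

text \<open>The equations in \<open>x\<close> and \<open>y\<close> are additive in \<open>w\<close>,
  so they need only be checked for pure \<open>w\<close>, where they express distributivity and the
  compatibility of multiplication with scalars.\<close>

lemma balanced_mult_map:
  assumes w: "w \<in> carrier (M \<otimes>\<^sub>K N)"
  shows "balanced_map K M N (M \<otimes>\<^sub>K N) (\<lambda>x y. mult_map x y w)"
  unfolding balanced_map_def
proof (intro conjI ballI)
  note am = additive_map_add[OF additive_mult_map] additive_map_closed[OF additive_mult_map]
  note k = assoc_algebraD(3,4)[OF algM] assoc_algebraD(3,4)[OF algN]
  show "mult_map x y w \<in> carrier (M \<otimes>\<^sub>K N)" if "x \<in> carrier M" "y \<in> carrier N" for x y
    using w that by (rule am(2)[rotated 2])
  show "mult_map (x \<oplus>\<^bsub>M\<^esub> x') y w = mult_map x y w \<oplus>\<^bsub>M \<otimes>\<^sub>K N\<^esub> mult_map x' y w"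
    if "x \<in> carrier M" "x' \<in> carrier M" "y \<in> carrier N" for x x' y
    using w that
    by (induction rule: tensor_induct[OF mMN, consumes 1])
       (simp_all add: mult_map_tp M.l_distr tp_simps am T.a_ac)
  show "mult_map x (y \<oplus>\<^bsub>N\<^esub> y') w = mult_map x y w \<oplus>\<^bsub>M \<otimes>\<^sub>K N\<^esub> mult_map x y' w"
    if "x \<in> carrier M" "y \<in> carrier N" "y' \<in> carrier N" for x y y'
    using w that
    by (induction rule: tensor_induct[OF mMN, consumes 1])
       (simp_all add: mult_map_tp N.l_distr tp_simps am T.a_ac)
  show "mult_map (c \<odot>\<^bsub>M\<^esub> x) y w = mult_map x (c \<odot>\<^bsub>N\<^esub> y) w"
    if "c \<in> carrier K" "x \<in> carrier M" "y \<in> carrier N" for c x y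
    using w that
    by (induction rule: tensor_induct[OF mMN, consumes 1])
       (simp_all add: mult_map_tp k tp_simps am)
qed

text \<open>The product in the definition is a double sum over representatives of both factors. For
  fixed \<open>w\<close> the inner sum is \<open>mult_map x y w\<close>, which identifies right
  multiplication by \<open>w\<close> with the additive map induced by a balanced map.\<close>

lemma tensor_mult_aux:
  assumes w: "w \<in> carrier (M \<otimes>\<^sub>K N)"
  defines "h \<equiv> \<lambda>u. tensor_class K M N
        (frag_extend (\<lambda>(x, y). frag_extend (\<lambda>(x', y'). frag_of (x \<otimes>\<^bsub>M\<^esub> x', y \<otimes>\<^bsub>N\<^esub> y'))
          (tensor_rep K M N w)) u)"
  shows "h \<in> hom (formal_sums M N) (add_monoid (M \<otimes>\<^sub>K N))"
    and "h (frag_of (x, y)) = mult_map x y w"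
proof -
  have r: "Poly_Mapping.keys (tensor_rep K M N w) \<subseteq> carrier M \<times> carrier N"
    using rep_closed[OF mMN w] by (simp add: fsum_iff)
  have cl: "frag_extend (\<lambda>(x, y). frag_extend (\<lambda>(x', y'). frag_of (x \<otimes>\<^bsub>M\<^esub> x', y \<otimes>\<^bsub>N\<^esub> y'))
      (tensor_rep K M N w)) u \<in> fsum M N" if "u \<in> fsum M N" for u
  proof -
    have "Poly_Mapping.keys (frag_extend (\<lambda>(x', y'). frag_of (x \<otimes>\<^bsub>M\<^esub> x', y \<otimes>\<^bsub>N\<^esub> y')) (tensor_rep K M N w))
        \<subseteq> carrier M \<times> carrier N" if "x \<in> carrier M" "y \<in> carrier N" for x y
      using r that by (intro frag_extend_keys) auto
    then show ?thesis
      using that unfolding fsum_iff by (intro frag_extend_keys) auto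
  qed
  show "h \<in> hom (formal_sums M N) (add_monoid (M \<otimes>\<^sub>K N))"
    by (auto simp: hom_def h_def class_closed[OF mMN] class_add[OF mMN] cl frag_extend_add)
  show "h (frag_of (x, y)) = mult_map x y w"
    by (simp add: h_def tensor_map_def)
qed

lemma tensor_mult_eq:
  "z \<otimes>\<^bsub>M \<otimes>\<^sub>K N\<^esub> w = tensor_class K M N
        (frag_extend (\<lambda>(x, y). frag_extend (\<lambda>(x', y'). frag_of (x \<otimes>\<^bsub>M\<^esub> x', y \<otimes>\<^bsub>N\<^esub> y'))
          (tensor_rep K M N w)) (tensor_rep K M N z))"
  by (simp add: tensor_def)

lemma additive_tensor_mult_right:
  assumes "w \<in> carrier (M \<otimes>\<^sub>K N)"
  shows "additive_map (M \<otimes>\<^sub>K N) (M \<otimes>\<^sub>K N) (\<lambda>z. z \<otimes>\<^bsub>M \<otimes>\<^sub>K N\<^esub> w)"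
  using hom_rep_additive[OF mMN T.abelian_group_axioms tensor_mult_aux(1)[OF assms]]
    balanced_mult_map[OF assms] unfolding tensor_mult_aux(2)[OF assms] tensor_mult_eq by blast

lemma tensor_mult_pure_left:
  assumes "w \<in> carrier (M \<otimes>\<^sub>K N)" "x \<in> carrier M" "y \<in> carrier N"
  shows "tp M N x y \<otimes>\<^bsub>M \<otimes>\<^sub>K N\<^esub> w = mult_map x y w"
  using hom_rep[OF mMN T.abelian_group_axioms tensor_mult_aux(1)[OF assms(1)] _ fsum_of[OF assms(2,3)]]
    balanced_mult_map[OF assms(1)] unfolding tensor_mult_aux(2)[OF assms(1)] tensor_mult_eq by blast

lemma tp_mult:
  "\<lbrakk>x \<in> carrier M; y \<in> carrier N; x' \<in> carrier M; y' \<in> carrier N\<rbrakk> \<Longrightarrow>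
     tp M N x y \<otimes>\<^bsub>M \<otimes>\<^sub>K N\<^esub> tp M N x' y' = tp M N (x \<otimes>\<^bsub>M\<^esub> x') (y \<otimes>\<^bsub>N\<^esub> y')"
  by (simp add: tensor_mult_pure_left mult_map_tp tp_simps)

lemma tensor_mult_closed:
  "z \<in> carrier (M \<otimes>\<^sub>K N) \<Longrightarrow> w \<in> carrier (M \<otimes>\<^sub>K N) \<Longrightarrow> z \<otimes>\<^bsub>M \<otimes>\<^sub>K N\<^esub> w \<in> carrier (M \<otimes>\<^sub>K N)"
  by (rule additive_map_closed[OF additive_tensor_mult_right])

lemma tensor_l_distr:
  "\<lbrakk>z \<in> carrier (M \<otimes>\<^sub>K N); z' \<in> carrier (M \<otimes>\<^sub>K N); w \<in> carrier (M \<otimes>\<^sub>K N)\<rbrakk> \<Longrightarrow>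
    (z \<oplus>\<^bsub>M \<otimes>\<^sub>K N\<^esub> z') \<otimes>\<^bsub>M \<otimes>\<^sub>K N\<^esub> w = z \<otimes>\<^bsub>M \<otimes>\<^sub>K N\<^esub> w \<oplus>\<^bsub>M \<otimes>\<^sub>K N\<^esub> z' \<otimes>\<^bsub>M \<otimes>\<^sub>K N\<^esub> w"
  by (rule additive_map_add[OF additive_tensor_mult_right])

lemma tensor_r_distr:
  assumes "z \<in> carrier (M \<otimes>\<^sub>K N)" "w \<in> carrier (M \<otimes>\<^sub>K N)" "w' \<in> carrier (M \<otimes>\<^sub>K N)"
  shows "z \<otimes>\<^bsub>M \<otimes>\<^sub>K N\<^esub> (w \<oplus>\<^bsub>M \<otimes>\<^sub>K N\<^esub> w') = z \<otimes>\<^bsub>M \<otimes>\<^sub>K N\<^esub> w \<oplus>\<^bsub>M \<otimes>\<^sub>K N\<^esub> z \<otimes>\<^bsub>M \<otimes>\<^sub>K N\<^esub> w'"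
  using assms
  by (induction rule: tensor_induct[OF mMN, consumes 1])
     (simp_all add: tensor_mult_pure_left additive_map_add[OF additive_mult_map] tensor_l_distr
       tensor_mult_closed T.a_ac)

lemma tensor_one: "\<one>\<^bsub>M \<otimes>\<^sub>K N\<^esub> = tp M N \<one>\<^bsub>M\<^esub> \<one>\<^bsub>N\<^esub>"
  by (simp add: tensor_def)

lemma ring_tensor: "ring (M \<otimes>\<^sub>K N)"
proof (rule ringI[OF T.abelian_group_axioms])
  show "Group.monoid (M \<otimes>\<^sub>K N)"
  proof (rule monoidI)
    fix z w v assume z: "z \<in> carrier (M \<otimes>\<^sub>K N)" and w: "w \<in> carrier (M \<otimes>\<^sub>K N)" and v: "v \<in> carrier (M \<otimes>\<^sub>K N)"
    \<comment> \<open>Associativity is extended from pure tensors one factor at a time, from the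
      right: \<open>v\<close>, then \<open>w\<close>, then \<open>z\<close>.\<close>
    have 1: "(tp M N a b \<otimes>\<^bsub>M \<otimes>\<^sub>K N\<^esub> tp M N c d) \<otimes>\<^bsub>M \<otimes>\<^sub>K N\<^esub> v = tp M N a b \<otimes>\<^bsub>M \<otimes>\<^sub>K N\<^esub> (tp M N c d \<otimes>\<^bsub>M \<otimes>\<^sub>K N\<^esub> v)"
      if "a \<in> carrier M" "b \<in> carrier N" "c \<in> carrier M" "d \<in> carrier N" for a b c d
      using v that by (induction rule: tensor_induct[OF mMN, consumes 1])
        (simp_all add: tp_mult M.m_assoc N.m_assoc tensor_r_distr tensor_mult_closed tp_simps)
    have 2: "(tp M N a b \<otimes>\<^bsub>M \<otimes>\<^sub>K N\<^esub> w) \<otimes>\<^bsub>M \<otimes>\<^sub>K N\<^esub> v = tp M N a b \<otimes>\<^bsub>M \<otimes>\<^sub>K N\<^esub> (w \<otimes>\<^bsub>M \<otimes>\<^sub>K N\<^esub> v)"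
      if "a \<in> carrier M" "b \<in> carrier N" for a b
      using w that v by (induction rule: tensor_induct[OF mMN, consumes 1])
        (simp_all add: 1 tensor_r_distr tensor_l_distr tensor_mult_closed tp_simps)
    show "z \<otimes>\<^bsub>M \<otimes>\<^sub>K N\<^esub> w \<otimes>\<^bsub>M \<otimes>\<^sub>K N\<^esub> v = z \<otimes>\<^bsub>M \<otimes>\<^sub>K N\<^esub> (w \<otimes>\<^bsub>M \<otimes>\<^sub>K N\<^esub> v)"
      using z w v by (induction rule: tensor_induct[OF mMN, consumes 1])
        (simp_all add: 2 tensor_l_distr tensor_mult_closed)
  next
    fix z assume z: "z \<in> carrier (M \<otimes>\<^sub>K N)"
    show "\<one>\<^bsub>M \<otimes>\<^sub>K N\<^esub> \<otimes>\<^bsub>M \<otimes>\<^sub>K N\<^esub> z = z"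
      using z by (induction rule: tensor_induct[OF mMN, consumes 1])
        (simp_all add: tensor_one tp_mult tensor_r_distr tp_simps)
    show "z \<otimes>\<^bsub>M \<otimes>\<^sub>K N\<^esub> \<one>\<^bsub>M \<otimes>\<^sub>K N\<^esub> = z"
      using z by (induction rule: tensor_induct[OF mMN, consumes 1])
        (simp_all add: tensor_one tp_mult tensor_l_distr tp_simps)
  qed (simp_all add: tensor_mult_closed tensor_one tp_simps)
qed (simp_all add: tensor_l_distr tensor_r_distr)

end

lemma tensor_smult_eq: "k \<odot>\<^bsub>M \<otimes>\<^sub>K N\<^esub> z = tensor_map K M N M N (\<lambda>x. k \<odot>\<^bsub>M\<^esub> x) (\<lambda>y. y) z"
  by (simp add: tensor_def)

context
  fixes M N :: "'u alg"
  assumes mods: "module K M" "module K N"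
begin

interpretation M: module K M by (rule mods)
interpretation N: module K N by (rule mods)
interpretation T: abelian_group "M \<otimes>\<^sub>K N"
  by (rule abelian_group_tensor[OF mods])

lemma tensor_smult_tp:
  "k \<in> carrier K \<Longrightarrow> x \<in> carrier M \<Longrightarrow> y \<in> carrier N \<Longrightarrow>
    k \<odot>\<^bsub>M \<otimes>\<^sub>K N\<^esub> tp M N x y = tp M N (k \<odot>\<^bsub>M\<^esub> x) y"
  unfolding tensor_smult_eq by (intro tensor_map_tp linear_map_smult_module linear_map_id mods)

lemma additive_tensor_smult:
  "k \<in> carrier K \<Longrightarrow> additive_map (M \<otimes>\<^sub>K N) (M \<otimes>\<^sub>K N) (\<lambda>z. k \<odot>\<^bsub>M \<otimes>\<^sub>K N\<^esub> z)"
  unfolding tensor_smult_eq by (intro additive_tensor_map linear_map_smult_module linear_map_id mods)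

lemma module_tensor: "module K (M \<otimes>\<^sub>K N)"
proof (rule moduleI[OF cring_K T.abelian_group_axioms])
  note as = additive_map_closed[OF additive_tensor_smult] additive_map_add[OF additive_tensor_smult]
  note ts = tensor_smult_tp tp_closed[OF mods] tp_add_left[OF mods] tp_add_right[OF mods] tp_smult[OF mods]
  show "a \<odot>\<^bsub>M \<otimes>\<^sub>K N\<^esub> x \<in> carrier (M \<otimes>\<^sub>K N)" if "a \<in> carrier K" "x \<in> carrier (M \<otimes>\<^sub>K N)" for a x
    using that by (rule as(1))
  show "a \<odot>\<^bsub>M \<otimes>\<^sub>K N\<^esub> (x \<oplus>\<^bsub>M \<otimes>\<^sub>K N\<^esub> y) = a \<odot>\<^bsub>M \<otimes>\<^sub>K N\<^esub> x \<oplus>\<^bsub>M \<otimes>\<^sub>K N\<^esub> a \<odot>\<^bsub>M \<otimes>\<^sub>K N\<^esub> y"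
    if "a \<in> carrier K" "x \<in> carrier (M \<otimes>\<^sub>K N)" "y \<in> carrier (M \<otimes>\<^sub>K N)" for a x y
    using that by (rule as(2))
  fix a b z assume a: "a \<in> carrier K" and b: "b \<in> carrier K" and z: "z \<in> carrier (M \<otimes>\<^sub>K N)"
  show "(a \<oplus>\<^bsub>K\<^esub> b) \<odot>\<^bsub>M \<otimes>\<^sub>K N\<^esub> z = a \<odot>\<^bsub>M \<otimes>\<^sub>K N\<^esub> z \<oplus>\<^bsub>M \<otimes>\<^sub>K N\<^esub> b \<odot>\<^bsub>M \<otimes>\<^sub>K N\<^esub> z"
    using z a b by (induction rule: tensor_induct[OF mods, consumes 1])
      (simp_all add: ts as M.smult_l_distr T.a_ac)
  show "(a \<otimes>\<^bsub>K\<^esub> b) \<odot>\<^bsub>M \<otimes>\<^sub>K N\<^esub> z = a \<odot>\<^bsub>M \<otimes>\<^sub>K N\<^esub> (b \<odot>\<^bsub>M \<otimes>\<^sub>K N\<^esub> z)"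
    using z a b by (induction rule: tensor_induct[OF mods, consumes 1])
      (simp_all add: tensor_smult_tp as M.smult_assoc1)
next
  note as = additive_map_closed[OF additive_tensor_smult] additive_map_add[OF additive_tensor_smult]
  fix z assume z: "z \<in> carrier (M \<otimes>\<^sub>K N)"
  show "\<one>\<^bsub>K\<^esub> \<odot>\<^bsub>M \<otimes>\<^sub>K N\<^esub> z = z"
    using z by (induction rule: tensor_induct[OF mods, consumes 1]) (simp_all add: tensor_smult_tp as)
qed

end

lemma algebra_tensor:
  assumes "algebra K S" "algebra K T"
  shows "algebra K (S \<otimes>\<^sub>K T)"
proof -
  interpret S: algebra K S by fact
  interpret T: algebra K T by fact
  note as = assms[THEN algebra_imp_assoc_algebra]
  interpret ST: module K "S \<otimes>\<^sub>K T"
    by (rule module_tensor) unfold_locales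
  interpret STr: ring "S \<otimes>\<^sub>K T"
    by (rule ring_tensor[OF as])
  note ms = S.module_axioms T.module_axioms
  show ?thesis
  proof (rule algebraI)
    show "cring K" by (rule cring_K)
    show "cring (S \<otimes>\<^sub>K T)"
    proof (rule cringI)
      show "Group.comm_monoid (S \<otimes>\<^sub>K T)"
      proof (rule STr.monoid_comm_monoidI)
        fix z w assume z: "z \<in> carrier (S \<otimes>\<^sub>K T)" and w: "w \<in> carrier (S \<otimes>\<^sub>K T)"
        have "tp S T a b \<otimes>\<^bsub>S \<otimes>\<^sub>K T\<^esub> w = w \<otimes>\<^bsub>S \<otimes>\<^sub>K T\<^esub> tp S T a b"
          if "a \<in> carrier S" "b \<in> carrier T" for a b
          using w that by (induction rule: tensor_induct[OF ms, consumes 1])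
            (simp_all add: tp_mult[OF as] S.m_comm T.m_comm STr.l_distr STr.r_distr tp_closed[OF ms])
        with z w show "z \<otimes>\<^bsub>S \<otimes>\<^sub>K T\<^esub> w = w \<otimes>\<^bsub>S \<otimes>\<^sub>K T\<^esub> z"
          by (induction rule: tensor_induct[OF ms, consumes 1]) (simp_all add: STr.l_distr STr.r_distr)
      qed
    qed (simp_all add: ST.M.abelian_group_axioms STr.l_distr)
  next
    fix a z w assume a: "a \<in> carrier K" and z: "z \<in> carrier (S \<otimes>\<^sub>K T)" and w: "w \<in> carrier (S \<otimes>\<^sub>K T)"
    have "a \<odot>\<^bsub>S \<otimes>\<^sub>K T\<^esub> tp S T x y \<otimes>\<^bsub>S \<otimes>\<^sub>K T\<^esub> w = a \<odot>\<^bsub>S \<otimes>\<^sub>K T\<^esub> (tp S T x y \<otimes>\<^bsub>S \<otimes>\<^sub>K T\<^esub> w)"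
      if "x \<in> carrier S" "y \<in> carrier T" for x y
      using w a that by (induction rule: tensor_induct[OF ms, consumes 1])
        (simp_all add: tensor_smult_tp[OF ms] tp_mult[OF as] S.smult_assoc2 STr.r_distr
          ST.smult_r_distr tp_closed[OF ms])
    with z w a show "a \<odot>\<^bsub>S \<otimes>\<^sub>K T\<^esub> z \<otimes>\<^bsub>S \<otimes>\<^sub>K T\<^esub> w = a \<odot>\<^bsub>S \<otimes>\<^sub>K T\<^esub> (z \<otimes>\<^bsub>S \<otimes>\<^sub>K T\<^esub> w)"
      by (induction rule: tensor_induct[OF ms, consumes 1])
        (simp_all add: STr.l_distr ST.smult_r_distr)
  qed (simp_all add: ST.smult_l_distr ST.smult_r_distr ST.smult_assoc1)
qed

end

section \<open>Morphisms of algebras as extensional maps\<close>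

lemma algebra_mapD:
  assumes "algebra_map R A B f"
  shows "linear_map R A B f"
    and "x \<in> carrier A \<Longrightarrow> f x \<in> carrier B"
    and "x \<in> carrier A \<Longrightarrow> y \<in> carrier A \<Longrightarrow> f (x \<oplus>\<^bsub>A\<^esub> y) = f x \<oplus>\<^bsub>B\<^esub> f y"
    and "x \<in> carrier A \<Longrightarrow> y \<in> carrier A \<Longrightarrow> f (x \<otimes>\<^bsub>A\<^esub> y) = f x \<otimes>\<^bsub>B\<^esub> f y"
    and "r \<in> carrier R \<Longrightarrow> x \<in> carrier A \<Longrightarrow> f (r \<odot>\<^bsub>A\<^esub> x) = r \<odot>\<^bsub>B\<^esub> f x"
    and "f \<one>\<^bsub>A\<^esub> = \<one>\<^bsub>B\<^esub>"
  using assms by (auto simp: algebra_map_def linear_map_def ring_hom_def)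

lemma algebra_mapI:
  assumes "linear_map R A B f"
    and "\<And>x y. x \<in> carrier A \<Longrightarrow> y \<in> carrier A \<Longrightarrow> f (x \<otimes>\<^bsub>A\<^esub> y) = f x \<otimes>\<^bsub>B\<^esub> f y"
    and "f \<one>\<^bsub>A\<^esub> = \<one>\<^bsub>B\<^esub>"
  shows "algebra_map R A B f"
  using assms by (auto simp: algebra_map_def linear_map_def ring_hom_def)

lemma algebra_map_compose:
  "algebra_map R A B f \<Longrightarrow> algebra_map R B C g \<Longrightarrow> algebra_map R A C (\<lambda>x. g (f x))"
  by (rule algebra_mapI[OF linear_map_compose[OF algebra_mapD(1) algebra_mapD(1)]])
     (auto simp: algebra_mapD)

lemma khomD:
  assumes "h \<in> khom K S T"
  shows "algebra_map K S T h"
    and "linear_map K S T h"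
    and "x \<in> carrier S \<Longrightarrow> h x \<in> carrier T"
    and "x \<in> carrier S \<Longrightarrow> y \<in> carrier S \<Longrightarrow> h (x \<oplus>\<^bsub>S\<^esub> y) = h x \<oplus>\<^bsub>T\<^esub> h y"
    and "x \<in> carrier S \<Longrightarrow> y \<in> carrier S \<Longrightarrow> h (x \<otimes>\<^bsub>S\<^esub> y) = h x \<otimes>\<^bsub>T\<^esub> h y"
    and "r \<in> carrier K \<Longrightarrow> x \<in> carrier S \<Longrightarrow> h (r \<odot>\<^bsub>S\<^esub> x) = r \<odot>\<^bsub>T\<^esub> h x"
    and "h \<one>\<^bsub>S\<^esub> = \<one>\<^bsub>T\<^esub>"
    and "h \<in> extensional (carrier S)"
  using assms algebra_mapD[of K S T h] by (auto simp: khom_def)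

lemma restrict_khom:
  assumes "algebra K S" "algebra_map K S T h"
  shows "restrict h (carrier S) \<in> khom K S T"
proof -
  interpret algebra K S by fact
  show ?thesis
    unfolding khom_def using algebra_mapD[OF assms(2)]
    by (auto intro!: algebra_mapI simp: linear_map_def)
qed

lemma khom_eqI:
  assumes "h \<in> khom K S T" "h' \<in> khom K S T'" "\<And>x. x \<in> carrier S \<Longrightarrow> h x = h' x"
  shows "h = h'"
  using assms by (auto simp: khom_def intro: extensionalityI)

lemma kalgsD:
  assumes "S \<in> kalgs K"
  shows "algebra K S" "assoc_algebra K S" "module K S" "cring S" "ring S" "abelian_group S"
proof -
  show a: "algebra K S" using assms by (simp add: kalgs_def)
  interpret algebra K S by fact
  show "assoc_algebra K S" by (rule algebra_imp_assoc_algebra[OF a])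
  show "module K S" by (rule module_axioms)
  show "cring S" by (rule is_cring)
  show "ring S" using is_cring by (simp add: cring_def)
  show "abelian_group S" by (rule M.abelian_group_axioms)
qed

lemma khom_id: "S \<in> kalgs K \<Longrightarrow> (\<lambda>s\<in>carrier S. s) \<in> khom K S S"
  by (intro restrict_khom kalgsD algebra_mapI linear_map_id) auto

lemma khom_compose:
  assumes "S \<in> kalgs K" "h \<in> khom K S T" "g \<in> khom K T U"
  shows "compose (carrier S) g h \<in> khom K S U"
  unfolding compose_def
  by (rule restrict_khom[OF kalgsD(1) algebra_map_compose[OF khomD(1) khomD(1)]]) (fact assms)+

lemma compose_apply: "x \<in> S \<Longrightarrow> compose S g h x = g (h x)"
  by (simp add: compose_def)

lemma compose_assoc_carrier:
  assumes "h \<in> khom K S T"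
  shows "compose (carrier S) f (compose (carrier S) g h) = compose (carrier S) (compose (carrier T) f g) h"
  using khomD(3)[OF assms] by (auto simp: compose_def fun_eq_iff)

lemma compose_id:
  assumes "h \<in> khom K S T"
  shows "compose (carrier S) (\<lambda>t\<in>carrier T. t) h = h" "compose (carrier S) h (\<lambda>s\<in>carrier S. s) = h"
  using khomD(3,8)[OF assms] by (auto simp: compose_def fun_eq_iff extensional_def)

lemma salgs_iff: "(T, h) \<in> salgs K S \<longleftrightarrow> T \<in> kalgs K \<and> h \<in> khom K S T"
  by (simp add: salgs_def)

lemma salgsD: "p \<in> salgs K S \<Longrightarrow> fst p \<in> kalgs K" "p \<in> salgs K S \<Longrightarrow> snd p \<in> khom K S (fst p)"
  by (auto simp: salgs_def)

section \<open>The initial algebra \<open>K\<close> and the coproduct of two algebras\<close>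

definition base_algebra :: "'u ring \<Rightarrow> 'u alg" where
  "base_algebra K = \<lparr>carrier = carrier K, mult = mult K, one = one K,
     ring.zero = ring.zero K, add = add K, smult = mult K\<rparr>"

lemma base_algebra_simps [simp]:
  "carrier (base_algebra K) = carrier K"
  "x \<otimes>\<^bsub>base_algebra K\<^esub> y = x \<otimes>\<^bsub>K\<^esub> y"
  "x \<oplus>\<^bsub>base_algebra K\<^esub> y = x \<oplus>\<^bsub>K\<^esub> y"
  "x \<odot>\<^bsub>base_algebra K\<^esub> y = x \<otimes>\<^bsub>K\<^esub> y"
  "\<one>\<^bsub>base_algebra K\<^esub> = \<one>\<^bsub>K\<^esub>"
  "\<zero>\<^bsub>base_algebra K\<^esub> = \<zero>\<^bsub>K\<^esub>"
  by (simp_all add: base_algebra_def)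

text \<open>The morphism \<open>b \<otimes> s \<mapsto> i(b) h(s)\<close> given by the universal
  property of the coproduct \<open>B \<otimes> S\<close>. It is written with
  \<open>tensor_codiagonal\<close> because the evaluation in \<open>to_functions_Spec\<close> is,
  and restricted so that it can be an element of \<open>khom\<close>.\<close>

definition copair :: "'u ring \<Rightarrow> 'u alg \<Rightarrow> 'u alg \<Rightarrow> 'u alg \<Rightarrow> ('u \<Rightarrow> 'u) \<Rightarrow> ('u \<Rightarrow> 'u) \<Rightarrow> 'u \<Rightarrow> 'u" where
  "copair K B S T i h =
     (\<lambda>z\<in>carrier (tensor K B S). tensor_codiagonal K T (tensor_map K B S T T i h z))"

context base_field
begin

abbreviation KK :: "'u alg" where "KK \<equiv> base_algebra K"

definition kunit :: "'u alg \<Rightarrow> 'u \<Rightarrow> 'u" where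
  "kunit S = (\<lambda>k\<in>carrier K. k \<odot>\<^bsub>S\<^esub> \<one>\<^bsub>S\<^esub>)"

lemma KK_kalgs: "KK \<in> kalgs K"
proof -
  interpret cring K by (rule cring_K)
  have [simp]: "cring KK"
  proof (rule cringI)
    show "abelian_group KK"
      by (rule abelian_groupI) (auto simp: a_ac intro: bexI[of _ "\<ominus>\<^bsub>K\<^esub> x" for x] l_neg)
    show "Group.comm_monoid KK"
      by (rule comm_monoidI) (auto simp: m_ac)
  qed (simp add: l_distr)
  show ?thesis
    unfolding kalgs_def by (auto intro!: algebraI is_cring simp: m_assoc l_distr r_distr)
qed

lemma kunit_khom:
  assumes "S \<in> kalgs K"
  shows "kunit S \<in> khom K KK S"
proof -
  interpret algebra K S by (rule kalgsD[OF assms])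
  have "algebra_map K KK S (\<lambda>k. k \<odot>\<^bsub>S\<^esub> \<one>\<^bsub>S\<^esub>)"
    by (rule algebra_mapI)
       (auto simp: linear_map_def smult_l_distr smult_assoc1 smult_assoc2 )
  then show ?thesis
    using restrict_khom[OF kalgsD(1)[OF KK_kalgs]] by (simp add: kunit_def)
qed

text \<open>A morphism out of \<open>KK\<close> is linear and preserves the unit, which fixes it.
  Different structure morphisms from \<open>K\<close> into a tensor product may therefore be
  identified whenever they arise.\<close>

lemma kunit_unique:
  assumes "h \<in> khom K KK S"
  shows "h = kunit S"
proof -
  interpret cring K by (rule cring_K)
  have "h k = k \<odot>\<^bsub>S\<^esub> \<one>\<^bsub>S\<^esub>" if "k \<in> carrier K" for k
    using khomD(6)[OF assms, of k "\<one>\<^bsub>K\<^esub>"] khomD(7)[OF assms] that by simp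
  then show ?thesis
    using khomD(8)[OF assms] by (auto simp: kunit_def extensional_def)
qed

lemma tensor_kalgs: "S \<in> kalgs K \<Longrightarrow> T \<in> kalgs K \<Longrightarrow> S \<otimes>\<^sub>K T \<in> kalgs K"
  by (simp add: kalgs_def algebra_tensor)

lemma algebra_map_tensor_map:
  assumes "assoc_algebra K M" "assoc_algebra K N" "assoc_algebra K M'" "assoc_algebra K N'"
    and "algebra_map K M M' f" "algebra_map K N N' g"
  shows "algebra_map K (M \<otimes>\<^sub>K N) (M' \<otimes>\<^sub>K N') (tensor_map K M N M' N' f g)"
proof -
  note m = assoc_algebraD(1)[OF assms(1)] assoc_algebraD(1)[OF assms(2)]
    assoc_algebraD(1)[OF assms(3)] assoc_algebraD(1)[OF assms(4)]
  note f = algebra_mapD[OF assms(5)] and g = algebra_mapD[OF assms(6)]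
  interpret T: ring "M \<otimes>\<^sub>K N" by (rule ring_tensor) fact+
  interpret T': ring "M' \<otimes>\<^sub>K N'" by (rule ring_tensor) fact+
  interpret Tm: module K "M \<otimes>\<^sub>K N" by (rule module_tensor) fact+
  interpret Tm': module K "M' \<otimes>\<^sub>K N'" by (rule module_tensor) fact+
  interpret M: ring M by (rule assoc_algebraD(2)[OF assms(1)])
  interpret N: ring N by (rule assoc_algebraD(2)[OF assms(2)])
  interpret Mm: module K M by (rule m)
  note tm = tensor_map_tp[OF m f(1) g(1)] tensor_map_closed[OF m f(1) g(1)] tensor_map_add[OF m f(1) g(1)]
  show ?thesis
  proof (rule algebra_mapI)
    show "linear_map K (M \<otimes>\<^sub>K N) (M' \<otimes>\<^sub>K N') (tensor_map K M N M' N' f g)"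
      unfolding linear_map_def
    proof (intro conjI ballI)
      fix r z assume r: "r \<in> carrier K" and z: "z \<in> carrier (M \<otimes>\<^sub>K N)"
      show "tensor_map K M N M' N' f g (r \<odot>\<^bsub>M \<otimes>\<^sub>K N\<^esub> z) = r \<odot>\<^bsub>M' \<otimes>\<^sub>K N'\<^esub> tensor_map K M N M' N' f g z"
        using z r by (induction rule: tensor_induct[OF m(1,2), consumes 1])
          (simp_all add: tm tensor_smult_tp[OF m(1,2)] tensor_smult_tp[OF m(3,4)] f g
            Tm.smult_r_distr Tm'.smult_r_distr)
    qed (simp_all add: tm)
    show "tensor_map K M N M' N' f g \<one>\<^bsub>M \<otimes>\<^sub>K N\<^esub> = \<one>\<^bsub>M' \<otimes>\<^sub>K N'\<^esub>"
      by (simp add: tensor_one[OF assms(1,2)] tensor_one[OF assms(3,4)] tm f g)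
    fix z w assume z: "z \<in> carrier (M \<otimes>\<^sub>K N)" and w: "w \<in> carrier (M \<otimes>\<^sub>K N)"
    have "tensor_map K M N M' N' f g (tp M N x y \<otimes>\<^bsub>M \<otimes>\<^sub>K N\<^esub> w)
        = tensor_map K M N M' N' f g (tp M N x y) \<otimes>\<^bsub>M' \<otimes>\<^sub>K N'\<^esub> tensor_map K M N M' N' f g w"
      if "x \<in> carrier M" "y \<in> carrier N" for x y
      using w that by (induction rule: tensor_induct[OF m(1,2), consumes 1])
        (simp_all add: tm tp_mult[OF assms(1,2)] tp_mult[OF assms(3,4)] f g T.r_distr T'.r_distr
          tp_closed[OF m(1,2)] tp_closed[OF m(3,4)])
    with z w show "tensor_map K M N M' N' f g (z \<otimes>\<^bsub>M \<otimes>\<^sub>K N\<^esub> w)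
        = tensor_map K M N M' N' f g z \<otimes>\<^bsub>M' \<otimes>\<^sub>K N'\<^esub> tensor_map K M N M' N' f g w"
      by (induction rule: tensor_induct[OF m(1,2), consumes 1])
        (simp_all add: tm T.l_distr T'.l_distr)
  qed
qed

lemma algebra_map_idI: "algebra_map R A A (\<lambda>x. x)"
  by (rule algebra_mapI[OF linear_map_id]) simp_all

lemma tensor_map_khom:
  assumes "S \<in> kalgs K" "T \<in> kalgs K" "S' \<in> kalgs K" "T' \<in> kalgs K"
    "algebra_map K S S' f" "algebra_map K T T' g"
  shows "restrict (tensor_map K S T S' T' f g) (carrier (S \<otimes>\<^sub>K T)) \<in> khom K (S \<otimes>\<^sub>K T) (S' \<otimes>\<^sub>K T')"
  by (intro restrict_khom kalgsD[OF tensor_kalgs] algebra_map_tensor_map kalgsD(2) assms)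

context
  fixes S T assumes ST: "S \<in> kalgs K" "T \<in> kalgs K"
begin

interpretation S: algebra K S by (rule kalgsD[OF ST(1)])
interpretation T: algebra K T by (rule kalgsD[OF ST(2)])

lemma tensor_left_khom: "tensor_left K S T \<in> khom K S (S \<otimes>\<^sub>K T)"
proof -
  note as = kalgsD(2)[OF ST(1)] kalgsD(2)[OF ST(2)] and m = kalgsD(3)[OF ST(1)] kalgsD(3)[OF ST(2)]
  have "algebra_map K S (S \<otimes>\<^sub>K T) (\<lambda>s. tp S T s \<one>\<^bsub>T\<^esub>)"
    by (rule algebra_mapI)
       (auto simp: linear_map_def tp_closed[OF m] tp_add_left[OF m] tp_mult[OF as] tensor_one[OF as] tensor_smult_tp[OF m])
  then show ?thesis
    unfolding tensor_left_def by (rule restrict_khom[OF kalgsD(1)[OF ST(1)]])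
qed

lemma tensor_right_khom: "tensor_right K S T \<in> khom K T (S \<otimes>\<^sub>K T)"
proof -
  note as = kalgsD(2)[OF ST(1)] kalgsD(2)[OF ST(2)] and m = kalgsD(3)[OF ST(1)] kalgsD(3)[OF ST(2)]
  have "algebra_map K T (S \<otimes>\<^sub>K T) (\<lambda>t. tp S T \<one>\<^bsub>S\<^esub> t)"
    by (rule algebra_mapI)
       (auto simp: linear_map_def tp_closed[OF m] tp_add_right[OF m] tp_mult[OF as] tensor_one[OF as]
          tensor_smult_tp[OF m] tp_smult[OF m])
  then show ?thesis
    unfolding tensor_right_def by (rule restrict_khom[OF kalgsD(1)[OF ST(2)]])
qed

end

lemma tensor_left_apply: "s \<in> carrier S \<Longrightarrow> tensor_left K S T s = tp S T s \<one>\<^bsub>T\<^esub>"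
  by (simp add: tensor_left_def)

lemma tensor_right_apply: "t \<in> carrier T \<Longrightarrow> tensor_right K S T t = tp S T \<one>\<^bsub>S\<^esub> t"
  by (simp add: tensor_right_def)

context
  fixes T assumes T: "T \<in> kalgs K"
begin

interpretation T: algebra K T by (rule kalgsD[OF T])
interpretation T: ring T by (rule kalgsD[OF T])

lemma codiagonal_aux:
  defines "D \<equiv> \<lambda>u. \<Oplus>\<^bsub>T\<^esub>p\<in>Poly_Mapping.keys u. [Poly_Mapping.lookup u p] \<cdot>\<^bsub>T\<^esub> (fst p \<otimes>\<^bsub>T\<^esub> snd p)"
  shows "D \<in> hom (formal_sums T T) (add_monoid T)"
    and "x \<in> carrier T \<Longrightarrow> y \<in> carrier T \<Longrightarrow> D (frag_of (x, y)) = x \<otimes>\<^bsub>T\<^esub> y"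
proof -
  have c: "[n] \<cdot>\<^bsub>T\<^esub> (fst p \<otimes>\<^bsub>T\<^esub> snd p) \<in> carrier T" if "p \<in> carrier T \<times> carrier T" for n :: int and p
    using that by (intro T.add.int_pow_closed) auto
  \<comment> \<open>The range of summation of \<open>D u\<close> depends on \<open>u\<close>.
    Enlarging it to a common finite set makes \<open>u\<close>, \<open>v\<close> and
    \<open>u + v\<close> comparable.\<close>
  have D: "D u = (\<Oplus>\<^bsub>T\<^esub>p\<in>A. [Poly_Mapping.lookup u p] \<cdot>\<^bsub>T\<^esub> (fst p \<otimes>\<^bsub>T\<^esub> snd p))"
    if "finite A" "Poly_Mapping.keys u \<subseteq> A" "A \<subseteq> carrier T \<times> carrier T" for u A
    unfolding D_def
  proof (rule T.add.finprod_mono_neutral_cong_left)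
    show "[Poly_Mapping.lookup u p] \<cdot>\<^bsub>T\<^esub> (fst p \<otimes>\<^bsub>T\<^esub> snd p) = \<zero>\<^bsub>T\<^esub>" if "p \<in> A - Poly_Mapping.keys u" for p
      using that by (simp add: in_keys_iff add_pow_def)
  qed (use that c in auto)
  show "D \<in> hom (formal_sums T T) (add_monoid T)"
  proof (rule homI)
    fix u v assume "u \<in> fsum T T" "v \<in> fsum T T"
    then have k: "Poly_Mapping.keys u \<union> Poly_Mapping.keys v \<subseteq> carrier T \<times> carrier T" (is "?A \<subseteq> _")
      by (simp add: fsum_iff)
    have "D (u + v) = (\<Oplus>\<^bsub>T\<^esub>p\<in>?A. [Poly_Mapping.lookup (u + v) p] \<cdot>\<^bsub>T\<^esub> (fst p \<otimes>\<^bsub>T\<^esub> snd p))"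
      using k keys_add[of u v] by (intro D) auto
    also have "\<dots> = (\<Oplus>\<^bsub>T\<^esub>p\<in>?A. [Poly_Mapping.lookup u p] \<cdot>\<^bsub>T\<^esub> (fst p \<otimes>\<^bsub>T\<^esub> snd p)
        \<oplus>\<^bsub>T\<^esub> [Poly_Mapping.lookup v p] \<cdot>\<^bsub>T\<^esub> (fst p \<otimes>\<^bsub>T\<^esub> snd p))"
    proof (rule T.add.finprod_cong')
      fix p assume "p \<in> ?A"
      with k have "p \<in> carrier T \<times> carrier T" by blast
      then show "[Poly_Mapping.lookup (u + v) p] \<cdot>\<^bsub>T\<^esub> (fst p \<otimes>\<^bsub>T\<^esub> snd p) =
          [Poly_Mapping.lookup u p] \<cdot>\<^bsub>T\<^esub> (fst p \<otimes>\<^bsub>T\<^esub> snd p) \<oplus>\<^bsub>T\<^esub> [Poly_Mapping.lookup v p] \<cdot>\<^bsub>T\<^esub> (fst p \<otimes>\<^bsub>T\<^esub> snd p)"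
        by (auto simp: Poly_Mapping.lookup_add T.add.int_pow_mult)
    qed (use k c in auto)
    also have "\<dots> = (\<Oplus>\<^bsub>T\<^esub>p\<in>?A. [Poly_Mapping.lookup u p] \<cdot>\<^bsub>T\<^esub> (fst p \<otimes>\<^bsub>T\<^esub> snd p))
        \<oplus>\<^bsub>T\<^esub> (\<Oplus>\<^bsub>T\<^esub>p\<in>?A. [Poly_Mapping.lookup v p] \<cdot>\<^bsub>T\<^esub> (fst p \<otimes>\<^bsub>T\<^esub> snd p))"
      using k c by (intro T.finsum_addf) blast+
    also have "\<dots> = D u \<oplus>\<^bsub>T\<^esub> D v"
      using k by (simp add: D[of ?A])
    finally show "D (u \<otimes>\<^bsub>formal_sums T T\<^esub> v) = D u \<otimes>\<^bsub>add_monoid T\<^esub> D v"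
      by simp
  next
    fix u assume "u \<in> fsum T T"
    then show "D u \<in> carrier (add_monoid T)"
      using c unfolding D_def fsum_iff by (auto intro!: T.finsum_closed)
  qed
  show "D (frag_of (x, y)) = x \<otimes>\<^bsub>T\<^esub> y" if "x \<in> carrier T" "y \<in> carrier T"
    using that T.add.int_pow_1[of "x \<otimes>\<^bsub>T\<^esub> y"] by (simp add: D_def)
qed

lemma additive_codiagonal: "additive_map (T \<otimes>\<^sub>K T) T (tensor_codiagonal K T)"
  and codiagonal_tp: "\<lbrakk>x \<in> carrier T; y \<in> carrier T\<rbrakk> \<Longrightarrow> tensor_codiagonal K T (tp T T x y) = x \<otimes>\<^bsub>T\<^esub> y"
proof -
  let ?D = "\<lambda>u. \<Oplus>\<^bsub>T\<^esub>p\<in>Poly_Mapping.keys u. [Poly_Mapping.lookup u p] \<cdot>\<^bsub>T\<^esub> (fst p \<otimes>\<^bsub>T\<^esub> snd p)"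
  note m = kalgsD(3)[OF T]
  have e: "tensor_codiagonal K T = (\<lambda>z. ?D (tensor_rep K T T z))"
    by (simp add: tensor_codiagonal_def fun_eq_iff)
  have bal: "balanced_map K T T T (\<lambda>x y. ?D (frag_of (x, y)))"
    unfolding balanced_map_def
    by (auto simp: codiagonal_aux(2) T.l_distr T.r_distr T.smult_assoc2 assoc_algebraD(4)[OF kalgsD(2)[OF T]])
  show "additive_map (T \<otimes>\<^sub>K T) T (tensor_codiagonal K T)"
    unfolding e by (rule hom_rep_additive[OF m m T.M.abelian_group_axioms codiagonal_aux(1) bal])
  show "tensor_codiagonal K T (tp T T x y) = x \<otimes>\<^bsub>T\<^esub> y" if "x \<in> carrier T" "y \<in> carrier T"
    unfolding e using hom_rep[OF m m T.M.abelian_group_axioms codiagonal_aux(1) bal fsum_of] that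
    by (simp add: codiagonal_aux(2))
qed

context
  fixes B S i h
  assumes BS: "B \<in> kalgs K" "S \<in> kalgs K" and ih: "i \<in> khom K B T" "h \<in> khom K S T"
begin

interpretation B: algebra K B by (rule kalgsD[OF BS(1)])
interpretation S: algebra K S by (rule kalgsD[OF BS(2)])
interpretation TT: algebra K "B \<otimes>\<^sub>K S" by (rule kalgsD[OF tensor_kalgs[OF BS]])
interpretation TT: ring "B \<otimes>\<^sub>K S" by (rule kalgsD[OF tensor_kalgs[OF BS]])

lemma copair_tp: "x \<in> carrier B \<Longrightarrow> y \<in> carrier S \<Longrightarrow> copair K B S T i h (tp B S x y) = i x \<otimes>\<^bsub>T\<^esub> h y"
  by (simp add: copair_def tp_closed kalgsD(3) BS T tensor_map_tp khomD[OF ih(1)] khomD[OF ih(2)] codiagonal_tp)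

lemma additive_copair: "additive_map (B \<otimes>\<^sub>K S) T (copair K B S T i h)"
proof -
  have "additive_map (B \<otimes>\<^sub>K S) T (\<lambda>z. tensor_codiagonal K T (tensor_map K B S T T i h z))"
    by (rule additive_map_compose[OF additive_tensor_map additive_codiagonal])
       (intro kalgsD BS T khomD(2)[OF ih(1)] khomD(2)[OF ih(2)])+
  then show ?thesis
    by (auto simp: additive_map_def copair_def)
qed

text \<open>Multiplicativity rests on commutativity of \<open>T\<close>: in the product of the
  images of two pure tensors, a value of \<open>h\<close> has to be moved past a value of
  \<open>i\<close>.\<close>

lemma copair_khom: "copair K B S T i h \<in> khom K (B \<otimes>\<^sub>K S) T"
proof -
  note m = kalgsD(3)[OF BS(1)] kalgsD(3)[OF BS(2)]
  note as = kalgsD(2)[OF BS(1)] kalgsD(2)[OF BS(2)]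
  note add = additive_mapD[OF additive_copair]
  note hs = khomD[OF ih(1)] khomD[OF ih(2)]
  have "algebra_map K (B \<otimes>\<^sub>K S) T (copair K B S T i h)"
  proof (rule algebra_mapI)
    show "linear_map K (B \<otimes>\<^sub>K S) T (copair K B S T i h)"
      unfolding linear_map_def
    proof (intro conjI ballI)
      fix r z assume r: "r \<in> carrier K" and z: "z \<in> carrier (B \<otimes>\<^sub>K S)"
      show "copair K B S T i h (r \<odot>\<^bsub>B \<otimes>\<^sub>K S\<^esub> z) = r \<odot>\<^bsub>T\<^esub> copair K B S T i h z"
        using z r by (induction rule: tensor_induct[OF m, consumes 1])
          (simp_all add: tensor_smult_tp[OF m] copair_tp hs T.smult_assoc2 TT.smult_r_distr add T.smult_r_distr)
    qed (simp_all add: add)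
    show "copair K B S T i h \<one>\<^bsub>B \<otimes>\<^sub>K S\<^esub> = \<one>\<^bsub>T\<^esub>"
      by (simp add: tensor_one[OF as] copair_tp hs)
    fix z w assume z: "z \<in> carrier (B \<otimes>\<^sub>K S)" and w: "w \<in> carrier (B \<otimes>\<^sub>K S)"
    have "copair K B S T i h (tp B S x y \<otimes>\<^bsub>B \<otimes>\<^sub>K S\<^esub> w) = copair K B S T i h (tp B S x y) \<otimes>\<^bsub>T\<^esub> copair K B S T i h w"
      if "x \<in> carrier B" "y \<in> carrier S" for x y
      using w that by (induction rule: tensor_induct[OF m, consumes 1])
        (simp_all add: tp_mult[OF as] copair_tp hs add TT.r_distr T.r_distr T.m_ac tp_closed[OF m])
    with z w show "copair K B S T i h (z \<otimes>\<^bsub>B \<otimes>\<^sub>K S\<^esub> w) = copair K B S T i h z \<otimes>\<^bsub>T\<^esub> copair K B S T i h w"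
      by (induction rule: tensor_induct[OF m, consumes 1])
        (simp_all add: add TT.l_distr T.l_distr)
  qed
  then show ?thesis
    by (simp add: khom_def copair_def)
qed

lemma copair_left: "compose (carrier B) (copair K B S T i h) (tensor_left K B S) = i"
  by (rule khom_eqI[OF khom_compose[OF BS(1) tensor_left_khom[OF BS] copair_khom] ih(1)])
     (simp add: compose_apply tensor_left_apply copair_tp khomD[OF ih(1)] khomD[OF ih(2)])

lemma copair_right: "compose (carrier S) (copair K B S T i h) (tensor_right K B S) = h"
  by (rule khom_eqI[OF khom_compose[OF BS(2) tensor_right_khom[OF BS] copair_khom] ih(2)])
     (simp add: compose_apply tensor_right_apply copair_tp khomD[OF ih(1)] khomD[OF ih(2)])

end

end

end

lemma (in abelian_group) a_inv_zero: "\<ominus> \<zero> = \<zero>"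
  by (rule minus_equality) simp_all

section \<open>Linear functionals\<close>

context base_field
begin

lemma submodule_D:
  assumes "module K V" "submodule H K V"
  shows "H \<subseteq> carrier V" "\<zero>\<^bsub>V\<^esub> \<in> H"
    "\<And>x y. x \<in> H \<Longrightarrow> y \<in> H \<Longrightarrow> x \<oplus>\<^bsub>V\<^esub> y \<in> H"
    "\<And>x. x \<in> H \<Longrightarrow> \<ominus>\<^bsub>V\<^esub> x \<in> H"
    "\<And>x y. x \<in> H \<Longrightarrow> y \<in> H \<Longrightarrow> x \<ominus>\<^bsub>V\<^esub> y \<in> H"
    "\<And>k x. k \<in> carrier K \<Longrightarrow> x \<in> H \<Longrightarrow> k \<odot>\<^bsub>V\<^esub> x \<in> H"
proof -
  interpret module K V by fact
  note E = submoduleE[OF assms(2)]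
  show "H \<subseteq> carrier V" "\<And>x. x \<in> H \<Longrightarrow> \<ominus>\<^bsub>V\<^esub> x \<in> H"
    "\<And>x y. x \<in> H \<Longrightarrow> y \<in> H \<Longrightarrow> x \<oplus>\<^bsub>V\<^esub> y \<in> H"
    "\<And>k x. k \<in> carrier K \<Longrightarrow> x \<in> H \<Longrightarrow> k \<odot>\<^bsub>V\<^esub> x \<in> H"
    using E by auto
  show "\<And>x y. x \<in> H \<Longrightarrow> y \<in> H \<Longrightarrow> x \<ominus>\<^bsub>V\<^esub> y \<in> H"
    using E by (auto simp: M.minus_eq)
  obtain x where x: "x \<in> H" using E(2) by blast
  then have "x \<oplus>\<^bsub>V\<^esub> (\<ominus>\<^bsub>V\<^esub> x) \<in> H" using E by blast
  then show "\<zero>\<^bsub>V\<^esub> \<in> H" using x E(1) by (auto simp: M.r_neg)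
qed

text \<open>Zorn's lemma gives a submodule \<open>H\<close> maximal among those that contain
  \<open>W\<close> and avoid \<open>v\<close>. By maximality every \<open>x\<close> is congruent
  modulo \<open>H\<close> to a multiple of \<open>v\<close>, and the coefficient is unique because
  \<open>v\<close> is not in \<open>H\<close>. This coefficient is the functional.\<close>

lemma exists_functional:
  assumes V: "module K V" and W: "submodule W K V" and v: "v \<in> carrier V" "v \<notin> W"
  obtains w where "linear_map K V KK w" "\<And>x. x \<in> W \<Longrightarrow> w x = \<zero>\<^bsub>K\<^esub>" "w v = \<one>\<^bsub>K\<^esub>"
proof -
  interpret field K by (rule field_K)
  interpret V: module K V by fact
  define \<A> where "\<A> = {H. submodule H K V \<and> W \<subseteq> H \<and> v \<notin> H}"
  have "\<exists>H\<in>\<A>. \<forall>X\<in>\<A>. H \<subseteq> X \<longrightarrow> X = H"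
  proof (rule subset_Zorn_nonempty)
    show "\<A> \<noteq> {}" using W v by (auto simp: \<A>_def)
    fix C assume C: "C \<noteq> {}" "subset.chain \<A> C"
    then have CA: "\<And>H. H \<in> C \<Longrightarrow> submodule H K V \<and> W \<subseteq> H \<and> v \<notin> H"
      by (auto simp: \<A>_def subset_chain_def)
    have CD: "submodule H K V" if "H \<in> C" for H
      using CA that by blast
    have "submodule (\<Union>C) K V"
    proof (rule V.submoduleI)
      show "\<Union>C \<subseteq> carrier V"
        using submodule_D(1)[OF V CD] by (intro Union_least)
      obtain H where "H \<in> C" using C(1) by blast
      then show "\<zero>\<^bsub>V\<^esub> \<in> \<Union>C"
        using submodule_D(2)[OF V CD] by (intro UnionI)
      show "\<ominus>\<^bsub>V\<^esub> a \<in> \<Union>C" if a: "a \<in> \<Union>C" for a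
        using a submodule_D(4)[OF V CD] by (elim UnionE) (intro UnionI)
      show "k \<odot>\<^bsub>V\<^esub> a \<in> \<Union>C" if k: "k \<in> carrier K" and a: "a \<in> \<Union>C" for k a
        using a submodule_D(6)[OF V CD k] by (elim UnionE) (intro UnionI)
      show "a \<oplus>\<^bsub>V\<^esub> b \<in> \<Union>C" if ab: "a \<in> \<Union>C" "b \<in> \<Union>C" for a b
      proof -
        obtain G H where G: "G \<in> C" "a \<in> G" and H: "H \<in> C" "b \<in> H" using ab by blast
        have "G \<subseteq> H \<or> H \<subseteq> G"
          using C(2) G(1) H(1) by (auto simp: subset_chain_def)
        then obtain J where J: "J \<in> C" "a \<in> J" "b \<in> J"
          using G H by blast
        then show ?thesis
          using submodule_D(3)[OF V CD[OF J(1)] J(2,3)] by (intro UnionI)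
      qed
    qed
    then show "\<Union>C \<in> \<A>"
      using CA C(1) by (auto simp: \<A>_def)
  qed
  then obtain H where HA: "H \<in> \<A>" and HM: "\<forall>X\<in>\<A>. H \<subseteq> X \<longrightarrow> X = H" ..
  have H: "submodule H K V" "W \<subseteq> H" "v \<notin> H"
    using HA by (simp_all add: \<A>_def)
  have max: "X = H" if "submodule X K V" "H \<subseteq> X" "v \<notin> X" for X
  proof -
    have "X \<in> \<A>"
      using H(2) that unfolding \<A>_def by blast
    then show ?thesis
      using HM that(2) by simp
  qed
  note HD = submodule_D[OF V H(1)]
  have HV: "x \<in> carrier V" if "x \<in> H" for x using that HD(1) by blast
  \<comment> \<open>Two different coefficients would put \<open>(k - l) v\<close> into
    \<open>H\<close> with \<open>k - l\<close> invertible, hence \<open>v\<close> itself.\<close>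
  have uniq: "k = l" if k: "k \<in> carrier K" "l \<in> carrier K" and x: "x \<in> carrier V"
    and "x \<ominus>\<^bsub>V\<^esub> k \<odot>\<^bsub>V\<^esub> v \<in> H" "x \<ominus>\<^bsub>V\<^esub> l \<odot>\<^bsub>V\<^esub> v \<in> H" for k l x
  proof (rule ccontr)
    assume "k \<noteq> l"
    then have nz: "k \<ominus>\<^bsub>K\<^esub> l \<noteq> \<zero>\<^bsub>K\<^esub>" "k \<ominus>\<^bsub>K\<^esub> l \<in> carrier K"
      using k \<open>k \<noteq> l\<close> minus_equality[of k "\<ominus>\<^bsub>K\<^esub> l"] by (auto simp: minus_eq)
    then have u: "inv\<^bsub>K\<^esub> (k \<ominus>\<^bsub>K\<^esub> l) \<in> carrier K" "inv\<^bsub>K\<^esub> (k \<ominus>\<^bsub>K\<^esub> l) \<otimes>\<^bsub>K\<^esub> (k \<ominus>\<^bsub>K\<^esub> l) = \<one>\<^bsub>K\<^esub>"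
      using field_Units by auto
    have "(k \<ominus>\<^bsub>K\<^esub> l) \<odot>\<^bsub>V\<^esub> v = (x \<ominus>\<^bsub>V\<^esub> l \<odot>\<^bsub>V\<^esub> v) \<ominus>\<^bsub>V\<^esub> (x \<ominus>\<^bsub>V\<^esub> k \<odot>\<^bsub>V\<^esub> v)"
      using k x v by (simp add: minus_eq V.M.minus_eq V.smult_l_distr V.smult_l_minus V.M.minus_add V.M.a_ac V.M.r_neg1 V.M.r_neg2)
    then have "(k \<ominus>\<^bsub>K\<^esub> l) \<odot>\<^bsub>V\<^esub> v \<in> H"
      using HD(5) that by simp
    then have "inv\<^bsub>K\<^esub> (k \<ominus>\<^bsub>K\<^esub> l) \<odot>\<^bsub>V\<^esub> ((k \<ominus>\<^bsub>K\<^esub> l) \<odot>\<^bsub>V\<^esub> v) \<in> H"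
      using HD(6) u by simp
    then show False
      using H(3) u nz v by (simp flip: V.smult_assoc1)
  qed
  have ex: "\<exists>k\<in>carrier K. x \<ominus>\<^bsub>V\<^esub> k \<odot>\<^bsub>V\<^esub> v \<in> H" if x: "x \<in> carrier V" for x
  proof (cases "x \<in> H")
    case True
    then show ?thesis
      using x v by (intro bexI[of _ "\<zero>\<^bsub>K\<^esub>"]) (simp_all add: V.M.minus_eq V.M.a_inv_zero)
  next
    case False
    \<comment> \<open>\<open>X\<close> is \<open>H + K x\<close>. It is strictly larger than
      \<open>H\<close>, so by maximality it contains \<open>v\<close>, and solving
      \<open>v = h + k x\<close> for \<open>x\<close> gives the coefficient
      \<open>1/k\<close>.\<close>
    define X where "X = {h \<oplus>\<^bsub>V\<^esub> k \<odot>\<^bsub>V\<^esub> x | h k. h \<in> H \<and> k \<in> carrier K}"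
    have XI: "h \<oplus>\<^bsub>V\<^esub> k \<odot>\<^bsub>V\<^esub> x \<in> X" if "h \<in> H" "k \<in> carrier K" for h k
      using that by (auto simp: X_def)
    have "submodule X K V"
    proof (rule V.submoduleI)
      show "X \<subseteq> carrier V" using HV x by (auto simp: X_def)
      show "\<zero>\<^bsub>V\<^esub> \<in> X" using XI[OF HD(2), of "\<zero>\<^bsub>K\<^esub>"] x by simp
      show "\<ominus>\<^bsub>V\<^esub> a \<in> X" if "a \<in> X" for a
      proof -
        from that obtain h k where a: "a = h \<oplus>\<^bsub>V\<^esub> k \<odot>\<^bsub>V\<^esub> x" "h \<in> H" "k \<in> carrier K" by (auto simp: X_def)
        then show ?thesis
          using XI[OF HD(4), of h "\<ominus>\<^bsub>K\<^esub> k"] x HV by (simp add: V.M.minus_add V.smult_l_minus V.M.a_comm)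
      qed
      show "c \<odot>\<^bsub>V\<^esub> a \<in> X" if "c \<in> carrier K" "a \<in> X" for c a
      proof -
        from that obtain h k where a: "a = h \<oplus>\<^bsub>V\<^esub> k \<odot>\<^bsub>V\<^esub> x" "h \<in> H" "k \<in> carrier K" by (auto simp: X_def)
        then show ?thesis
          using XI[OF HD(6), of c h "c \<otimes>\<^bsub>K\<^esub> k"] x that HV by (simp add: V.smult_r_distr V.smult_assoc1)
      qed
      show "a \<oplus>\<^bsub>V\<^esub> b \<in> X" if "a \<in> X" "b \<in> X" for a b
      proof -
        from that obtain h k h' k' where a: "a = h \<oplus>\<^bsub>V\<^esub> k \<odot>\<^bsub>V\<^esub> x" "h \<in> H" "k \<in> carrier K"
          and b: "b = h' \<oplus>\<^bsub>V\<^esub> k' \<odot>\<^bsub>V\<^esub> x" "h' \<in> H" "k' \<in> carrier K" by (auto simp: X_def)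
        have "a \<oplus>\<^bsub>V\<^esub> b = (h \<oplus>\<^bsub>V\<^esub> h') \<oplus>\<^bsub>V\<^esub> (k \<oplus>\<^bsub>K\<^esub> k') \<odot>\<^bsub>V\<^esub> x"
          using a b x HV by (simp add: V.smult_l_distr V.M.a_ac)
        then show ?thesis
          using XI[OF HD(3)] a b by simp
      qed
    qed
    moreover have "H \<subseteq> X"
      using XI[of _ "\<zero>\<^bsub>K\<^esub>"] x HV by force
    moreover have "x \<in> X"
      using XI[OF HD(2) one_closed] x by simp
    ultimately have "v \<in> X"
      using max False by blast
    then obtain h k where hk: "v = h \<oplus>\<^bsub>V\<^esub> k \<odot>\<^bsub>V\<^esub> x" "h \<in> H" "k \<in> carrier K" by (auto simp: X_def)
    then have "k \<noteq> \<zero>\<^bsub>K\<^esub>"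
      using H(3) x HV by auto
    then have u: "inv\<^bsub>K\<^esub> k \<in> carrier K" "inv\<^bsub>K\<^esub> k \<otimes>\<^bsub>K\<^esub> k = \<one>\<^bsub>K\<^esub>"
      using field_Units hk by auto
    have "x \<ominus>\<^bsub>V\<^esub> inv\<^bsub>K\<^esub> k \<odot>\<^bsub>V\<^esub> v = \<ominus>\<^bsub>V\<^esub> (inv\<^bsub>K\<^esub> k \<odot>\<^bsub>V\<^esub> h)"
      using hk u x HV[OF hk(2)]
      by (simp add: V.smult_r_distr V.M.minus_eq V.M.minus_add V.M.a_ac V.M.r_neg1 V.M.r_neg2 flip: V.smult_assoc1)
    then show ?thesis
      using HD hk u by (intro bexI[of _ "inv\<^bsub>K\<^esub> k"]) simp_all
  qed
  define w where "w x = (SOME k. k \<in> carrier K \<and> x \<ominus>\<^bsub>V\<^esub> k \<odot>\<^bsub>V\<^esub> v \<in> H)" for x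
  have w: "w x \<in> carrier K" "x \<ominus>\<^bsub>V\<^esub> w x \<odot>\<^bsub>V\<^esub> v \<in> H" if "x \<in> carrier V" for x
    using someI_ex[of "\<lambda>k. k \<in> carrier K \<and> x \<ominus>\<^bsub>V\<^esub> k \<odot>\<^bsub>V\<^esub> v \<in> H"] ex[OF that] unfolding w_def by blast+
  have wI: "w x = k" if "x \<in> carrier V" "k \<in> carrier K" "x \<ominus>\<^bsub>V\<^esub> k \<odot>\<^bsub>V\<^esub> v \<in> H" for x k
    using uniq[OF w(1) that(2,1) w(2) that(3)] that(1) by blast
  show ?thesis
  proof
    show "linear_map K V KK w"
      unfolding linear_map_def
    proof (intro conjI ballI)
      show "w \<in> carrier V \<rightarrow> carrier KK" using w by auto
      show "w (x \<oplus>\<^bsub>V\<^esub> y) = w x \<oplus>\<^bsub>KK\<^esub> w y" if xy: "x \<in> carrier V" "y \<in> carrier V" for x y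
      proof -
        have "(x \<oplus>\<^bsub>V\<^esub> y) \<ominus>\<^bsub>V\<^esub> (w x \<oplus>\<^bsub>K\<^esub> w y) \<odot>\<^bsub>V\<^esub> v = (x \<ominus>\<^bsub>V\<^esub> w x \<odot>\<^bsub>V\<^esub> v) \<oplus>\<^bsub>V\<^esub> (y \<ominus>\<^bsub>V\<^esub> w y \<odot>\<^bsub>V\<^esub> v)"
          using xy w v by (simp add: V.smult_l_distr V.M.minus_eq V.M.minus_add V.M.a_ac)
        then show ?thesis
          using xy w HD(3) by (intro wI) simp_all
      qed
      show "w (k \<odot>\<^bsub>V\<^esub> x) = k \<odot>\<^bsub>KK\<^esub> w x" if kx: "k \<in> carrier K" "x \<in> carrier V" for k x
      proof -
        have "k \<odot>\<^bsub>V\<^esub> x \<ominus>\<^bsub>V\<^esub> (k \<otimes>\<^bsub>K\<^esub> w x) \<odot>\<^bsub>V\<^esub> v = k \<odot>\<^bsub>V\<^esub> (x \<ominus>\<^bsub>V\<^esub> w x \<odot>\<^bsub>V\<^esub> v)"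
          using kx w v by (simp add: V.smult_assoc1 V.smult_r_distr V.M.minus_eq V.smult_r_minus)
        then show ?thesis
          using kx w HD(6) by (simp add: wI)
      qed
    qed
    show "w x = \<zero>\<^bsub>K\<^esub>" if "x \<in> W" for x
    proof -
      have "x \<in> H" using that H by blast
      then show ?thesis using v HV by (intro wI) (simp_all add: V.M.minus_eq V.M.a_inv_zero)
    qed
    show "w v = \<one>\<^bsub>K\<^esub>"
      using v HD(2) by (intro wI) (simp_all add: V.M.minus_eq V.M.r_neg)
  qed
qed

section \<open>Contraction with functionals and flatness over a field\<close>

definition contract :: "'u alg \<Rightarrow> 'u alg \<Rightarrow> ('u \<Rightarrow> 'u) \<Rightarrow> 'u \<Rightarrow> 'u" where
  "contract V S w z = copair K KK S S (kunit S) (\<lambda>s\<in>carrier S. s) (tensor_map K V S KK S w (\<lambda>s. s) z)"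

context
  fixes V S :: "'u alg" and w
  assumes V: "module K V" and S: "S \<in> kalgs K" and w: "linear_map K V KK w"
begin

lemma additive_contract: "additive_map (V \<otimes>\<^sub>K S) S (contract V S w)"
  unfolding contract_def
  by (intro additive_map_compose[OF additive_tensor_map additive_copair] V S KK_kalgs kalgsD(3)
      kunit_khom khom_id w linear_map_id)

text \<open>\<open>contract\<close> is the slice map \<open>w \<otimes> 1\<close>: the functional
  acts on the first factor, and the copairing of \<open>kunit S\<close> with the identity identifies
  \<open>K \<otimes> S\<close> with \<open>S\<close>.\<close>

lemma contract_tp:
  assumes "x \<in> carrier V" "s \<in> carrier S"
  shows "contract V S w (tp V S x s) = w x \<odot>\<^bsub>S\<^esub> s"
proof -
  interpret S: algebra K S by (rule kalgsD[OF S])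
  have wx: "w x \<in> carrier K"
    using linear_map_closed[OF w assms(1)] by simp
  have "contract V S w (tp V S x s) = copair K KK S S (kunit S) (\<lambda>s\<in>carrier S. s) (tp KK S (w x) s)"
    unfolding contract_def using assms
    by (simp add: tensor_map_tp V S KK_kalgs kalgsD(3) w linear_map_id)
  also have "\<dots> = kunit S (w x) \<otimes>\<^bsub>S\<^esub> s"
    using assms wx by (simp add: copair_tp S KK_kalgs kunit_khom khom_id)
  also have "\<dots> = w x \<odot>\<^bsub>S\<^esub> s"
    using assms wx by (simp add: kunit_def S.smult_assoc2)
  finally show ?thesis .
qed

end

text \<open>Elements are presented by lists of pure tensors to allow induction on the number of
  terms; \<open>tensor_induct\<close> keeps no such count.\<close>

definition tensor_sum :: "'u alg \<Rightarrow> 'u alg \<Rightarrow> ('u \<times> 'u) list \<Rightarrow> 'u" where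
  "tensor_sum V S ps = foldr (\<lambda>p z. tp V S (fst p) (snd p) \<oplus>\<^bsub>V \<otimes>\<^sub>K S\<^esub> z) ps \<zero>\<^bsub>V \<otimes>\<^sub>K S\<^esub>"

lemma tensor_sum_simps:
  fixes V S :: "'u alg"
  shows
  "tensor_sum V S [] = \<zero>\<^bsub>V \<otimes>\<^sub>K S\<^esub>"
  "tensor_sum V S (p # ps) = tp V S (fst p) (snd p) \<oplus>\<^bsub>V \<otimes>\<^sub>K S\<^esub> tensor_sum V S ps"
  by (simp_all add: tensor_sum_def)

lemma tensor_sum_closed:
  fixes V S :: "'u alg"
  assumes "module K V" "module K S" "set ps \<subseteq> carrier V \<times> carrier S"
  shows "tensor_sum V S ps \<in> carrier (V \<otimes>\<^sub>K S)"
proof -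
  interpret T: abelian_group "V \<otimes>\<^sub>K S" using assms by (intro abelian_group_tensor)
  show ?thesis
    using assms(3) by (induction ps) (auto simp: tensor_sum_simps tp_closed assms)
qed

lemma tensor_sum_exists:
  fixes V S :: "'u alg"
  assumes m: "module K V" "module K S" and z: "z \<in> carrier (V \<otimes>\<^sub>K S)"
  obtains ps where "set ps \<subseteq> carrier V \<times> carrier S" "z = tensor_sum V S ps"
proof -
  interpret T: abelian_group "V \<otimes>\<^sub>K S" using m by (intro abelian_group_tensor)
  have "\<exists>ps. set ps \<subseteq> carrier V \<times> carrier S \<and> z = tensor_sum V S ps"
    using z
  proof (induction rule: tensor_induct[OF m, consumes 1, case_names pure add])
    case (pure x y)
    then show ?case
      by (intro exI[of _ "[(x, y)]"]) (simp add: tensor_sum_simps tp_closed m)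
  next
    case (add z w)
    then obtain ps qs where *: "set ps \<subseteq> carrier V \<times> carrier S" "z = tensor_sum V S ps"
      "set qs \<subseteq> carrier V \<times> carrier S" "w = tensor_sum V S qs" by blast
    have "tensor_sum V S (ps @ qs) = tensor_sum V S ps \<oplus>\<^bsub>V \<otimes>\<^sub>K S\<^esub> tensor_sum V S qs"
      using *(1,3) by (induction ps)
        (auto simp: tensor_sum_simps tensor_sum_closed tp_closed m T.a_assoc)
    then show ?case
      using * by (intro exI[of _ "ps @ qs"]) simp
  qed
  then show ?thesis using that by blast
qed

text \<open>
  If a term \<open>x \<otimes> s\<close> of a sum killed by every functional in \<open>F\<close> has \<open>x\<close> outside
  \<open>W\<close>, a functional with \<open>w x = 1\<close> expresses \<open>s\<close> by the other terms, which
  removes one term from the sum.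
\<close>

lemma functionals_separate:
  fixes V :: "'u alg"
  assumes V: "module K V" and S: "S \<in> kalgs K" and W: "submodule W K V"
    and F: "\<And>w. w \<in> F \<Longrightarrow> linear_map K V KK w"
    and sep: "\<And>v. v \<in> carrier V \<Longrightarrow> v \<notin> W \<Longrightarrow> \<exists>w\<in>F. (\<forall>x\<in>W. w x = \<zero>\<^bsub>K\<^esub>) \<and> w v = \<one>\<^bsub>K\<^esub>"
    and D: "\<And>x s. x \<in> W \<Longrightarrow> s \<in> carrier S \<Longrightarrow> tp V S x s \<in> D"
      "\<And>z z'. z \<in> D \<Longrightarrow> z' \<in> D \<Longrightarrow> z \<oplus>\<^bsub>V \<otimes>\<^sub>K S\<^esub> z' \<in> D"
    and z: "z \<in> carrier (V \<otimes>\<^sub>K S)"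
    and kill: "\<And>w. w \<in> F \<Longrightarrow> (\<forall>x\<in>W. w x = \<zero>\<^bsub>K\<^esub>) \<Longrightarrow> contract V S w z = \<zero>\<^bsub>S\<^esub>"
  shows "z \<in> D"
proof -
  interpret V: module K V by fact
  interpret S: algebra K S by (rule kalgsD[OF S])
  note m = V kalgsD(3)[OF S]
  interpret T: abelian_group "V \<otimes>\<^sub>K S" by (rule abelian_group_tensor[OF m])
  note ca = additive_mapD[OF additive_contract[OF V S F]] and ct = contract_tp[OF V S F]
  have cz: "contract V S w \<zero>\<^bsub>V \<otimes>\<^sub>K S\<^esub> = \<zero>\<^bsub>S\<^esub>" if "w \<in> F" for w
    by (rule additive_map_zero[OF additive_contract[OF V S F[OF that]] T.abelian_group_axioms S.M.abelian_group_axioms])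
  have wc: "w x \<in> carrier K" if "w \<in> F" "x \<in> carrier V" for w x
    using linear_map_closed[OF F[OF that(1)] that(2)] by simp
  have "tensor_sum V S ps \<in> D" if "set ps \<subseteq> carrier V \<times> carrier S"
    "\<And>w. w \<in> F \<Longrightarrow> (\<forall>x\<in>W. w x = \<zero>\<^bsub>K\<^esub>) \<Longrightarrow> contract V S w (tensor_sum V S ps) = \<zero>\<^bsub>S\<^esub>" for ps
    using that
  \<comment> \<open>In one case the induction hypothesis is applied to a modified tail, so the
    induction is on the length and not on the structure of the list.\<close>
  proof (induction "length ps" arbitrary: ps)
    case 0
    then show ?case
      using D(1)[OF submodule_D(2)[OF V W] S.M.zero_closed] tp_zero(1)[OF m V.M.zero_closed S.M.zero_closed]
      by (simp add: tensor_sum_simps)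
  next
    case (Suc n)
    then obtain v s qs where ps: "ps = (v, s) # qs" and n: "n = length qs"
      by (metis length_Suc_conv prod.exhaust)
    have c: "v \<in> carrier V" "s \<in> carrier S" "set qs \<subseteq> carrier V \<times> carrier S"
      using Suc.prems(1) ps by auto
    note tc = tensor_sum_closed[OF m c(3)]
    have cps: "contract V S w (tensor_sum V S ps) = w v \<odot>\<^bsub>S\<^esub> s \<oplus>\<^bsub>S\<^esub> contract V S w (tensor_sum V S qs)"
      if "w \<in> F" for w
      using that c tc by (simp add: ps tensor_sum_simps ca ct tp_closed m)
    show ?case
    proof (cases "v \<in> W")
      case True
      have "tensor_sum V S qs \<in> D"
      proof (rule Suc.hyps(1)[OF n c(3)])
        fix w assume w: "w \<in> F" "\<forall>x\<in>W. w x = \<zero>\<^bsub>K\<^esub>"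
        show "contract V S w (tensor_sum V S qs) = \<zero>\<^bsub>S\<^esub>"
          using Suc.prems(2)[OF w] w True c tc by (simp add: cps ca)
      qed
      then show ?thesis
        using D True c by (simp add: ps tensor_sum_simps)
    next
      case False
      then obtain w0 where w0: "w0 \<in> F" "\<forall>x\<in>W. w0 x = \<zero>\<^bsub>K\<^esub>" "w0 v = \<one>\<^bsub>K\<^esub>"
        using sep c by blast
      \<comment> \<open>\<open>r\<close> replaces each \<open>x\<close> by
        \<open>x - w0(x) v\<close>, its projection to the kernel of \<open>w0\<close> along
        \<open>v\<close>. The sum then loses the term \<open>v \<otimes> c\<close>, where
        \<open>c\<close> is its contraction with \<open>w0\<close>.\<close>
      define r :: "('u \<times> 'u) list \<Rightarrow> ('u \<times> 'u) list" where "r = map (\<lambda>p. (fst p \<ominus>\<^bsub>V\<^esub> w0 (fst p) \<odot>\<^bsub>V\<^esub> v, snd p))"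
      have r: "set (r l) \<subseteq> carrier V \<times> carrier S \<and>
          tensor_sum V S (r l) = tensor_sum V S l \<ominus>\<^bsub>V \<otimes>\<^sub>K S\<^esub> tp V S v (contract V S w0 (tensor_sum V S l))"
        if "set l \<subseteq> carrier V \<times> carrier S" for l
        using that
      proof (induction l)
        case Nil
        then show ?case
          using c by (simp add: r_def tensor_sum_simps cz w0 tp_zero m T.minus_eq T.a_inv_zero)
      next
        case (Cons p l)
        obtain x t where p: "p = (x, t)" by force
        have xt: "x \<in> carrier V" "t \<in> carrier S" "set l \<subseteq> carrier V \<times> carrier S"
          using Cons.prems p by auto
        note IH = Cons.IH[OF xt(3)] and tl = tensor_sum_closed[OF m xt(3)]
        have wx: "w0 x \<in> carrier K" using wc w0 xt by blast
        have "tensor_sum V S (r (p # l)) = tp V S (x \<ominus>\<^bsub>V\<^esub> w0 x \<odot>\<^bsub>V\<^esub> v) t \<oplus>\<^bsub>V \<otimes>\<^sub>K S\<^esub> tensor_sum V S (r l)"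
          by (simp add: r_def p tensor_sum_simps)
        also have "\<dots> = tp V S x t \<ominus>\<^bsub>V \<otimes>\<^sub>K S\<^esub> tp V S v (w0 x \<odot>\<^bsub>S\<^esub> t) \<oplus>\<^bsub>V \<otimes>\<^sub>K S\<^esub>
            (tensor_sum V S l \<ominus>\<^bsub>V \<otimes>\<^sub>K S\<^esub> tp V S v (contract V S w0 (tensor_sum V S l)))"
          using xt c wx IH by (simp add: V.M.minus_eq T.minus_eq tp_add_left tp_minus_left tp_smult m)
        also have "\<dots> = (tp V S x t \<oplus>\<^bsub>V \<otimes>\<^sub>K S\<^esub> tensor_sum V S l) \<ominus>\<^bsub>V \<otimes>\<^sub>K S\<^esub>
            tp V S v (w0 x \<odot>\<^bsub>S\<^esub> t \<oplus>\<^bsub>S\<^esub> contract V S w0 (tensor_sum V S l))"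
          using xt c wx tl w0 by (simp add: tp_add_right tp_closed m ca T.minus_eq T.minus_add T.a_ac)
        also have "\<dots> = tensor_sum V S (p # l) \<ominus>\<^bsub>V \<otimes>\<^sub>K S\<^esub> tp V S v (contract V S w0 (tensor_sum V S (p # l)))"
          using xt w0 tl by (simp add: p tensor_sum_simps ca ct tp_closed m)
        finally show ?case
          using IH xt wx c by (auto simp: r_def p)
      qed
      note rq = r[OF c(3)]
      let ?c = "contract V S w0 (tensor_sum V S qs)"
      have cc: "?c \<in> carrier S" using ca(1)[OF w0(1) tc] .
      \<comment> \<open>The hypothesis on \<open>w0\<close> reads \<open>s + ?c = 0\<close>. Hence
        \<open>v \<otimes> s\<close> equals \<open>- (v \<otimes> ?c)\<close>, which is exactly the
        correction from \<open>qs\<close> to \<open>r qs\<close>; the sum of \<open>ps\<close> is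
        that of the list \<open>r qs\<close>, which has one term less.\<close>
      have "s \<oplus>\<^bsub>S\<^esub> ?c = \<zero>\<^bsub>S\<^esub>"
        using Suc.prems(2)[OF w0(1,2)] c by (simp add: cps w0)
      then have "s = \<ominus>\<^bsub>S\<^esub> ?c"
        using S.M.minus_equality[of s ?c] c cc by simp
      moreover have "tp V S v (\<ominus>\<^bsub>S\<^esub> ?c) = \<ominus>\<^bsub>V \<otimes>\<^sub>K S\<^esub> tp V S v ?c"
      proof -
        have "additive_map S (V \<otimes>\<^sub>K S) (tp V S v)"
          using c by (auto simp: additive_map_def tp_closed tp_add_right m)
        from additive_map_minus[OF this S.M.abelian_group_axioms T.abelian_group_axioms cc] show ?thesis .
      qed
      ultimately have e: "tensor_sum V S ps = tensor_sum V S (r qs)"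
        using rq tc cc c by (simp add: ps tensor_sum_simps T.minus_eq T.a_comm tp_closed m)
      have "tensor_sum V S (r qs) \<in> D"
      proof (rule Suc.hyps(1))
        show "n = length (r qs)" by (simp add: n r_def)
        show "set (r qs) \<subseteq> carrier V \<times> carrier S" using rq by blast
        show "contract V S w (tensor_sum V S (r qs)) = \<zero>\<^bsub>S\<^esub>" if "w \<in> F" "\<forall>x\<in>W. w x = \<zero>\<^bsub>K\<^esub>" for w
          using Suc.prems(2)[OF that] by (simp add: e)
      qed
      then show ?thesis by (simp add: e)
    qed
  qed
  moreover obtain ps where "set ps \<subseteq> carrier V \<times> carrier S" "z = tensor_sum V S ps"
    using tensor_sum_exists[OF m z] .
  ultimately show ?thesis
    using kill by blast
qed

lemma submodule_linear_incl: "W \<subseteq> carrier V \<Longrightarrow> linear_map K (V\<lparr>carrier := W\<rparr>) V (\<lambda>x. x)"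
  by (auto simp: linear_map_def)

text \<open>The functionals on \<open>V\<close> restrict to \<open>W\<close> and separate its
  nonzero vectors from zero, and the contraction with a restricted functional factors through
  \<open>V \<otimes> S\<close>. So \<open>functionals_separate\<close>, used for the zero submodule
  with \<open>D\<close> consisting of zero alone, shows that the kernel is trivial.\<close>

lemma tensor_incl_inj:
  fixes V :: "'u alg"
  assumes V: "module K V" and S: "S \<in> kalgs K" and W: "submodule W K V"
  shows "inj_on (tensor_map K (V\<lparr>carrier := W\<rparr>) S V S (\<lambda>x. x) (\<lambda>s. s)) (carrier (V\<lparr>carrier := W\<rparr> \<otimes>\<^sub>K S))"
proof -
  let ?W = "V\<lparr>carrier := W\<rparr>"
  let ?i = "tensor_map K ?W S V S (\<lambda>x. x) (\<lambda>s. s)"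
  interpret V: module K V by fact
  interpret S: algebra K S by (rule kalgsD[OF S])
  have mW: "module K ?W" by (rule submodule.submodule_is_module[OF W V])
  note WD = submodule_D[OF V W]
  have z0: "\<zero>\<^bsub>?W\<^esub> = \<zero>\<^bsub>V\<^esub>" by simp
  interpret W: module K ?W by fact
  interpret TW: abelian_group "?W \<otimes>\<^sub>K S" by (rule abelian_group_tensor[OF mW kalgsD(3)[OF S]])
  interpret TV: abelian_group "V \<otimes>\<^sub>K S" by (rule abelian_group_tensor[OF V kalgsD(3)[OF S]])
  note l = submodule_linear_incl[OF WD(1)]
  have ai: "additive_map (?W \<otimes>\<^sub>K S) (V \<otimes>\<^sub>K S) ?i"
    by (rule additive_tensor_map[OF mW kalgsD(3)[OF S] V kalgsD(3)[OF S] l linear_map_id])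
  interpret i: group_hom "add_monoid (?W \<otimes>\<^sub>K S)" "add_monoid (V \<otimes>\<^sub>K S)" ?i
    by (rule additive_map_group_hom[OF ai TW.abelian_group_axioms TV.abelian_group_axioms])
  have sub0: "submodule {\<zero>\<^bsub>V\<^esub>} K M" if "module K M" "\<zero>\<^bsub>M\<^esub> = \<zero>\<^bsub>V\<^esub>" for M :: "'u alg"
  proof -
    interpret M: module K M by fact
    show ?thesis
      unfolding that(2)[symmetric] by (rule M.submoduleI) auto
  qed
  have "z = \<zero>\<^bsub>?W \<otimes>\<^sub>K S\<^esub>" if z: "z \<in> carrier (?W \<otimes>\<^sub>K S)" "?i z = \<zero>\<^bsub>V \<otimes>\<^sub>K S\<^esub>" for z
  proof -
    have "z \<in> {\<zero>\<^bsub>?W \<otimes>\<^sub>K S\<^esub>}"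
    proof (rule functionals_separate[OF mW S sub0[OF mW z0], where F = "{w. linear_map K V KK w}"])
      show lw: "linear_map K ?W KK w" if "w \<in> {w. linear_map K V KK w}" for w
        using that linear_map_compose[OF l] by auto
      show "\<exists>w\<in>{w. linear_map K V KK w}. (\<forall>x\<in>{\<zero>\<^bsub>V\<^esub>}. w x = \<zero>\<^bsub>K\<^esub>) \<and> w v = \<one>\<^bsub>K\<^esub>"
        if v: "v \<in> carrier ?W" "v \<notin> {\<zero>\<^bsub>V\<^esub>}" for v
      proof -
        have "v \<in> carrier V" using v(1) WD(1) by auto
        then obtain w where "linear_map K V KK w" "\<And>x. x \<in> {\<zero>\<^bsub>V\<^esub>} \<Longrightarrow> w x = \<zero>\<^bsub>K\<^esub>" "w v = \<one>\<^bsub>K\<^esub>"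
          using exists_functional[OF V sub0[OF V refl] _ v(2)] by blast
        then show ?thesis by blast
      qed
      show "tp ?W S x s \<in> {\<zero>\<^bsub>?W \<otimes>\<^sub>K S\<^esub>}" if "x \<in> {\<zero>\<^bsub>V\<^esub>}" "s \<in> carrier S" for x s
        using tp_zero(1)[OF mW kalgsD(3)[OF S] W.M.zero_closed that(2)] that(1) by simp
      show "contract ?W S w z = \<zero>\<^bsub>S\<^esub>" if w: "w \<in> {w. linear_map K V KK w}" for w
      proof -
        have "contract ?W S w z = contract V S w (?i z)"
          unfolding contract_def using z(1) w lw[OF w]
          by (simp add: tensor_map_compose[OF mW kalgsD(3)[OF S] V kalgsD(3)[OF S] kalgsD(3)[OF KK_kalgs] kalgsD(3)[OF S] l linear_map_id _ linear_map_id])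
        also have "\<dots> = \<zero>\<^bsub>S\<^esub>"
          using w unfolding z(2)
          by (intro additive_map_zero[OF additive_contract[OF V S] TV.abelian_group_axioms S.M.abelian_group_axioms]) simp
        finally show ?thesis .
      qed
    qed (use z in auto)
    then show ?thesis by simp
  qed
  then show ?thesis
    by (auto simp: i.inj_on_one_iff[simplified])
qed

end

section \<open>Quasi-coherent functors\<close>

lemma underlying_simps [simp]:
  "on_obj (underlying M) S = carrier (on_obj M S)" "on_hom (underlying M) = on_hom M"
  by (simp_all add: underlying_def)

lemma algebra_morphism_compose:
  assumes "algebra_morphism K A B \<phi>" "algebra_morphism K B C \<psi>"
  shows "algebra_morphism K A C (\<lambda>S x. \<psi> S (\<phi> S x))"
  unfolding algebra_morphism_def
proof (intro conjI ballI)
  show "algebra_map S (on_obj A S) (on_obj C S) (\<lambda>x. \<psi> S (\<phi> S x))" if "S \<in> kalgs K" for S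
    by (rule algebra_map_compose[of _ _ "on_obj B S"]) (use assms that in \<open>auto simp: algebra_morphism_def\<close>)
qed (use assms in \<open>auto simp: algebra_morphism_def set_morphism_def Pi_iff\<close>)

lemma module_morphism_compose:
  assumes "module_morphism K A B \<phi>" "module_morphism K B C \<psi>"
  shows "module_morphism K A C (\<lambda>S x. \<psi> S (\<phi> S x))"
  unfolding module_morphism_def
proof (intro conjI ballI)
  show "linear_map S (on_obj A S) (on_obj C S) (\<lambda>x. \<psi> S (\<phi> S x))" if "S \<in> kalgs K" for S
    by (rule linear_map_compose[of _ _ "on_obj B S"]) (use assms that in \<open>auto simp: module_morphism_def\<close>)
qed (use assms in \<open>auto simp: module_morphism_def set_morphism_def Pi_iff\<close>)

lemma algebra_morphism_imp_module_morphism: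
  "algebra_morphism K A B \<phi> \<Longrightarrow> module_morphism K A B \<phi>"
  by (auto simp: algebra_morphism_def module_morphism_def algebra_map_def)

lemma module_morphismD:
  assumes "module_morphism K A B \<phi>" "S \<in> kalgs K" "x \<in> carrier (on_obj A S)"
  shows "\<phi> S x \<in> carrier (on_obj B S)"
    and "y \<in> carrier (on_obj A S) \<Longrightarrow> \<phi> S (x \<oplus>\<^bsub>on_obj A S\<^esub> y) = \<phi> S x \<oplus>\<^bsub>on_obj B S\<^esub> \<phi> S y"
    and "s \<in> carrier S \<Longrightarrow> \<phi> S (s \<odot>\<^bsub>on_obj A S\<^esub> x) = s \<odot>\<^bsub>on_obj B S\<^esub> \<phi> S x"
    and "T \<in> kalgs K \<Longrightarrow> h \<in> khom K S T \<Longrightarrow> \<phi> T (on_hom A S T h x) = on_hom B S T h (\<phi> S x)"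
  using assms by (auto simp: module_morphism_def set_morphism_def underlying_def linear_map_def Pi_iff)

lemma algebra_morphismD:
  assumes "algebra_morphism K A B \<phi>" "S \<in> kalgs K"
  shows "x \<in> carrier (on_obj A S) \<Longrightarrow> y \<in> carrier (on_obj A S) \<Longrightarrow>
      \<phi> S (x \<otimes>\<^bsub>on_obj A S\<^esub> y) = \<phi> S x \<otimes>\<^bsub>on_obj B S\<^esub> \<phi> S y"
    and "\<phi> S \<one>\<^bsub>on_obj A S\<^esub> = \<one>\<^bsub>on_obj B S\<^esub>"
  using assms by (auto simp: algebra_morphism_def algebra_map_def ring_hom_def)

lemma set_functorD:
  assumes "set_functor K X" "S \<in> kalgs K" "x \<in> on_obj X S"
  shows "T \<in> kalgs K \<Longrightarrow> h \<in> khom K S T \<Longrightarrow> on_hom X S T h x \<in> on_obj X T"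
    and "on_hom X S S (\<lambda>s\<in>carrier S. s) x = x"
    and "T \<in> kalgs K \<Longrightarrow> U \<in> kalgs K \<Longrightarrow> h \<in> khom K S T \<Longrightarrow> g \<in> khom K T U \<Longrightarrow>
      on_hom X S U (compose (carrier S) g h) x = on_hom X T U g (on_hom X S T h x)"
  using assms unfolding set_functor_def by blast+

lemma module_functorD:
  assumes "module_functor K M" "S \<in> kalgs K"
  shows "module S (on_obj M S)"
    and "x \<in> carrier (on_obj M S) \<Longrightarrow> T \<in> kalgs K \<Longrightarrow> h \<in> khom K S T \<Longrightarrow>
      on_hom M S T h x \<in> carrier (on_obj M T)"
    and "x \<in> carrier (on_obj M S) \<Longrightarrow> on_hom M S S (\<lambda>s\<in>carrier S. s) x = x"
    and "x \<in> carrier (on_obj M S) \<Longrightarrow> T \<in> kalgs K \<Longrightarrow> U \<in> kalgs K \<Longrightarrow>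
      h \<in> khom K S T \<Longrightarrow> g \<in> khom K T U \<Longrightarrow>
      on_hom M S U (compose (carrier S) g h) x = on_hom M T U g (on_hom M S T h x)"
    and "x \<in> carrier (on_obj M S) \<Longrightarrow> y \<in> carrier (on_obj M S) \<Longrightarrow> T \<in> kalgs K \<Longrightarrow> h \<in> khom K S T \<Longrightarrow>
      on_hom M S T h (x \<oplus>\<^bsub>on_obj M S\<^esub> y) = on_hom M S T h x \<oplus>\<^bsub>on_obj M T\<^esub> on_hom M S T h y"
    and "s \<in> carrier S \<Longrightarrow> x \<in> carrier (on_obj M S) \<Longrightarrow> T \<in> kalgs K \<Longrightarrow> h \<in> khom K S T \<Longrightarrow>
      on_hom M S T h (s \<odot>\<^bsub>on_obj M S\<^esub> x) = h s \<odot>\<^bsub>on_obj M T\<^esub> on_hom M S T h x"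
proof -
  have X: "set_functor K (underlying M)" using assms(1) by (simp add: module_functor_def)
  note D = set_functorD[OF X assms(2), of x, simplified]
  show "x \<in> carrier (on_obj M S) \<Longrightarrow> T \<in> kalgs K \<Longrightarrow> h \<in> khom K S T \<Longrightarrow>
      on_hom M S T h x \<in> carrier (on_obj M T)"
    "x \<in> carrier (on_obj M S) \<Longrightarrow> on_hom M S S (\<lambda>s\<in>carrier S. s) x = x"
    "x \<in> carrier (on_obj M S) \<Longrightarrow> T \<in> kalgs K \<Longrightarrow> U \<in> kalgs K \<Longrightarrow>
      h \<in> khom K S T \<Longrightarrow> g \<in> khom K T U \<Longrightarrow>
      on_hom M S U (compose (carrier S) g h) x = on_hom M T U g (on_hom M S T h x)"
    by (fact D)+
qed (use assms in \<open>simp_all add: module_functor_def\<close>)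

lemma algebra_functorD:
  assumes "algebra_functor K A"
  shows "module_functor K A"
    and "S \<in> kalgs K \<Longrightarrow> assoc_algebra S (on_obj A S)"
    and "S \<in> kalgs K \<Longrightarrow> ring (on_obj A S)"
    and "S \<in> kalgs K \<Longrightarrow> T \<in> kalgs K \<Longrightarrow> h \<in> khom K S T \<Longrightarrow>
      on_hom A S T h \<in> ring_hom (on_obj A S) (on_obj A T)"
  using assms by (auto simp: algebra_functor_def assoc_algebra_def)

text \<open>Elements of \<open>Spec\<close> are extensional families, so morphisms are constantly
  restricted to carriers. Agreement on the carriers suffices because \<open>A\<close> is closed
  under its operations and its transition maps.\<close>

lemma algebra_morphism_cong:
  assumes "\<And>S x. S \<in> kalgs K \<Longrightarrow> x \<in> carrier (on_obj A S) \<Longrightarrow> \<phi>' S x = \<phi> S x"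
    and A: "algebra_functor K A" and \<phi>: "algebra_morphism K A B \<phi>"
  shows "algebra_morphism K A B \<phi>'"
  unfolding algebra_morphism_def set_morphism_def
proof (intro conjI ballI)
  note D = module_morphismD[OF algebra_morphism_imp_module_morphism[OF \<phi>]] algebra_morphismD[OF \<phi>]
  fix S assume S: "S \<in> kalgs K"
  interpret M: module S "on_obj A S" by (rule module_functorD[OF algebra_functorD(1)[OF A] S])
  interpret R: ring "on_obj A S" by (rule algebra_functorD(3)[OF A S])
  show "\<phi>' S \<in> on_obj (underlying A) S \<rightarrow> on_obj (underlying B) S"
    using D(1)[OF S] assms(1)[OF S] by simp
  show "algebra_map S (on_obj A S) (on_obj B S) (\<phi>' S)"
    by (rule algebra_mapI) (simp_all add: linear_map_def assms(1)[OF S] D S)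
  show "\<phi>' T (on_hom (underlying A) S T h x) = on_hom (underlying B) S T h (\<phi>' S x)"
    if "T \<in> kalgs K" "h \<in> khom K S T" "x \<in> on_obj (underlying A) S" for T h x
    using that S D(4)[OF S _ that(1,2)] module_functorD(2)[OF algebra_functorD(1)[OF A] S _ that(1,2)]
    by (simp add: assms(1))
qed

section \<open>Quasi-coherent functors and the morphisms between them\<close>

lemma qc_simps [simp]:
  "carrier (on_obj (quasi_coherent K M) S) = carrier (tensor K M S)"
  "x \<oplus>\<^bsub>on_obj (quasi_coherent K M) S\<^esub> y = x \<oplus>\<^bsub>tensor K M S\<^esub> y"
  "x \<otimes>\<^bsub>on_obj (quasi_coherent K M) S\<^esub> y = x \<otimes>\<^bsub>tensor K M S\<^esub> y"
  "\<one>\<^bsub>on_obj (quasi_coherent K M) S\<^esub> = \<one>\<^bsub>tensor K M S\<^esub>"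
  "\<zero>\<^bsub>on_obj (quasi_coherent K M) S\<^esub> = \<zero>\<^bsub>tensor K M S\<^esub>"
  "on_hom (quasi_coherent K M) S T h = tensor_map K M S M T (\<lambda>x. x) h"
  by (simp_all add: quasi_coherent_def)

lemma qc_smult:
  "s \<odot>\<^bsub>on_obj (quasi_coherent K M) S\<^esub> z = tensor_map K M S M S (\<lambda>x. x) (\<lambda>t. s \<otimes>\<^bsub>S\<^esub> t) z"
  by (simp add: quasi_coherent_def)

context base_field
begin

abbreviation QC :: "'u alg \<Rightarrow> ('u, 'u) mfunctor" where "QC \<equiv> quasi_coherent K"

context
  fixes M S :: "'u alg"
  assumes M: "module K M" and S: "S \<in> kalgs K"
begin

lemma linear_map_mult: "s \<in> carrier S \<Longrightarrow> linear_map K S S (\<lambda>t. s \<otimes>\<^bsub>S\<^esub> t)"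
  by (rule linear_map_mult_left[OF kalgsD(2)[OF S]])

lemma qc_smult_tp:
  "\<lbrakk>s \<in> carrier S; x \<in> carrier M; t \<in> carrier S\<rbrakk> \<Longrightarrow>
     s \<odot>\<^bsub>on_obj (QC M) S\<^esub> tp M S x t = tp M S x (s \<otimes>\<^bsub>S\<^esub> t)"
  unfolding qc_smult by (intro tensor_map_tp linear_map_mult linear_map_id M kalgsD(3) S)

lemma additive_qc_smult:
  "s \<in> carrier S \<Longrightarrow> additive_map (M \<otimes>\<^sub>K S) (M \<otimes>\<^sub>K S) (\<lambda>z. s \<odot>\<^bsub>on_obj (QC M) S\<^esub> z)"
  unfolding qc_smult by (intro additive_tensor_map linear_map_mult linear_map_id M kalgsD(3) S)

lemmas qc_smult_closed = additive_map_closed[OF additive_qc_smult]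
lemmas qc_smult_add = additive_map_add[OF additive_qc_smult]

end

text \<open>For an algebra \<open>T\<close> the \<open>S\<close>-module structure of the
  quasi-coherent functor is multiplication along the structure morphism of the
  \<open>S\<close>-algebra \<open>T \<otimes> S\<close>. This matches it with the scalar
  multiplication of functions, which also goes through the structure morphism.\<close>

lemma qc_smult_alg:
  assumes "T \<in> kalgs K" "S \<in> kalgs K" "s \<in> carrier S" "z \<in> carrier (T \<otimes>\<^sub>K S)"
  shows "s \<odot>\<^bsub>on_obj (QC T) S\<^esub> z = tensor_right K T S s \<otimes>\<^bsub>T \<otimes>\<^sub>K S\<^esub> z"
proof -
  interpret TS: ring "T \<otimes>\<^sub>K S" by (rule kalgsD(5)[OF tensor_kalgs[OF assms(1,2)]])
  interpret T: ring T by (rule kalgsD(5)[OF assms(1)])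
  interpret S: ring S by (rule kalgsD(5)[OF assms(2)])
  note m = kalgsD(3)[OF assms(1)] kalgsD(3)[OF assms(2)] and as = kalgsD(2)[OF assms(1)] kalgsD(2)[OF assms(2)]
  show ?thesis
    using assms(4) assms(3)
    by (induction rule: tensor_induct[OF m, consumes 1])
       (simp_all add: qc_smult_tp m assms tensor_right_apply tp_mult[OF as] qc_smult_add TS.r_distr tp_closed)
qed

text \<open>\<open>g\<close> acts on the first factor, while scalars and transition maps act on the
  second.\<close>

lemma algebra_morphism_qc_map:
  assumes "assoc_algebra K M" "assoc_algebra K N" "algebra_map K M N g"
  shows "algebra_morphism K (QC M) (QC N) (\<lambda>S. tensor_map K M S N S g (\<lambda>s. s))"
  unfolding algebra_morphism_def set_morphism_def
proof (intro conjI ballI)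
  note m = assoc_algebraD(1)[OF assms(1)] assoc_algebraD(1)[OF assms(2)]
  note g = algebra_mapD[OF assms(3)]
  fix S assume S: "S \<in> kalgs K"
  interpret S: algebra K S by (rule kalgsD[OF S])
  note mS = kalgsD(3)[OF S]
  note am = algebra_mapD[OF algebra_map_tensor_map[OF assms(1) kalgsD(2)[OF S] assms(2) kalgsD(2)[OF S] assms(3) algebra_map_idI]]
  show "tensor_map K M S N S g (\<lambda>s. s) \<in> on_obj (underlying (QC M)) S \<rightarrow> on_obj (underlying (QC N)) S"
    using am by auto
  show "algebra_map S (on_obj (QC M) S) (on_obj (QC N) S) (tensor_map K M S N S g (\<lambda>s. s))"
  proof (rule algebra_mapI)
    show "linear_map S (on_obj (QC M) S) (on_obj (QC N) S) (tensor_map K M S N S g (\<lambda>s. s))"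
      unfolding linear_map_def
    proof (intro conjI ballI)
      fix s z assume s: "s \<in> carrier S" and "z \<in> carrier (on_obj (QC M) S)"
      then have z: "z \<in> carrier (M \<otimes>\<^sub>K S)" by simp
      show "tensor_map K M S N S g (\<lambda>s. s) (s \<odot>\<^bsub>on_obj (QC M) S\<^esub> z) =
          s \<odot>\<^bsub>on_obj (QC N) S\<^esub> tensor_map K M S N S g (\<lambda>s. s) z"
        using z s by (induction rule: tensor_induct[OF m(1) mS, consumes 1])
          (simp_all add: qc_smult_tp qc_smult_closed qc_smult_add m mS S tensor_map_tp g linear_map_id am tp_closed)
    qed (use am in auto)
  qed (use am in auto)
  fix T h z assume T: "T \<in> kalgs K" and h: "h \<in> khom K S T" and "z \<in> on_obj (underlying (QC M)) S"
  then have z: "z \<in> carrier (M \<otimes>\<^sub>K S)" by simp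
  note mT = kalgsD(3)[OF T]
  show "tensor_map K M T N T g (\<lambda>s. s) (on_hom (underlying (QC M)) S T h z) =
      on_hom (underlying (QC N)) S T h (tensor_map K M S N S g (\<lambda>s. s) z)"
    using z by (simp add: tensor_map_compose[OF m(1) mS m(1) mT m(2) mT linear_map_id khomD(2)[OF h] g(1) linear_map_id]
        tensor_map_compose[OF m(1) mS m(2) mS m(2) mT g(1) linear_map_id linear_map_id khomD(2)[OF h]])
qed

text \<open>The balanced map \<open>(x, k) \<mapsto> k x\<close> lifts to a left inverse of
  \<open>x \<mapsto> x \<otimes> 1\<close>. Together with \<open>tp_KK_surj\<close> this identifies
  \<open>M \<otimes> K\<close> with \<open>M\<close>.\<close>

lemma tp_KK_inj:
  assumes M: "module K M" and xy: "x \<in> carrier M" "y \<in> carrier M" "tp M KK x \<one>\<^bsub>K\<^esub> = tp M KK y \<one>\<^bsub>K\<^esub>"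
  shows "x = y"
proof -
  interpret M: module K M by fact
  have *: "k \<odot>\<^bsub>M\<^esub> (l \<odot>\<^bsub>M\<^esub> x) = (l \<otimes>\<^bsub>K\<^esub> k) \<odot>\<^bsub>M\<^esub> x" if "k \<in> carrier K" "l \<in> carrier K" "x \<in> carrier M" for k l x
    using M.smult_assoc1[OF that] M.R.m_comm[OF that(1,2)] by simp
  have "balanced_map K M KK M (\<lambda>x k. k \<odot>\<^bsub>M\<^esub> x)"
    unfolding balanced_map_def using * by (auto simp: M.smult_r_distr M.smult_l_distr)
  then obtain L where "additive_map (M \<otimes>\<^sub>K KK) M L"
    and L: "\<And>x k. x \<in> carrier M \<Longrightarrow> k \<in> carrier KK \<Longrightarrow> L (tp M KK x k) = k \<odot>\<^bsub>M\<^esub> x"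
    by (rule tensor_lift[OF M kalgsD(3)[OF KK_kalgs] M.M.abelian_group_axioms]) (rule that, assumption, simp)
  have Lu: "L (tp M KK u \<one>\<^bsub>K\<^esub>) = u" if "u \<in> carrier M" for u
    using L[OF that, of "\<one>\<^bsub>K\<^esub>"] that by simp
  have "x = L (tp M KK x \<one>\<^bsub>K\<^esub>)" by (rule Lu[OF xy(1), symmetric])
  also have "\<dots> = y" unfolding xy(3) by (rule Lu[OF xy(2)])
  finally show ?thesis .
qed

lemma tp_KK_surj:
  assumes M: "module K M" and z: "z \<in> carrier (M \<otimes>\<^sub>K KK)"
  obtains x where "x \<in> carrier M" "z = tp M KK x \<one>\<^bsub>K\<^esub>"
proof -
  interpret M: module K M by fact
  have "\<exists>x\<in>carrier M. z = tp M KK x \<one>\<^bsub>K\<^esub>"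
    using z
  proof (induction rule: tensor_induct[OF M kalgsD(3)[OF KK_kalgs], consumes 1, case_names pure add])
    case (pure x k)
    have "tp M KK (k \<odot>\<^bsub>M\<^esub> x) \<one>\<^bsub>K\<^esub> = tp M KK x k"
      using pure tp_smult[OF M kalgsD(3)[OF KK_kalgs], of k x "\<one>\<^bsub>K\<^esub>"] by simp
    then show ?case
      using pure by (intro bexI[of _ "k \<odot>\<^bsub>M\<^esub> x"]) auto
  next
    case (add z w)
    then obtain x y where "x \<in> carrier M" "z = tp M KK x \<one>\<^bsub>K\<^esub>" "y \<in> carrier M" "w = tp M KK y \<one>\<^bsub>K\<^esub>"
      by blast
    then show ?case
      by (intro bexI[of _ "x \<oplus>\<^bsub>M\<^esub> y"]) (simp_all add: tp_add_left M kalgsD(3)[OF KK_kalgs])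
  qed
  then show ?thesis using that by blast
qed

text \<open>
  By linearity and naturality along \<open>K \<rightarrow> S\<close>, a morphism of quasi-coherent modules is
  determined by its value at \<open>K\<close>.
\<close>

lemma qc_morphism:
  assumes M: "module K M" and N: "module K N" and \<tau>: "module_morphism K (QC M) (QC N) \<tau>"
  obtains t where "linear_map K M N t"
    "\<And>x. x \<in> carrier M \<Longrightarrow> \<tau> KK (tp M KK x \<one>\<^bsub>K\<^esub>) = tp N KK (t x) \<one>\<^bsub>K\<^esub>"
    "\<And>S z. S \<in> kalgs K \<Longrightarrow> z \<in> carrier (M \<otimes>\<^sub>K S) \<Longrightarrow> \<tau> S z = tensor_map K M S N S t (\<lambda>s. s) z"
proof -
  interpret M: module K M by fact
  interpret N: module K N by fact
  note K3 = kalgsD(3)[OF KK_kalgs]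
  note \<tau>D = module_morphismD[OF \<tau>, simplified]
  have tc: "tp M KK x \<one>\<^bsub>K\<^esub> \<in> carrier (M \<otimes>\<^sub>K KK)" if "x \<in> carrier M" for x
    using tp_closed[OF M K3 that, of "\<one>\<^bsub>K\<^esub>"] by simp
  \<comment> \<open>The map \<open>t\<close> is \<open>\<tau>\<close> at \<open>KK\<close>, read
    through the identification of \<open>M \<otimes> K\<close> with \<open>M\<close> and of
    \<open>N \<otimes> K\<close> with \<open>N\<close>.\<close>
  have "\<forall>x\<in>carrier M. \<exists>y\<in>carrier N. \<tau> KK (tp M KK x \<one>\<^bsub>K\<^esub>) = tp N KK y \<one>\<^bsub>K\<^esub>"
    using tp_KK_surj[OF N \<tau>D(1)[OF KK_kalgs tc]] by metis
  then obtain t where t: "\<And>x. x \<in> carrier M \<Longrightarrow> t x \<in> carrier N"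
    "\<And>x. x \<in> carrier M \<Longrightarrow> \<tau> KK (tp M KK x \<one>\<^bsub>K\<^esub>) = tp N KK (t x) \<one>\<^bsub>K\<^esub>"
    by metis
  have lt: "linear_map K M N t"
    unfolding linear_map_def
  proof (intro conjI ballI)
    show "t \<in> carrier M \<rightarrow> carrier N" using t by auto
    show "t (x \<oplus>\<^bsub>M\<^esub> y) = t x \<oplus>\<^bsub>N\<^esub> t y" if xy: "x \<in> carrier M" "y \<in> carrier M" for x y
    proof (rule tp_KK_inj[OF N])
      show "tp N KK (t (x \<oplus>\<^bsub>M\<^esub> y)) \<one>\<^bsub>K\<^esub> = tp N KK (t x \<oplus>\<^bsub>N\<^esub> t y) \<one>\<^bsub>K\<^esub>"
        using xy by (simp add: t tp_add_left[OF M K3] tp_add_left[OF N K3] \<tau>D(2)[OF KK_kalgs tc tc] flip: t(2))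
    qed (use xy t in auto)
    show "t (k \<odot>\<^bsub>M\<^esub> x) = k \<odot>\<^bsub>N\<^esub> t x" if kx: "k \<in> carrier K" "x \<in> carrier M" for k x
    proof (rule tp_KK_inj[OF N])
      have *: "tp P KK (k \<odot>\<^bsub>P\<^esub> y) \<one>\<^bsub>K\<^esub> = k \<odot>\<^bsub>on_obj (QC P) KK\<^esub> tp P KK y \<one>\<^bsub>K\<^esub>"
        if "module K P" "y \<in> carrier P" for P y
        using kx tp_smult[OF that(1) K3 kx(1) that(2), of "\<one>\<^bsub>K\<^esub>"] qc_smult_tp[OF that(1) KK_kalgs, of k y "\<one>\<^bsub>K\<^esub>"] that
        by simp
      show "tp N KK (t (k \<odot>\<^bsub>M\<^esub> x)) \<one>\<^bsub>K\<^esub> = tp N KK (k \<odot>\<^bsub>N\<^esub> t x) \<one>\<^bsub>K\<^esub>"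
        using kx t by (simp add: *[OF M] *[OF N] \<tau>D(3)[OF KK_kalgs tc] flip: t(2))
    qed (use kx t in auto)
  qed
  have "\<tau> S z = tensor_map K M S N S t (\<lambda>s. s) z" if S: "S \<in> kalgs K" and z: "z \<in> carrier (M \<otimes>\<^sub>K S)" for S z
  proof (rule tensor_eqI[OF M kalgsD(3)[OF S] _ _ _ z])
    note S3 = kalgsD(3)[OF S]
    interpret S: algebra K S by (rule kalgsD[OF S])
    interpret Sr: ring S by (rule kalgsD[OF S])
    show "additive_map (M \<otimes>\<^sub>K S) (N \<otimes>\<^sub>K S) (\<tau> S)"
      using \<tau>D(1,2)[OF S] by (auto simp: additive_map_def)
    show "additive_map (M \<otimes>\<^sub>K S) (N \<otimes>\<^sub>K S) (tensor_map K M S N S t (\<lambda>s. s))"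
      by (rule additive_tensor_map[OF M S3 N S3 lt linear_map_id])
    fix x s assume xs: "x \<in> carrier M" "s \<in> carrier S"
    have ku: "kunit S \<one>\<^bsub>K\<^esub> = \<one>\<^bsub>S\<^esub>"
      using khomD(7)[OF kunit_khom[OF S]] by simp
    have e: "tp P S y \<one>\<^bsub>S\<^esub> = tensor_map K P KK P S (\<lambda>x. x) (kunit S) (tp P KK y \<one>\<^bsub>K\<^esub>)"
      if "module K P" "y \<in> carrier P" for P y
      using that by (simp add: tensor_map_tp[OF that(1) K3 that(1) S3 linear_map_id khomD(2)[OF kunit_khom[OF S]]] ku)
    have e': "tp P S y s = s \<odot>\<^bsub>on_obj (QC P) S\<^esub> tp P S y \<one>\<^bsub>S\<^esub>" if "module K P" "y \<in> carrier P" for P y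
      using that xs by (simp add: qc_smult_tp S)
    have "\<tau> S (tp M S x s) = s \<odot>\<^bsub>on_obj (QC N) S\<^esub> \<tau> S (tp M S x \<one>\<^bsub>S\<^esub>)"
      using xs by (subst e'[OF M xs(1)]) (simp add: \<tau>D(3)[OF S] tp_closed M S3)
    also have "\<tau> S (tp M S x \<one>\<^bsub>S\<^esub>) = tp N S (t x) \<one>\<^bsub>S\<^esub>"
      using xs t by (simp add: e[OF M] e[OF N] \<tau>D(4)[OF KK_kalgs tc S kunit_khom[OF S]])
    finally show "\<tau> S (tp M S x s) = tensor_map K M S N S t (\<lambda>s. s) (tp M S x s)"
      using xs t by (simp add: tensor_map_tp[OF M S3 N S3 lt linear_map_id] flip: e'[OF N])
  qed
  then show ?thesis
    using that lt t(2) by blast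
qed

end

section \<open>Functions on a functor of sets\<close>

lemma base_functor_simps [simp]:
  "carrier (on_obj base_functor S) = carrier S"
  "x \<oplus>\<^bsub>on_obj base_functor S\<^esub> y = x \<oplus>\<^bsub>S\<^esub> y"
  "x \<otimes>\<^bsub>on_obj base_functor S\<^esub> y = x \<otimes>\<^bsub>S\<^esub> y"
  "x \<odot>\<^bsub>on_obj base_functor S\<^esub> y = x \<otimes>\<^bsub>S\<^esub> y"
  "\<one>\<^bsub>on_obj base_functor S\<^esub> = \<one>\<^bsub>S\<^esub>"
  "\<zero>\<^bsub>on_obj base_functor S\<^esub> = \<zero>\<^bsub>S\<^esub>"
  "on_hom base_functor S T h = h"
  by (simp_all add: base_functor_def)

abbreviation functions_on ::
  "'u ring \<Rightarrow> ('u, 'v) sfunctor \<Rightarrow> 'u alg \<Rightarrow> ('u alg \<times> ('u \<Rightarrow> 'u) \<Rightarrow> 'v \<Rightarrow> 'u) set" where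
  "functions_on K X S \<equiv> set_homs K X (underlying base_functor) S"

lemma functions_onD:
  assumes "f \<in> functions_on K X S" "T \<in> kalgs K" "h \<in> khom K S T" "x \<in> on_obj X T"
  shows "f (T, h) x \<in> carrier T"
    and "T' \<in> kalgs K \<Longrightarrow> g \<in> khom K T T' \<Longrightarrow>
      f (T', compose (carrier S) g h) (on_hom X T T' g x) = g (f (T, h) x)"
proof -
  have p: "(T, h) \<in> salgs K S" using assms by (simp add: salgs_iff)
  show "f (T, h) x \<in> carrier T"
    using assms(1,4) p unfolding set_homs_def by (fastforce dest: PiE_mem)
  show "T' \<in> kalgs K \<Longrightarrow> g \<in> khom K T T' \<Longrightarrow>
      f (T', compose (carrier S) g h) (on_hom X T T' g x) = g (f (T, h) x)"
    using assms p by (simp add: set_homs_def)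
qed

lemma functions_on_eqI:
  assumes "f \<in> functions_on K X S" "g \<in> functions_on K X S"
    and "\<And>T h x. T \<in> kalgs K \<Longrightarrow> h \<in> khom K S T \<Longrightarrow> x \<in> on_obj X T \<Longrightarrow> f (T, h) x = g (T, h) x"
  shows "f = g"
proof (rule PiE_ext)
  show "f \<in> (\<Pi>\<^sub>E p\<in>salgs K S. on_obj X (fst p) \<rightarrow>\<^sub>E on_obj (underlying base_functor) (fst p))"
    "g \<in> (\<Pi>\<^sub>E p\<in>salgs K S. on_obj X (fst p) \<rightarrow>\<^sub>E on_obj (underlying base_functor) (fst p))"
    using assms(1,2) by (simp_all add: set_homs_def)
  fix p assume p: "p \<in> salgs K S"
  show "f p = g p"
  proof (rule PiE_ext)
    show "f p \<in> on_obj X (fst p) \<rightarrow>\<^sub>E on_obj (underlying base_functor) (fst p)"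
      "g p \<in> on_obj X (fst p) \<rightarrow>\<^sub>E on_obj (underlying base_functor) (fst p)"
      using assms(1,2) p by (auto simp: set_homs_def dest: PiE_mem)
    show "f p x = g p x" if "x \<in> on_obj X (fst p)" for x
      using assms(3)[of "fst p" "snd p" x] salgsD[OF p] that by simp
  qed
qed

lemma functions_onI:
  assumes "\<And>T h x. T \<in> kalgs K \<Longrightarrow> h \<in> khom K S T \<Longrightarrow> x \<in> on_obj X T \<Longrightarrow> F (T, h) x \<in> carrier T"
    and "\<And>T h x T' g. T \<in> kalgs K \<Longrightarrow> h \<in> khom K S T \<Longrightarrow> x \<in> on_obj X T \<Longrightarrow> T' \<in> kalgs K \<Longrightarrow> g \<in> khom K T T' \<Longrightarrow>
      F (T', compose (carrier S) g h) (on_hom X T T' g x) = g (F (T, h) x)"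
    and X: "set_functor K X" and S: "S \<in> kalgs K"
  shows "(\<lambda>p\<in>salgs K S. \<lambda>x\<in>on_obj X (fst p). F p x) \<in> functions_on K X S"
  unfolding set_homs_def
proof (intro CollectI conjI allI impI ballI)
  show "(\<lambda>p\<in>salgs K S. \<lambda>x\<in>on_obj X (fst p). F p x) \<in>
      (\<Pi>\<^sub>E p\<in>salgs K S. on_obj X (fst p) \<rightarrow>\<^sub>E on_obj (underlying base_functor) (fst p))"
  proof (rule restrict_PiE_iff[THEN iffD2], intro ballI)
    fix p assume p: "p \<in> salgs K S"
    then show "(\<lambda>x\<in>on_obj X (fst p). F p x) \<in> on_obj X (fst p) \<rightarrow>\<^sub>E on_obj (underlying base_functor) (fst p)"
      using assms(1)[of "fst p" "snd p"] salgsD[OF p] by auto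
  qed
  fix T h T' g x
  assume "(T, h) \<in> salgs K S" and T': "T' \<in> kalgs K" and g: "g \<in> khom K T T'" and x: "x \<in> on_obj X T"
  then have T: "T \<in> kalgs K" and h: "h \<in> khom K S T" by (simp_all add: salgs_iff)
  show "(\<lambda>p\<in>salgs K S. \<lambda>x\<in>on_obj X (fst p). F p x) (T', compose (carrier S) g h) (on_hom X T T' g x) =
      on_hom (underlying base_functor) T T' g ((\<lambda>p\<in>salgs K S. \<lambda>x\<in>on_obj X (fst p). F p x) (T, h) x)"
    using T h T' g x assms(2)[OF T h x T' g]
    by (simp add: salgs_iff khom_compose[OF S h g] set_functorD(1)[OF X T x T' g])
qed

lemma function_algebra_simps:
  "carrier (on_obj (function_algebra K X) S) = functions_on K X S"
  "f \<oplus>\<^bsub>on_obj (function_algebra K X) S\<^esub> g = (\<lambda>p\<in>salgs K S. \<lambda>x\<in>on_obj X (fst p). f p x \<oplus>\<^bsub>fst p\<^esub> g p x)"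
  "f \<otimes>\<^bsub>on_obj (function_algebra K X) S\<^esub> g = (\<lambda>p\<in>salgs K S. \<lambda>x\<in>on_obj X (fst p). f p x \<otimes>\<^bsub>fst p\<^esub> g p x)"
  "s \<odot>\<^bsub>on_obj (function_algebra K X) S\<^esub> f = (\<lambda>p\<in>salgs K S. \<lambda>x\<in>on_obj X (fst p). snd p s \<otimes>\<^bsub>fst p\<^esub> f p x)"
  "\<one>\<^bsub>on_obj (function_algebra K X) S\<^esub> = (\<lambda>p\<in>salgs K S. \<lambda>x\<in>on_obj X (fst p). \<one>\<^bsub>fst p\<^esub>)"
  "\<zero>\<^bsub>on_obj (function_algebra K X) S\<^esub> = (\<lambda>p\<in>salgs K S. \<lambda>x\<in>on_obj X (fst p). \<zero>\<^bsub>fst p\<^esub>)"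
  "on_hom (function_algebra K X) S T h = base_change K S T h"
  by (simp_all add: function_algebra_def pointwise_def)

lemma function_algebra_apply:
  assumes "T \<in> kalgs K" "h \<in> khom K S T" "x \<in> on_obj X T"
  shows "(f \<oplus>\<^bsub>on_obj (function_algebra K X) S\<^esub> g) (T, h) x = f (T, h) x \<oplus>\<^bsub>T\<^esub> g (T, h) x"
    "(f \<otimes>\<^bsub>on_obj (function_algebra K X) S\<^esub> g) (T, h) x = f (T, h) x \<otimes>\<^bsub>T\<^esub> g (T, h) x"
    "(s \<odot>\<^bsub>on_obj (function_algebra K X) S\<^esub> f) (T, h) x = h s \<otimes>\<^bsub>T\<^esub> f (T, h) x"
    "\<one>\<^bsub>on_obj (function_algebra K X) S\<^esub> (T, h) x = \<one>\<^bsub>T\<^esub>"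
    "\<zero>\<^bsub>on_obj (function_algebra K X) S\<^esub> (T, h) x = \<zero>\<^bsub>T\<^esub>"
  using assms by (simp_all add: function_algebra_simps salgs_iff)

lemma base_change_apply:
  assumes "T \<in> kalgs K" "h \<in> khom K S' T"
  shows "base_change K S S' g f (T, h) = f (T, compose (carrier S) h g)"
  using assms by (simp add: base_change_def salgs_iff)

lemma base_change_closed:
  assumes f: "f \<in> functions_on K X S" and S: "S \<in> kalgs K" "S' \<in> kalgs K" and g: "g \<in> khom K S S'"
    and X: "set_functor K X"
  shows "base_change K S S' g f \<in> functions_on K X S'"
proof -
  have "(\<lambda>p\<in>salgs K S'. \<lambda>x\<in>on_obj X (fst p). base_change K S S' g f p x) \<in> functions_on K X S'"
  proof (rule functions_onI[OF _ _ X S(2)])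
    fix T h x assume T: "T \<in> kalgs K" "h \<in> khom K S' T" and x: "x \<in> on_obj X T"
    note c = khom_compose[OF S(1) g T(2)]
    show "base_change K S S' g f (T, h) x \<in> carrier T"
      using functions_onD(1)[OF f T(1) c x] by (simp add: base_change_apply T)
    fix T' k assume T': "T' \<in> kalgs K" and k: "k \<in> khom K T T'"
    show "base_change K S S' g f (T', compose (carrier S') k h) (on_hom X T T' k x) = k (base_change K S S' g f (T, h) x)"
      using functions_onD(2)[OF f T(1) c x T' k]
      by (simp add: base_change_apply T T' khom_compose[OF S(2) T(2) k] compose_assoc_carrier[OF g])
  qed
  \<comment> \<open>The restricted family is \<open>base_change\<close> itself, because the values
    of \<open>f\<close> are already extensional.\<close>
  moreover have "(\<lambda>p\<in>salgs K S'. \<lambda>x\<in>on_obj X (fst p). base_change K S S' g f p x) = base_change K S S' g f"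
  proof
    fix p
    show "(\<lambda>p\<in>salgs K S'. \<lambda>x\<in>on_obj X (fst p). base_change K S S' g f p x) p = base_change K S S' g f p"
    proof (cases "p \<in> salgs K S'")
      case True
      then have "(fst p, compose (carrier S) (snd p) g) \<in> salgs K S"
        using khom_compose[OF S(1) g] salgsD[OF True] by (auto simp: salgs_iff)
      then have "f (fst p, compose (carrier S) (snd p) g) \<in> on_obj X (fst p) \<rightarrow>\<^sub>E carrier (fst p)"
        using f PiE_mem[of f "salgs K S" "\<lambda>p. on_obj X (fst p) \<rightarrow>\<^sub>E carrier (fst p)"]
        by (fastforce simp: set_homs_def)
      then show ?thesis
        using True by (simp add: base_change_def PiE_restrict)
    qed (simp add: base_change_def)
  qed
  ultimately show ?thesis by simp
qed

section \<open>The pointwise algebra structure on functions\<close>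

context
  fixes K :: "'u ring" and X :: "('u, 'v) sfunctor" and S
  assumes X: "set_functor K X" and S: "S \<in> kalgs K"
begin

abbreviation (input) FS where "FS \<equiv> on_obj (function_algebra K X) S"

lemma function_algebra_closed:
  shows "f \<in> functions_on K X S \<Longrightarrow> g \<in> functions_on K X S \<Longrightarrow> f \<oplus>\<^bsub>FS\<^esub> g \<in> functions_on K X S"
    "f \<in> functions_on K X S \<Longrightarrow> g \<in> functions_on K X S \<Longrightarrow> f \<otimes>\<^bsub>FS\<^esub> g \<in> functions_on K X S"
    "s \<in> carrier S \<Longrightarrow> f \<in> functions_on K X S \<Longrightarrow> s \<odot>\<^bsub>FS\<^esub> f \<in> functions_on K X S"
    "\<one>\<^bsub>FS\<^esub> \<in> functions_on K X S"
    "\<zero>\<^bsub>FS\<^esub> \<in> functions_on K X S"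
proof -
  have R: "ring T" if "T \<in> kalgs K" for T by (rule kalgsD[OF that])
  have z: "g \<zero>\<^bsub>T\<^esub> = \<zero>\<^bsub>T'\<^esub>" if "g \<in> khom K T T'" "T \<in> kalgs K" "T' \<in> kalgs K" for g T T'
    using additive_map_zero[OF linear_map_additive[OF khomD(2)[OF that(1)]]] that kalgsD(6) by blast
  show "f \<in> functions_on K X S \<Longrightarrow> g \<in> functions_on K X S \<Longrightarrow> f \<oplus>\<^bsub>FS\<^esub> g \<in> functions_on K X S"
    unfolding function_algebra_simps
    by (intro functions_onI X S) (simp_all add: functions_onD khomD ring.ring_simprules R)
  show "f \<in> functions_on K X S \<Longrightarrow> g \<in> functions_on K X S \<Longrightarrow> f \<otimes>\<^bsub>FS\<^esub> g \<in> functions_on K X S"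
    unfolding function_algebra_simps
    by (intro functions_onI X S) (simp_all add: functions_onD khomD ring.ring_simprules R)
  show "s \<in> carrier S \<Longrightarrow> f \<in> functions_on K X S \<Longrightarrow> s \<odot>\<^bsub>FS\<^esub> f \<in> functions_on K X S"
    unfolding function_algebra_simps
    by (intro functions_onI X S) (simp_all add: functions_onD khomD ring.ring_simprules R compose_apply)
  show "\<one>\<^bsub>FS\<^esub> \<in> functions_on K X S"
    unfolding function_algebra_simps
    by (intro functions_onI X S) (simp_all add: khomD ring.ring_simprules R)
  show "\<zero>\<^bsub>FS\<^esub> \<in> functions_on K X S"
    unfolding function_algebra_simps
    by (intro functions_onI X S) (simp_all add: z ring.ring_simprules R)
qed

lemma function_algebra_cring: "cring FS"
  and function_algebra_module: "module S FS"
  and function_algebra_assoc: "assoc_algebra S FS"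
proof -
  have C: "cring T" if "T \<in> kalgs K" for T by (rule kalgsD[OF that])
  note car = function_algebra_simps(1)[of K X S]
  note cl = function_algebra_closed[folded car]
  have ev: "f (T, h) x \<in> carrier T"
    if "f \<in> carrier FS" "T \<in> kalgs K" "h \<in> khom K S T" "x \<in> on_obj X T" for f T h x
    using that unfolding car by (rule functions_onD(1))
  have FE: "f = g" if "f \<in> carrier FS" "g \<in> carrier FS"
    "\<And>T h x. T \<in> kalgs K \<Longrightarrow> h \<in> khom K S T \<Longrightarrow> x \<in> on_obj X T \<Longrightarrow> f (T, h) x = g (T, h) x" for f g
    using that unfolding car by (rule functions_on_eqI)
  note ap = function_algebra_apply ev cring.cring_simprules[OF C] khomD(3-5,7)
  interpret S: cring S by (rule C[OF S])
  have hm: "h (\<ominus>\<^bsub>S\<^esub> \<one>\<^bsub>S\<^esub>) = \<ominus>\<^bsub>T\<^esub> \<one>\<^bsub>T\<^esub>" if "T \<in> kalgs K" "h \<in> khom K S T" for T h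
    using additive_map_minus[OF linear_map_additive[OF khomD(2)[OF that(2)]] kalgsD(6)[OF S] kalgsD(6)[OF that(1)] S.one_closed]
      khomD(7)[OF that(2)] by simp
  have ag: "abelian_group FS"
  proof (rule abelian_groupI)
    fix f assume f: "f \<in> carrier FS"
    show "\<exists>g\<in>carrier FS. g \<oplus>\<^bsub>FS\<^esub> f = \<zero>\<^bsub>FS\<^esub>"
    proof (rule bexI)
      \<comment> \<open>\<open>-1\<close> times \<open>f\<close> serves as the additive inverse, so
        closure under scalar multiplication also covers negation.\<close>
      show m: "(\<ominus>\<^bsub>S\<^esub> \<one>\<^bsub>S\<^esub>) \<odot>\<^bsub>FS\<^esub> f \<in> carrier FS"
        using f by (simp add: cl)
      show "(\<ominus>\<^bsub>S\<^esub> \<one>\<^bsub>S\<^esub>) \<odot>\<^bsub>FS\<^esub> f \<oplus>\<^bsub>FS\<^esub> f = \<zero>\<^bsub>FS\<^esub>"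
      proof (rule FE)
        fix T h x assume a: "T \<in> kalgs K" "h \<in> khom K S T" "x \<in> on_obj X T"
        interpret T: cring T by (rule C[OF a(1)])
        show "((\<ominus>\<^bsub>S\<^esub> \<one>\<^bsub>S\<^esub>) \<odot>\<^bsub>FS\<^esub> f \<oplus>\<^bsub>FS\<^esub> f) (T, h) x = \<zero>\<^bsub>FS\<^esub> (T, h) x"
          using ev[OF f a] by (simp add: function_algebra_apply[OF a] hm[OF a(1,2)] T.l_minus T.l_neg)
      qed (use f m in \<open>simp_all add: cl\<close>)
    qed
  next
    fix f g k assume "f \<in> carrier FS" "g \<in> carrier FS" "k \<in> carrier FS"
    then show "f \<oplus>\<^bsub>FS\<^esub> g \<oplus>\<^bsub>FS\<^esub> k = f \<oplus>\<^bsub>FS\<^esub> (g \<oplus>\<^bsub>FS\<^esub> k)"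
      by (intro FE) (simp_all add: cl ap)
  next
    fix f g assume "f \<in> carrier FS" "g \<in> carrier FS"
    then show "f \<oplus>\<^bsub>FS\<^esub> g = g \<oplus>\<^bsub>FS\<^esub> f"
      by (intro FE) (simp_all add: cl ap)
  next
    fix f assume "f \<in> carrier FS"
    then show "\<zero>\<^bsub>FS\<^esub> \<oplus>\<^bsub>FS\<^esub> f = f"
      by (intro FE) (simp_all add: cl ap)
  qed (simp_all add: cl)
  have comm: "Group.comm_monoid FS"
  proof (rule comm_monoidI)
    fix f g k assume fgk: "f \<in> carrier FS" "g \<in> carrier FS" "k \<in> carrier FS"
    then show "f \<otimes>\<^bsub>FS\<^esub> g \<otimes>\<^bsub>FS\<^esub> k = f \<otimes>\<^bsub>FS\<^esub> (g \<otimes>\<^bsub>FS\<^esub> k)"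
      by (intro FE) (simp_all add: cl ap)
  next
    fix f g assume "f \<in> carrier FS" "g \<in> carrier FS"
    then show "f \<otimes>\<^bsub>FS\<^esub> g = g \<otimes>\<^bsub>FS\<^esub> f"
      by (intro FE) (simp_all add: cl ap)
  next
    fix f assume "f \<in> carrier FS"
    then show "\<one>\<^bsub>FS\<^esub> \<otimes>\<^bsub>FS\<^esub> f = f"
      by (intro FE) (simp_all add: cl ap)
  qed (simp_all add: cl)
  show cr: "cring FS"
  proof (rule cringI[OF ag comm])
    fix f g k assume "f \<in> carrier FS" "g \<in> carrier FS" "k \<in> carrier FS"
    then show "(f \<oplus>\<^bsub>FS\<^esub> g) \<otimes>\<^bsub>FS\<^esub> k = f \<otimes>\<^bsub>FS\<^esub> k \<oplus>\<^bsub>FS\<^esub> g \<otimes>\<^bsub>FS\<^esub> k"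
      by (intro FE) (simp_all add: cl ap)
  qed
  show m: "module S FS"
  proof (rule moduleI[OF C[OF S] ag])
    fix a b f g assume "a \<in> carrier S" "b \<in> carrier S" "f \<in> carrier FS"
    then show "(a \<oplus>\<^bsub>S\<^esub> b) \<odot>\<^bsub>FS\<^esub> f = a \<odot>\<^bsub>FS\<^esub> f \<oplus>\<^bsub>FS\<^esub> b \<odot>\<^bsub>FS\<^esub> f"
      "(a \<otimes>\<^bsub>S\<^esub> b) \<odot>\<^bsub>FS\<^esub> f = a \<odot>\<^bsub>FS\<^esub> (b \<odot>\<^bsub>FS\<^esub> f)"
      by (intro FE; simp add: cl ap)+
  next
    fix a f g assume "a \<in> carrier S" "f \<in> carrier FS" "g \<in> carrier FS"
    then show "a \<odot>\<^bsub>FS\<^esub> (f \<oplus>\<^bsub>FS\<^esub> g) = a \<odot>\<^bsub>FS\<^esub> f \<oplus>\<^bsub>FS\<^esub> a \<odot>\<^bsub>FS\<^esub> g"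
      by (intro FE; simp add: cl ap)
  next
    fix f assume "f \<in> carrier FS"
    then show "\<one>\<^bsub>S\<^esub> \<odot>\<^bsub>FS\<^esub> f = f"
      by (intro FE; simp add: cl ap)
  qed (simp add: cl)
  show "assoc_algebra S FS"
    unfolding assoc_algebra_def
  proof (intro conjI ballI m)
    show "ring FS" using cr by (simp add: cring_def)
    fix a f g assume "a \<in> carrier S" "f \<in> carrier FS" "g \<in> carrier FS"
    then show "a \<odot>\<^bsub>FS\<^esub> f \<otimes>\<^bsub>FS\<^esub> g = a \<odot>\<^bsub>FS\<^esub> (f \<otimes>\<^bsub>FS\<^esub> g)"
      "f \<otimes>\<^bsub>FS\<^esub> (a \<odot>\<^bsub>FS\<^esub> g) = a \<odot>\<^bsub>FS\<^esub> (f \<otimes>\<^bsub>FS\<^esub> g)"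
      by (intro FE; simp add: cl ap)+
  qed
qed

end

text \<open>Base change only precomposes the structure morphism of the test algebra, so it commutes
  with operations that are defined pointwise.\<close>

lemma function_algebra_functor:
  assumes X: "set_functor K X"
  shows "comm_algebra_functor K (function_algebra K X)"
proof -
  note fs = function_algebra_simps(1,7)
  have sf: "set_functor K (underlying (function_algebra K X))"
    unfolding set_functor_def underlying_simps fs
  proof (intro conjI ballI)
    show "base_change K S T h \<in> functions_on K X S \<rightarrow> functions_on K X T"
      if "S \<in> kalgs K" "T \<in> kalgs K" "h \<in> khom K S T" for S T h
      using base_change_closed[OF _ that X] by blast
    show "base_change K S S (\<lambda>s\<in>carrier S. s) f = f" if S: "S \<in> kalgs K" and f: "f \<in> functions_on K X S" for S f
      by (rule functions_on_eqI[OF base_change_closed[OF f S S khom_id[OF S] X] f])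
         (simp add: base_change_apply compose_id)
    fix S T U h g f assume STU: "S \<in> kalgs K" "T \<in> kalgs K" "U \<in> kalgs K"
      and h: "h \<in> khom K S T" and g: "g \<in> khom K T U" and f: "f \<in> functions_on K X S"
    note hg = khom_compose[OF STU(1) h g]
    show "base_change K S U (compose (carrier S) g h) f = base_change K T U g (base_change K S T h f)"
      by (rule functions_on_eqI[OF base_change_closed[OF f STU(1,3) hg X]
            base_change_closed[OF base_change_closed[OF f STU(1,2) h X] STU(2,3) g X]])
         (simp add: base_change_apply khom_compose[OF STU(2) g] compose_assoc_carrier[OF h])
  qed
  have hom: "base_change K S T h (f \<oplus>\<^bsub>on_obj (function_algebra K X) S\<^esub> g) =
        base_change K S T h f \<oplus>\<^bsub>on_obj (function_algebra K X) T\<^esub> base_change K S T h g"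
      "base_change K S T h (f \<otimes>\<^bsub>on_obj (function_algebra K X) S\<^esub> g) =
        base_change K S T h f \<otimes>\<^bsub>on_obj (function_algebra K X) T\<^esub> base_change K S T h g"
      "s \<in> carrier S \<Longrightarrow> base_change K S T h (s \<odot>\<^bsub>on_obj (function_algebra K X) S\<^esub> f) =
        h s \<odot>\<^bsub>on_obj (function_algebra K X) T\<^esub> base_change K S T h f"
      "base_change K S T h \<one>\<^bsub>on_obj (function_algebra K X) S\<^esub> = \<one>\<^bsub>on_obj (function_algebra K X) T\<^esub>"
    if ST: "S \<in> kalgs K" "T \<in> kalgs K" and h: "h \<in> khom K S T"
      and fg: "f \<in> functions_on K X S" "g \<in> functions_on K X S" for S T h f g s
  proof -
    note cl = function_algebra_closed[OF X ST(1)] function_algebra_closed[OF X ST(2)]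
      base_change_closed[OF _ ST h X] khomD(3)[OF h]
    note ap = base_change_apply function_algebra_apply khom_compose[OF ST(1) h] compose_apply
    show "base_change K S T h (f \<oplus>\<^bsub>on_obj (function_algebra K X) S\<^esub> g) =
        base_change K S T h f \<oplus>\<^bsub>on_obj (function_algebra K X) T\<^esub> base_change K S T h g"
      by (intro functions_on_eqI[where K = K and X = X and S = T] cl fg) (simp add: ap)
    show "base_change K S T h (f \<otimes>\<^bsub>on_obj (function_algebra K X) S\<^esub> g) =
        base_change K S T h f \<otimes>\<^bsub>on_obj (function_algebra K X) T\<^esub> base_change K S T h g"
      by (intro functions_on_eqI[where K = K and X = X and S = T] cl fg) (simp add: ap)
    show "base_change K S T h (s \<odot>\<^bsub>on_obj (function_algebra K X) S\<^esub> f) =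
        h s \<odot>\<^bsub>on_obj (function_algebra K X) T\<^esub> base_change K S T h f" if "s \<in> carrier S"
      by (intro functions_on_eqI[where K = K and X = X and S = T] cl fg that) (simp add: ap that)
    show "base_change K S T h \<one>\<^bsub>on_obj (function_algebra K X) S\<^esub> = \<one>\<^bsub>on_obj (function_algebra K X) T\<^esub>"
      by (intro functions_on_eqI[where K = K and X = X and S = T] cl fg) (simp add: ap)
  qed
  have mf: "module_functor K (function_algebra K X)"
    unfolding module_functor_def fs
  proof (intro conjI ballI sf)
    fix S T h f g assume *: "S \<in> kalgs K" "T \<in> kalgs K" "h \<in> khom K S T" "f \<in> functions_on K X S"
    show "base_change K S T h (f \<oplus>\<^bsub>on_obj (function_algebra K X) S\<^esub> g) =
        base_change K S T h f \<oplus>\<^bsub>on_obj (function_algebra K X) T\<^esub> base_change K S T h g"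
      if "g \<in> functions_on K X S"
      by (rule hom(1)[OF * that])
  next
    fix S T h s f assume *: "S \<in> kalgs K" "T \<in> kalgs K" "h \<in> khom K S T" "s \<in> carrier S" "f \<in> functions_on K X S"
    then show "base_change K S T h (s \<odot>\<^bsub>on_obj (function_algebra K X) S\<^esub> f) =
        h s \<odot>\<^bsub>on_obj (function_algebra K X) T\<^esub> base_change K S T h f"
      by (intro hom(3)[of S T h f f s])
  qed (rule function_algebra_module[OF X])
  have rh: "base_change K S T h \<in> ring_hom (on_obj (function_algebra K X) S) (on_obj (function_algebra K X) T)"
    if ST: "S \<in> kalgs K" "T \<in> kalgs K" "h \<in> khom K S T" for S T h
  proof (rule ring_hom_memI; (unfold fs)?)
    show "base_change K S T h f \<in> functions_on K X T" if "f \<in> functions_on K X S" for f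
      by (rule base_change_closed[OF that ST X])
    show "base_change K S T h (f \<otimes>\<^bsub>on_obj (function_algebra K X) S\<^esub> g) =
        base_change K S T h f \<otimes>\<^bsub>on_obj (function_algebra K X) T\<^esub> base_change K S T h g"
      if "f \<in> functions_on K X S" "g \<in> functions_on K X S" for f g
      by (rule hom(2)[OF ST that])
    show "base_change K S T h (f \<oplus>\<^bsub>on_obj (function_algebra K X) S\<^esub> g) =
        base_change K S T h f \<oplus>\<^bsub>on_obj (function_algebra K X) T\<^esub> base_change K S T h g"
      if "f \<in> functions_on K X S" "g \<in> functions_on K X S" for f g
      by (rule hom(1)[OF ST that])
    show "base_change K S T h \<one>\<^bsub>on_obj (function_algebra K X) S\<^esub> = \<one>\<^bsub>on_obj (function_algebra K X) T\<^esub>"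
      using function_algebra_closed(4)[OF X ST(1)] by (intro hom(4)[OF ST])
  qed
  show ?thesis
    unfolding comm_algebra_functor_def algebra_functor_def fs
    by (intro conjI ballI mf rh function_algebra_assoc[OF X] function_algebra_cring[OF X])
qed

section \<open>Spectra\<close>

lemma Spec_simps:
  "x \<in> on_obj (Spec K A) S \<longleftrightarrow>
     x \<in> (\<Pi>\<^sub>E T\<in>kalgs K. carrier (on_obj A T) \<rightarrow>\<^sub>E carrier (on_obj (quasi_coherent K S) T)) \<and>
     algebra_morphism K A (quasi_coherent K S) x"
  "on_hom (Spec K A) S S' g x = (\<lambda>T\<in>kalgs K. \<lambda>a\<in>carrier (on_obj A T). tensor_map K S T S' T g (\<lambda>t. t) (x T a))"
  by (simp_all add: Spec_def)

lemma SpecD: "x \<in> on_obj (Spec K A) S \<Longrightarrow> algebra_morphism K A (quasi_coherent K S) x"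
  by (simp add: Spec_simps)

lemma extensional_family_eqI:
  assumes "x \<in> (\<Pi>\<^sub>E T\<in>I. A T \<rightarrow>\<^sub>E B T)" "y \<in> (\<Pi>\<^sub>E T\<in>I. A T \<rightarrow>\<^sub>E C T)"
    and "\<And>T a. T \<in> I \<Longrightarrow> a \<in> A T \<Longrightarrow> x T a = y T a"
  shows "x = y"
proof (rule PiE_ext[OF assms(1)])
  have "y \<in> (\<Pi>\<^sub>E T\<in>I. A T \<rightarrow>\<^sub>E B T)"
  proof (rule PiE_I)
    fix T assume T: "T \<in> I"
    show "y T \<in> A T \<rightarrow>\<^sub>E B T"
    proof (rule PiE_I)
      show "y T a \<in> B T" if "a \<in> A T" for a
        using PiE_mem[OF PiE_mem[OF assms(1) T] that] assms(3)[OF T that] by simp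
      show "y T a = undefined" if "a \<notin> A T" for a
        using PiE_arb[OF PiE_mem[OF assms(2) T] that] .
    qed
  qed (rule PiE_arb[OF assms(2)])
  then show "y \<in> (\<Pi>\<^sub>E T\<in>I. A T \<rightarrow>\<^sub>E B T)" .
  fix T assume T: "T \<in> I"
  show "x T = y T"
    by (rule PiE_ext[OF PiE_mem[OF assms(1) T] PiE_mem[OF \<open>y \<in> (\<Pi>\<^sub>E T\<in>I. A T \<rightarrow>\<^sub>E B T)\<close> T] assms(3)[OF T]])
qed

lemma Spec_eqI:
  assumes "x \<in> on_obj (Spec K A) S" "y \<in> on_obj (Spec K A) S"
    and "\<And>T a. T \<in> kalgs K \<Longrightarrow> a \<in> carrier (on_obj A T) \<Longrightarrow> x T a = y T a"
  shows "x = y"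
  by (rule extensional_family_eqI[OF assms(1,2)[unfolded Spec_simps, THEN conjunct1] assms(3)])

lemma SpecI:
  assumes A: "algebra_functor K A" and \<phi>: "algebra_morphism K A (quasi_coherent K S) \<phi>"
  shows "(\<lambda>T\<in>kalgs K. \<lambda>a\<in>carrier (on_obj A T). \<phi> T a) \<in> on_obj (Spec K A) S"
  unfolding Spec_simps
proof
  show "(\<lambda>T\<in>kalgs K. \<lambda>a\<in>carrier (on_obj A T). \<phi> T a) \<in>
      (\<Pi>\<^sub>E T\<in>kalgs K. carrier (on_obj A T) \<rightarrow>\<^sub>E carrier (on_obj (quasi_coherent K S) T))"
    using module_morphismD(1)[OF algebra_morphism_imp_module_morphism[OF \<phi>]]
    by (intro restrict_PiE_iff[THEN iffD2] ballI) simp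
  show "algebra_morphism K A (quasi_coherent K S) (\<lambda>T\<in>kalgs K. \<lambda>a\<in>carrier (on_obj A T). \<phi> T a)"
    by (rule algebra_morphism_cong[OF _ A \<phi>]) simp
qed

lemma Spec_on_hom_apply:
  "T \<in> kalgs K \<Longrightarrow> a \<in> carrier (on_obj A T) \<Longrightarrow>
     on_hom (Spec K A) S S' g x T a = tensor_map K S T S' T g (\<lambda>t. t) (x T a)"
  by (simp add: Spec_simps)

context base_field
begin

lemma Spec_closed:
  "x \<in> on_obj (Spec K A) S \<Longrightarrow> T \<in> kalgs K \<Longrightarrow> a \<in> carrier (on_obj A T) \<Longrightarrow> x T a \<in> carrier (S \<otimes>\<^sub>K T)"
  using module_morphismD(1)[OF algebra_morphism_imp_module_morphism[OF SpecD]] by simp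

lemma Spec_on_hom_closed:
  assumes A: "algebra_functor K A" and SS': "S \<in> kalgs K" "S' \<in> kalgs K" and g: "g \<in> khom K S S'"
    and x: "x \<in> on_obj (Spec K A) S"
  shows "on_hom (Spec K A) S S' g x \<in> on_obj (Spec K A) S'"
  unfolding Spec_simps(2)
  by (rule SpecI[OF A algebra_morphism_compose[OF SpecD[OF x]
          algebra_morphism_qc_map[OF kalgsD(2)[OF SS'(1)] kalgsD(2)[OF SS'(2)] khomD(1)[OF g]]]])

lemma set_functor_Spec:
  assumes A: "algebra_functor K A"
  shows "set_functor K (Spec K A)"
  unfolding set_functor_def
proof (intro conjI ballI)
  note cl = Spec_on_hom_closed[OF A]
  show "on_hom (Spec K A) S T h \<in> on_obj (Spec K A) S \<rightarrow> on_obj (Spec K A) T"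
    if "S \<in> kalgs K" "T \<in> kalgs K" "h \<in> khom K S T" for S T h
    using cl[OF that] by blast
  show "on_hom (Spec K A) S S (\<lambda>s\<in>carrier S. s) x = x" if S: "S \<in> kalgs K" and x: "x \<in> on_obj (Spec K A) S" for S x
    by (rule Spec_eqI[OF cl[OF S S khom_id[OF S] x] x])
       (simp add: Spec_on_hom_apply tensor_map_id kalgsD(3) S Spec_closed[OF x])
  fix S T U h g x
  assume STU: "S \<in> kalgs K" "T \<in> kalgs K" "U \<in> kalgs K" and h: "h \<in> khom K S T" and g: "g \<in> khom K T U"
    and x: "x \<in> on_obj (Spec K A) S"
  note hg = khom_compose[OF STU(1) h g]
  show "on_hom (Spec K A) S U (compose (carrier S) g h) x = on_hom (Spec K A) T U g (on_hom (Spec K A) S T h x)"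
  proof (rule Spec_eqI[OF cl[OF STU(1,3) hg x] cl[OF STU(2,3) g cl[OF STU(1,2) h x]]])
    fix V a assume V: "V \<in> kalgs K" and a: "a \<in> carrier (on_obj A V)"
    note m = kalgsD(3)[OF STU(1)] kalgsD(3)[OF STU(2)] kalgsD(3)[OF STU(3)] kalgsD(3)[OF V]
    show "on_hom (Spec K A) S U (compose (carrier S) g h) x V a =
        on_hom (Spec K A) T U g (on_hom (Spec K A) S T h x) V a"
      unfolding Spec_on_hom_apply[OF V a]
        tensor_map_compose[OF m(1,4,2,4,3,4) khomD(2)[OF h] linear_map_id khomD(2)[OF g] linear_map_id Spec_closed[OF x V a]]
      by (rule tensor_map_cong[OF m(1,4,3,4) khomD(2)[OF hg] linear_map_id
            linear_map_compose[OF khomD(2)[OF h] khomD(2)[OF g]] linear_map_id _ _ Spec_closed[OF x V a]])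
         (simp_all add: compose_apply)
  qed
qed

text \<open>Naturality of the coprojections, here of the first and in
  \<open>tensor_map_right\<close> of the second. Points and structure morphisms over
  \<open>S \<otimes> T\<close> are moved along maps of either factor by these equations.\<close>

lemma tensor_map_left:
  assumes "S \<in> kalgs K" "T \<in> kalgs K" "S' \<in> kalgs K" "T' \<in> kalgs K" "algebra_map K S S' f" "algebra_map K T T' g"
  shows "compose (carrier S) (restrict (tensor_map K S T S' T' f g) (carrier (S \<otimes>\<^sub>K T))) (tensor_left K S T) =
    compose (carrier S) (tensor_left K S' T') f"
proof -
  interpret T: ring T by (rule kalgsD[OF assms(2)])
  show ?thesis
    unfolding compose_def
    by (rule restrict_ext)
       (simp add: tensor_left_apply tp_closed kalgsD(3) assms algebra_mapD[OF assms(5)] algebra_mapD[OF assms(6)] tensor_map_tp)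
qed

lemma tensor_map_right:
  assumes "S \<in> kalgs K" "T \<in> kalgs K" "S' \<in> kalgs K" "T' \<in> kalgs K" "algebra_map K S S' f" "algebra_map K T T' g"
  shows "compose (carrier T) (restrict (tensor_map K S T S' T' f g) (carrier (S \<otimes>\<^sub>K T))) (tensor_right K S T) =
    compose (carrier T) (tensor_right K S' T') g"
proof -
  interpret S: ring S by (rule kalgsD[OF assms(1)])
  show ?thesis
    unfolding compose_def
    by (rule restrict_ext)
       (simp add: tensor_right_apply tp_closed kalgsD(3) assms algebra_mapD[OF assms(5)] algebra_mapD[OF assms(6)] tensor_map_tp)
qed

lemma compose_left_id: "g \<in> khom K S T \<Longrightarrow> compose (carrier S) g (\<lambda>s. s) = g"
  using khomD(8)[of g K S T] by (auto simp: compose_def extensional_def)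

text \<open>\<open>B \<otimes> S\<close> is the universal \<open>S\<close>-algebra to which a point with values in \<open>B\<close> extends.\<close>

lemma function_value_universal:
  assumes X: "set_functor K X" and S: "S \<in> kalgs K" "T \<in> kalgs K" "B \<in> kalgs K"
    and h: "h \<in> khom K S T" and i: "i \<in> khom K B T" and x: "x \<in> on_obj X B"
    and f: "f \<in> functions_on K X S"
  shows "f (T, h) (on_hom X B T i x) =
    copair K B S T i h (f (B \<otimes>\<^sub>K S, tensor_right K B S) (on_hom X B (B \<otimes>\<^sub>K S) (tensor_left K B S) x))"
proof -
  note BS = tensor_kalgs[OF S(3,1)]
  note l = tensor_left_khom[OF S(3,1)] and r = tensor_right_khom[OF S(3,1)]
  note c = copair_khom[OF S(2,3,1) i h]
  note xl = set_functorD(1)[OF X S(3) x BS l]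
  \<comment> \<open>This is naturality of \<open>f\<close> along the copairing, whose composites
    with the two coprojections are \<open>i\<close> and \<open>h\<close>.\<close>
  show ?thesis
    using functions_onD(2)[OF f BS r xl S(2) c]
    unfolding copair_right[OF S(2,3,1) i h] set_functorD(3)[OF X S(3) x BS S(2) l c, symmetric]
      copair_left[OF S(2,3,1) i h] .
qed

section \<open>The canonical morphism from a functor to the spectrum of its functions\<close>

context
  fixes X :: "('u, 'w) sfunctor"
  assumes X: "set_functor K X"
begin

lemma to_Spec_functions_apply:
  "T \<in> kalgs K \<Longrightarrow> f \<in> functions_on K X T \<Longrightarrow> to_Spec_functions K X S x T f =
     f (S \<otimes>\<^sub>K T, tensor_right K S T) (on_hom X S (S \<otimes>\<^sub>K T) (tensor_left K S T) x)"
  by (simp add: to_Spec_functions_def function_algebra_simps(1))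

text \<open>Evaluation at the image of \<open>x\<close> in \<open>X(S \<otimes> T)\<close> respects
  the operations since those of functions are pointwise, and it is linear over \<open>T\<close>
  because \<open>S \<otimes> T\<close> is regarded as a \<open>T\<close>-algebra through
  \<open>tensor_right\<close>. Naturality in \<open>T\<close> is that of \<open>f\<close> along
  \<open>1 \<otimes> g\<close>.\<close>

lemma to_Spec_functions_closed:
  assumes S: "S \<in> kalgs K" and x: "x \<in> on_obj X S"
  shows "to_Spec_functions K X S x \<in> on_obj (Spec K (function_algebra K X)) S"
  unfolding to_Spec_functions_def
proof (rule SpecI)
  let ?F = "function_algebra K X"
  let ?\<phi> = "\<lambda>T f. f (S \<otimes>\<^sub>K T, tensor_right K S T) (on_hom X S (S \<otimes>\<^sub>K T) (tensor_left K S T) x)"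
  show A: "algebra_functor K ?F"
    using function_algebra_functor[OF X] by (simp add: comm_algebra_functor_def)
  have xl: "on_hom X S (S \<otimes>\<^sub>K T) (tensor_left K S T) x \<in> on_obj X (S \<otimes>\<^sub>K T)" if "T \<in> kalgs K" for T
    by (rule set_functorD(1)[OF X S x tensor_kalgs[OF S that] tensor_left_khom[OF S that]])
  have cl: "?\<phi> T f \<in> carrier (S \<otimes>\<^sub>K T)" if "T \<in> kalgs K" "f \<in> functions_on K X T" for T f
    by (rule functions_onD(1)[OF that(2) tensor_kalgs[OF S that(1)] tensor_right_khom[OF S that(1)] xl[OF that(1)]])
  show "algebra_morphism K ?F (QC S) ?\<phi>"
    unfolding algebra_morphism_def set_morphism_def
  proof (intro conjI ballI)
    fix T assume T: "T \<in> kalgs K"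
    note ap = function_algebra_apply[OF tensor_kalgs[OF S T] tensor_right_khom[OF S T] xl[OF T]]
    show "?\<phi> T \<in> on_obj (underlying ?F) T \<rightarrow> on_obj (underlying (QC S)) T"
      using cl[OF T] by (simp add: function_algebra_simps(1))
    show "algebra_map T (on_obj ?F T) (on_obj (QC S) T) (?\<phi> T)"
      by (rule algebra_mapI)
         (auto simp: linear_map_def ap cl[OF T] qc_smult_alg[OF S T] function_algebra_simps(1))
    fix U g f assume U: "U \<in> kalgs K" and g: "g \<in> khom K T U" and "f \<in> on_obj (underlying ?F) T"
    then have f: "f \<in> functions_on K X T" by (simp add: function_algebra_simps(1))
    note t = tensor_map_khom[OF S T S U algebra_map_idI khomD(1)[OF g]]
    \<comment> \<open>The maps into \<open>S \<otimes> U\<close> from \<open>T\<close> and from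
      \<open>S\<close> both factor through \<open>S \<otimes> T\<close>, so that naturality of
      \<open>f\<close> along \<open>1 \<otimes> g\<close> applies.\<close>
    have 1: "compose (carrier T) (tensor_right K S U) g =
        compose (carrier T) (restrict (tensor_map K S T S U (\<lambda>x. x) g) (carrier (S \<otimes>\<^sub>K T))) (tensor_right K S T)"
      by (rule tensor_map_right[OF S T S U algebra_map_idI khomD(1)[OF g], symmetric])
    have 2: "tensor_left K S U =
        compose (carrier S) (restrict (tensor_map K S T S U (\<lambda>x. x) g) (carrier (S \<otimes>\<^sub>K T))) (tensor_left K S T)"
      unfolding tensor_map_left[OF S T S U algebra_map_idI khomD(1)[OF g]]
      by (rule compose_left_id[OF tensor_left_khom[OF S U], symmetric])
    have "?\<phi> U (base_change K T U g f) =
        f (S \<otimes>\<^sub>K U, compose (carrier T) (tensor_right K S U) g) (on_hom X S (S \<otimes>\<^sub>K U) (tensor_left K S U) x)"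
      by (simp add: base_change_apply tensor_kalgs S U tensor_right_khom)
    also have "\<dots> = restrict (tensor_map K S T S U (\<lambda>x. x) g) (carrier (S \<otimes>\<^sub>K T)) (?\<phi> T f)"
      unfolding 1 2
        set_functorD(3)[OF X S x tensor_kalgs[OF S T] tensor_kalgs[OF S U] tensor_left_khom[OF S T] t]
      by (rule functions_onD(2)[OF f tensor_kalgs[OF S T] tensor_right_khom[OF S T] xl[OF T] tensor_kalgs[OF S U] t])
    finally show "?\<phi> U (on_hom (underlying ?F) T U g f) = on_hom (underlying (QC S)) T U g (?\<phi> T f)"
      using cl[OF T f] by (simp add: function_algebra_simps(7))
  qed
qed

text \<open>\<open>f\<close> is natural along \<open>g \<otimes> 1\<close>, which carries the image
  of \<open>x\<close> over \<open>S \<otimes> T\<close> to that of \<open>g x\<close> over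
  \<open>S' \<otimes> T\<close>.\<close>

lemma to_Spec_functions_morphism:
  "set_morphism K X (Spec K (function_algebra K X)) (to_Spec_functions K X)"
  unfolding set_morphism_def
proof (intro conjI ballI)
  let ?F = "function_algebra K X"
  show "to_Spec_functions K X S \<in> on_obj X S \<rightarrow> on_obj (Spec K ?F) S" if "S \<in> kalgs K" for S
    using to_Spec_functions_closed[OF that] by blast
  fix S S' g x assume S: "S \<in> kalgs K" and S': "S' \<in> kalgs K" and g: "g \<in> khom K S S'" and x: "x \<in> on_obj X S"
  have A: "algebra_functor K ?F"
    using function_algebra_functor[OF X] by (simp add: comm_algebra_functor_def)
  note xg = set_functorD(1)[OF X S x S' g]
  show "to_Spec_functions K X S' (on_hom X S S' g x) = on_hom (Spec K ?F) S S' g (to_Spec_functions K X S x)"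
  proof (rule Spec_eqI[OF to_Spec_functions_closed[OF S' xg] Spec_on_hom_closed[OF A S S' g to_Spec_functions_closed[OF S x]]])
    fix T f assume T: "T \<in> kalgs K" and fc: "f \<in> carrier (on_obj ?F T)"
    then have f: "f \<in> functions_on K X T" by (simp add: function_algebra_simps(1))
    note t = tensor_map_khom[OF S T S' T khomD(1)[OF g] algebra_map_idI]
    let ?t = "restrict (tensor_map K S T S' T g (\<lambda>x. x)) (carrier (S \<otimes>\<^sub>K T))"
    have 1: "tensor_right K S' T = compose (carrier T) ?t (tensor_right K S T)"
      unfolding tensor_map_right[OF S T S' T khomD(1)[OF g] algebra_map_idI]
      by (rule compose_left_id[OF tensor_right_khom[OF S' T], symmetric])
    have 2: "compose (carrier S) (tensor_left K S' T) g = compose (carrier S) ?t (tensor_left K S T)"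
      by (rule tensor_map_left[OF S T S' T khomD(1)[OF g] algebra_map_idI, symmetric])
    note xl = set_functorD(1)[OF X S x tensor_kalgs[OF S T] tensor_left_khom[OF S T]]
    have "to_Spec_functions K X S' (on_hom X S S' g x) T f =
        f (S' \<otimes>\<^sub>K T, tensor_right K S' T) (on_hom X S (S' \<otimes>\<^sub>K T) (compose (carrier S) (tensor_left K S' T) g) x)"
      unfolding to_Spec_functions_apply[OF T f]
        set_functorD(3)[OF X S x S' tensor_kalgs[OF S' T] g tensor_left_khom[OF S' T]] ..
    also have "\<dots> = ?t (to_Spec_functions K X S x T f)"
      unfolding 1 2 to_Spec_functions_apply[OF T f]
        set_functorD(3)[OF X S x tensor_kalgs[OF S T] tensor_kalgs[OF S' T] tensor_left_khom[OF S T] t]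
      by (rule functions_onD(2)[OF f tensor_kalgs[OF S T] tensor_right_khom[OF S T] xl tensor_kalgs[OF S' T] t])
    also have "\<dots> = on_hom (Spec K ?F) S S' g (to_Spec_functions K X S x) T f"
      using Spec_closed[OF to_Spec_functions_closed[OF S x] T fc] by (simp add: Spec_on_hom_apply[OF T fc])
    finally show "to_Spec_functions K X S' (on_hom X S S' g x) T f =
        on_hom (Spec K ?F) S S' g (to_Spec_functions K X S x) T f" .
  qed
qed

end

end

section \<open>Reflexive functors\<close>

lemma dual_simps:
  "carrier (on_obj (dual K M) S) = module_homs K M base_functor S"
  "f \<oplus>\<^bsub>on_obj (dual K M) S\<^esub> g = (\<lambda>p\<in>salgs K S. \<lambda>x\<in>carrier (on_obj M (fst p)). f p x \<oplus>\<^bsub>fst p\<^esub> g p x)"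
  "s \<odot>\<^bsub>on_obj (dual K M) S\<^esub> f = (\<lambda>p\<in>salgs K S. \<lambda>x\<in>carrier (on_obj M (fst p)). snd p s \<otimes>\<^bsub>fst p\<^esub> f p x)"
  "on_hom (dual K M) S T h = base_change K S T h"
  by (simp_all add: dual_def module_Hom_def pointwise_def)

lemma dual_apply:
  assumes "T \<in> kalgs K" "h \<in> khom K S T" "x \<in> carrier (on_obj M T)"
  shows "(f \<oplus>\<^bsub>on_obj (dual K M) S\<^esub> g) (T, h) x = f (T, h) x \<oplus>\<^bsub>T\<^esub> g (T, h) x"
    "(s \<odot>\<^bsub>on_obj (dual K M) S\<^esub> f) (T, h) x = h s \<otimes>\<^bsub>T\<^esub> f (T, h) x"
  using assms by (simp_all add: dual_simps salgs_iff)

lemma module_homsD: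
  assumes "f \<in> module_homs K M base_functor S"
  shows "f \<in> functions_on K (underlying M) S"
    and "T \<in> kalgs K \<Longrightarrow> h \<in> khom K S T \<Longrightarrow> linear_map T (on_obj M T) (on_obj base_functor T) (f (T, h))"
  using assms by (auto simp: module_homs_def salgs_iff)

lemma module_homsI:
  assumes f: "f \<in> functions_on K (underlying M) S"
    and "\<And>T h x y. T \<in> kalgs K \<Longrightarrow> h \<in> khom K S T \<Longrightarrow> x \<in> carrier (on_obj M T) \<Longrightarrow> y \<in> carrier (on_obj M T) \<Longrightarrow>
      f (T, h) (x \<oplus>\<^bsub>on_obj M T\<^esub> y) = f (T, h) x \<oplus>\<^bsub>T\<^esub> f (T, h) y"
    and "\<And>T h t x. T \<in> kalgs K \<Longrightarrow> h \<in> khom K S T \<Longrightarrow> t \<in> carrier T \<Longrightarrow> x \<in> carrier (on_obj M T) \<Longrightarrow>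
      f (T, h) (t \<odot>\<^bsub>on_obj M T\<^esub> x) = t \<otimes>\<^bsub>T\<^esub> f (T, h) x"
  shows "f \<in> module_homs K M base_functor S"
  unfolding module_homs_def
proof (intro CollectI conjI f ballI)
  fix p assume "p \<in> salgs K S"
  then obtain T h where p: "p = (T, h)" and T: "T \<in> kalgs K" "h \<in> khom K S T"
    by (cases p) (auto simp: salgs_iff)
  show "case p of (T, h) \<Rightarrow> linear_map T (on_obj M T) (on_obj base_functor T) (f (T, h))"
    using functions_onD(1)[OF f T] assms(2,3)[OF T] by (simp add: p linear_map_def)
qed

lemma base_change_module_homs:
  assumes f: "f \<in> module_homs K M base_functor S" and S: "S \<in> kalgs K" "S' \<in> kalgs K" and g: "g \<in> khom K S S'"
    and M: "set_functor K (underlying M)"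
  shows "base_change K S S' g f \<in> module_homs K M base_functor S'"
proof -
  have "case p of (T, h) \<Rightarrow> linear_map T (on_obj M T) (on_obj base_functor T) (base_change K S S' g f (T, h))"
    if "p \<in> salgs K S'" for p
    using that module_homsD(2)[OF f _ khom_compose[OF S(1) g]]
    by (cases p) (simp add: salgs_iff base_change_apply)
  then show ?thesis
    unfolding module_homs_def using base_change_closed[OF module_homsD(1)[OF f] S g M] by blast
qed

lemma set_functor_dual:
  assumes M: "set_functor K (underlying M)"
  shows "set_functor K (underlying (dual K M))"
proof -
  have F: "set_functor K (underlying (function_algebra K (underlying M)))"
    using function_algebra_functor[OF M]
    by (simp add: comm_algebra_functor_def algebra_functor_def module_functor_def)
  note D = set_functorD[OF F, unfolded underlying_simps function_algebra_simps]
  show ?thesis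
    unfolding set_functor_def underlying_simps dual_simps
  proof (intro conjI ballI)
    show "base_change K S T h \<in> module_homs K M base_functor S \<rightarrow> module_homs K M base_functor T"
      if "S \<in> kalgs K" "T \<in> kalgs K" "h \<in> khom K S T" for S T h
      using base_change_module_homs[OF _ that M] by blast
    show "base_change K S S (\<lambda>s\<in>carrier S. s) f = f" if "S \<in> kalgs K" "f \<in> module_homs K M base_functor S" for S f
      by (rule D(2)[OF that(1) module_homsD(1)[OF that(2)]])
    show "base_change K S U (compose (carrier S) g h) f = base_change K T U g (base_change K S T h f)"
      if "S \<in> kalgs K" "T \<in> kalgs K" "U \<in> kalgs K" "h \<in> khom K S T" "g \<in> khom K T U"
        "f \<in> module_homs K M base_functor S" for S T U h g f
      by (rule D(3)[OF that(1) module_homsD(1)[OF that(6)] that(2-5)])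
  qed
qed

text \<open>The operations are those of the functions on the underlying functor, where closure is
  known. Only linearity of the result remains, which for scalar multiples uses commutativity of
  \<open>T\<close>.\<close>

lemma dual_closed:
  assumes M: "module_functor K M" and S: "S \<in> kalgs K" and f: "f \<in> module_homs K M base_functor S"
  shows "g \<in> module_homs K M base_functor S \<Longrightarrow> f \<oplus>\<^bsub>on_obj (dual K M) S\<^esub> g \<in> module_homs K M base_functor S"
    and "s \<in> carrier S \<Longrightarrow> s \<odot>\<^bsub>on_obj (dual K M) S\<^esub> f \<in> module_homs K M base_functor S"
proof -
  have sM: "set_functor K (underlying M)" using M by (simp add: module_functor_def)
  have e: "f \<oplus>\<^bsub>on_obj (dual K M) S\<^esub> g = f \<oplus>\<^bsub>on_obj (function_algebra K (underlying M)) S\<^esub> g"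
    "s \<odot>\<^bsub>on_obj (dual K M) S\<^esub> f = s \<odot>\<^bsub>on_obj (function_algebra K (underlying M)) S\<^esub> f" for f g s
    by (simp_all add: dual_simps function_algebra_simps)
  note D = linear_mapD[OF module_homsD(2), simplified]
  show "f \<oplus>\<^bsub>on_obj (dual K M) S\<^esub> g \<in> module_homs K M base_functor S" if g: "g \<in> module_homs K M base_functor S"
  proof (rule module_homsI)
    show "f \<oplus>\<^bsub>on_obj (dual K M) S\<^esub> g \<in> functions_on K (underlying M) S"
      unfolding e by (intro function_algebra_closed[OF sM S] module_homsD f g)
    fix T h x assume T: "T \<in> kalgs K" and h: "h \<in> khom K S T" and x: "x \<in> carrier (on_obj M T)"
    interpret M: module T "on_obj M T" by (rule module_functorD(1)[OF M T])
    note [simp] = dual_apply[OF T h] D[OF f T h] D[OF g T h] x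
    show "(f \<oplus>\<^bsub>on_obj (dual K M) S\<^esub> g) (T, h) (x \<oplus>\<^bsub>on_obj M T\<^esub> y) =
        (f \<oplus>\<^bsub>on_obj (dual K M) S\<^esub> g) (T, h) x \<oplus>\<^bsub>T\<^esub> (f \<oplus>\<^bsub>on_obj (dual K M) S\<^esub> g) (T, h) y"
      if "y \<in> carrier (on_obj M T)" for y
      using that by (simp add: M.R.a_ac)
    show "(f \<oplus>\<^bsub>on_obj (dual K M) S\<^esub> g) (T, h) (t \<odot>\<^bsub>on_obj M T\<^esub> x) =
        t \<otimes>\<^bsub>T\<^esub> (f \<oplus>\<^bsub>on_obj (dual K M) S\<^esub> g) (T, h) x" if "t \<in> carrier T" for t
      using that by (simp add: M.R.r_distr)
  qed
  show "s \<odot>\<^bsub>on_obj (dual K M) S\<^esub> f \<in> module_homs K M base_functor S" if s: "s \<in> carrier S"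
  proof (rule module_homsI)
    show "s \<odot>\<^bsub>on_obj (dual K M) S\<^esub> f \<in> functions_on K (underlying M) S"
      unfolding e by (intro function_algebra_closed[OF sM S] module_homsD f s)
    fix T h x assume T: "T \<in> kalgs K" and h: "h \<in> khom K S T" and x: "x \<in> carrier (on_obj M T)"
    interpret M: module T "on_obj M T" by (rule module_functorD(1)[OF M T])
    note [simp] = dual_apply[OF T h] D[OF f T h] x khomD(3)[OF h s]
    show "(s \<odot>\<^bsub>on_obj (dual K M) S\<^esub> f) (T, h) (x \<oplus>\<^bsub>on_obj M T\<^esub> y) =
        (s \<odot>\<^bsub>on_obj (dual K M) S\<^esub> f) (T, h) x \<oplus>\<^bsub>T\<^esub> (s \<odot>\<^bsub>on_obj (dual K M) S\<^esub> f) (T, h) y"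
      if "y \<in> carrier (on_obj M T)" for y
      using that by (simp add: M.R.r_distr)
    show "(s \<odot>\<^bsub>on_obj (dual K M) S\<^esub> f) (T, h) (t \<odot>\<^bsub>on_obj M T\<^esub> x) =
        t \<otimes>\<^bsub>T\<^esub> (s \<odot>\<^bsub>on_obj (dual K M) S\<^esub> f) (T, h) x" if "t \<in> carrier T" for t
      using that by (simp add: M.R.m_lcomm)
  qed
qed

lemma to_bidual_apply:
  assumes "a \<in> carrier (on_obj M S)" "T \<in> kalgs K" "h \<in> khom K S T" "w \<in> module_homs K M base_functor T"
  shows "to_bidual K M S a (T, h) w = w (T, \<lambda>t\<in>carrier T. t) (on_hom M S T h a)"
  using assms by (simp add: to_bidual_def salgs_iff dual_simps)

section \<open>Linear forms on a reflexive functor and the image of \<open>A(K)\<close>\<close>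

context base_field
begin

context
  fixes V S :: "'u alg" and w
  assumes V: "module K V" and S: "S \<in> kalgs K" and w: "linear_map K V KK w"
begin

interpretation V: module K V by (rule V)
interpretation S: algebra K S by (rule kalgsD[OF S])
interpretation S: ring S by (rule kalgsD[OF S])

lemma contract_smult:
  assumes "s \<in> carrier S" "z \<in> carrier (V \<otimes>\<^sub>K S)"
  shows "contract V S w (s \<odot>\<^bsub>on_obj (QC V) S\<^esub> z) = s \<otimes>\<^bsub>S\<^esub> contract V S w z"
  using assms(2,1)
  by (induction rule: tensor_induct[OF V kalgsD(3)[OF S], consumes 1])
     (simp_all add: qc_smult_tp[OF V S] qc_smult_add[OF V S] qc_smult_closed[OF V S] contract_tp[OF V S w]
       additive_mapD[OF additive_contract[OF V S w]] S.r_distr linear_map_closed[OF w, simplified]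
       assoc_algebraD(4)[OF kalgsD(2)[OF S]])

lemma contract_natural:
  assumes T: "T \<in> kalgs K" and g: "g \<in> khom K S T" and z: "z \<in> carrier (V \<otimes>\<^sub>K S)"
  shows "contract V T w (tensor_map K V S V T (\<lambda>x. x) g z) = g (contract V S w z)"
proof (rule tensor_eqI[OF V kalgsD(3)[OF S] _ _ _ z])
  show "additive_map (V \<otimes>\<^sub>K S) T (\<lambda>z. contract V T w (tensor_map K V S V T (\<lambda>x. x) g z))"
    by (rule additive_map_compose[OF additive_tensor_map additive_contract])
       (intro V S T kalgsD(3) linear_map_id khomD(2)[OF g] w)+
  show "additive_map (V \<otimes>\<^sub>K S) T (\<lambda>z. g (contract V S w z))"
    by (rule additive_map_compose[OF additive_contract[OF V S w] linear_map_additive[OF khomD(2)[OF g]]])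
  show "contract V T w (tensor_map K V S V T (\<lambda>x. x) g (tp V S x s)) = g (contract V S w (tp V S x s))"
    if "x \<in> carrier V" "s \<in> carrier S" for x s
    using that by (simp add: tensor_map_tp V S T kalgsD(3) linear_map_id khomD[OF g] contract_tp w
        linear_map_closed[OF w, simplified])
qed

end

text \<open>
  The element of \<open>A(K)\<close> is the one whose image in the bidual sends \<open>w\<close>, a linear form over \<open>T\<close>, to
  the image of \<open>w(a) \<in> S \<otimes> T\<close> under \<open>s \<otimes> t \<mapsto> l(s) t\<close>.
\<close>

lemma reflexive_linear_image:
  assumes A: "reflexive K A" and S: "S \<in> kalgs K" and a: "a \<in> carrier (on_obj A S)"
    and l: "linear_map K S KK l"
  obtains \<alpha> where "\<alpha> \<in> carrier (on_obj A KK)"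
    "\<And>f. f \<in> module_homs K A base_functor KK \<Longrightarrow> f (KK, \<lambda>k\<in>carrier KK. k) \<alpha> = l (f (S, kunit S) a)"
proof -
  have mA: "module_functor K A" and iso: "module_iso K A (dual K (dual K A)) (to_bidual K A)"
    using A by (auto simp: reflexive_def)
  have sA: "set_functor K (underlying A)" using mA by (simp add: module_functor_def)
  note sD = set_functor_dual[OF sA]
  define F where "F p w = contract S (fst p) l
    (w (S \<otimes>\<^sub>K fst p, tensor_right K S (fst p)) (on_hom A S (S \<otimes>\<^sub>K fst p) (tensor_left K S (fst p)) a))" for p :: "'u alg \<times> ('u \<Rightarrow> 'u)" and w
  define \<Phi> where "\<Phi> = (\<lambda>p\<in>salgs K KK. \<lambda>w\<in>on_obj (underlying (dual K A)) (fst p). F p w)"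
  note S3 = kalgsD(3)[OF S]
  have al: "on_hom A S (S \<otimes>\<^sub>K T) (tensor_left K S T) a \<in> carrier (on_obj A (S \<otimes>\<^sub>K T))" if T: "T \<in> kalgs K" for T
    by (rule module_functorD(2)[OF mA S a tensor_kalgs[OF S T] tensor_left_khom[OF S T]])
  have wc: "w (S \<otimes>\<^sub>K T, tensor_right K S T) (on_hom A S (S \<otimes>\<^sub>K T) (tensor_left K S T) a) \<in> carrier (S \<otimes>\<^sub>K T)"
    if "T \<in> kalgs K" "w \<in> module_homs K A base_functor T" for T w
    using functions_onD(1)[OF module_homsD(1)[OF that(2)] tensor_kalgs[OF S that(1)] tensor_right_khom[OF S that(1)]] al[OF that(1)]
    by simp
  have cc: "contract S T l z \<in> carrier T" if "T \<in> kalgs K" "z \<in> carrier (S \<otimes>\<^sub>K T)" for T z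
    by (rule additive_map_closed[OF additive_contract[OF S3 that(1) l] that(2)])
  have \<Phi>f: "\<Phi> \<in> functions_on K (underlying (dual K A)) KK"
    unfolding \<Phi>_def
  proof (rule functions_onI[OF _ _ sD KK_kalgs])
    fix T h w assume T: "T \<in> kalgs K" and h: "h \<in> khom K KK T" and "w \<in> on_obj (underlying (dual K A)) T"
    then have w: "w \<in> module_homs K A base_functor T" by (simp add: dual_simps)
    show "F (T, h) w \<in> carrier T"
      using cc[OF T wc[OF T w]] by (simp add: F_def)
    fix T' g assume T': "T' \<in> kalgs K" and g: "g \<in> khom K T T'"
    note t = tensor_map_khom[OF S T S T' algebra_map_idI khomD(1)[OF g]]
    let ?t = "restrict (tensor_map K S T S T' (\<lambda>x. x) g) (carrier (S \<otimes>\<^sub>K T))"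
    have 1: "compose (carrier T) (tensor_right K S T') g = compose (carrier T) ?t (tensor_right K S T)"
      by (rule tensor_map_right[OF S T S T' algebra_map_idI khomD(1)[OF g], symmetric])
    have 2: "tensor_left K S T' = compose (carrier S) ?t (tensor_left K S T)"
      unfolding tensor_map_left[OF S T S T' algebra_map_idI khomD(1)[OF g]]
      by (rule compose_left_id[OF tensor_left_khom[OF S T'], symmetric])
    have "base_change K T T' g w (S \<otimes>\<^sub>K T', tensor_right K S T') (on_hom A S (S \<otimes>\<^sub>K T') (tensor_left K S T') a) =
      w (S \<otimes>\<^sub>K T', compose (carrier T) ?t (tensor_right K S T))
        (on_hom A (S \<otimes>\<^sub>K T) (S \<otimes>\<^sub>K T') ?t (on_hom A S (S \<otimes>\<^sub>K T) (tensor_left K S T) a))"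
      unfolding base_change_apply[OF tensor_kalgs[OF S T'] tensor_right_khom[OF S T']] 1 2
        module_functorD(4)[OF mA S a tensor_kalgs[OF S T] tensor_kalgs[OF S T'] tensor_left_khom[OF S T] t] ..
    also have "\<dots> = ?t (w (S \<otimes>\<^sub>K T, tensor_right K S T) (on_hom A S (S \<otimes>\<^sub>K T) (tensor_left K S T) a))"
      using functions_onD(2)[OF module_homsD(1)[OF w] tensor_kalgs[OF S T] tensor_right_khom[OF S T] _ tensor_kalgs[OF S T'] t] al[OF T]
      by simp
    also have "contract S T' l \<dots> = g (F (T, h) w)"
      using contract_natural[OF S3 T l T' g wc[OF T w]] wc[OF T w] by (simp add: F_def)
    finally show "F (T', compose (carrier KK) g h) (on_hom (underlying (dual K A)) T T' g w) = g (F (T, h) w)"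
      by (simp add: F_def dual_simps)
  qed
  have \<Phi>ap: "\<Phi> (T, h) w = F (T, h) w"
    if "T \<in> kalgs K" "h \<in> khom K KK T" "w \<in> module_homs K A base_functor T" for T h w
    using that by (simp add: \<Phi>_def salgs_iff dual_simps)
  \<comment> \<open>Linearity over \<open>T\<close> holds although \<open>l\<close> is only linear
    over \<open>K\<close>: in \<open>S \<otimes> T\<close> the map \<open>l\<close> acts on one
    factor and \<open>T\<close> on the other.\<close>
  have "\<Phi> \<in> module_homs K (dual K A) base_functor KK"
  proof (rule module_homsI[OF \<Phi>f])
    fix T h w v assume T: "T \<in> kalgs K" and h: "h \<in> khom K KK T"
      and "w \<in> carrier (on_obj (dual K A) T)"
    then have w: "w \<in> module_homs K A base_functor T" by (simp add: dual_simps)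
    note ap = dual_apply[OF tensor_kalgs[OF S T] tensor_right_khom[OF S T] al[OF T]]
    show "\<Phi> (T, h) (w \<oplus>\<^bsub>on_obj (dual K A) T\<^esub> v) = \<Phi> (T, h) w \<oplus>\<^bsub>T\<^esub> \<Phi> (T, h) v"
      if "v \<in> carrier (on_obj (dual K A) T)"
    proof -
      have v: "v \<in> module_homs K A base_functor T" using that by (simp add: dual_simps)
      have "w \<oplus>\<^bsub>on_obj (dual K A) T\<^esub> v \<in> module_homs K A base_functor T"
        by (rule dual_closed(1)[OF mA T w v])
      then show ?thesis
        using additive_map_add[OF additive_contract[OF S3 T l] wc[OF T w] wc[OF T v]]
        by (simp add: \<Phi>ap[OF T h] w v F_def ap)
    qed
    show "\<Phi> (T, h) (t \<odot>\<^bsub>on_obj (dual K A) T\<^esub> w) = t \<otimes>\<^bsub>T\<^esub> \<Phi> (T, h) w" if t: "t \<in> carrier T" for t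
    proof -
      have "t \<odot>\<^bsub>on_obj (dual K A) T\<^esub> w \<in> module_homs K A base_functor T"
        by (rule dual_closed(2)[OF mA T w t])
      then show ?thesis
        using contract_smult[OF S3 T l t wc[OF T w]]
        by (simp add: \<Phi>ap[OF T h] w F_def ap qc_smult_alg[OF S T t wc[OF T w]])
    qed
  qed
  then have "\<Phi> \<in> carrier (on_obj (dual K (dual K A)) KK)" by (simp add: dual_simps)
  \<comment> \<open>Reflexivity enters here, as surjectivity of the map to the bidual at
    \<open>KK\<close>.\<close>
  then obtain \<alpha> where \<alpha>: "\<alpha> \<in> carrier (on_obj A KK)" "to_bidual K A KK \<alpha> = \<Phi>"
  proof -
    have "to_bidual K A KK ` carrier (on_obj A KK) = carrier (on_obj (dual K (dual K A)) KK)"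
      using iso KK_kalgs by (simp add: module_iso_def bij_betw_def)
    then show ?thesis
      using \<open>\<Phi> \<in> carrier (on_obj (dual K (dual K A)) KK)\<close> that by (metis imageE)
  qed
  show ?thesis
  proof
    show "\<alpha> \<in> carrier (on_obj A KK)" by fact
    fix f assume f: "f \<in> module_homs K A base_functor KK"
    note i = khom_id[OF KK_kalgs] and SK = tensor_kalgs[OF S KK_kalgs]
    have fa: "f (S, kunit S) a \<in> carrier S"
      using functions_onD(1)[OF module_homsD(1)[OF f] S kunit_khom[OF S]] a by simp
    \<comment> \<open>Both sides are the only morphism from \<open>K\<close> to
      \<open>S \<otimes> K\<close>. Hence the value of \<open>f\<close> on the image of
      \<open>a\<close> over \<open>S \<otimes> K\<close> is \<open>f(a) \<otimes> 1\<close>, which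
      is contracted to \<open>l(f(a))\<close>.\<close>
    have r: "tensor_right K S KK = compose (carrier KK) (tensor_left K S KK) (kunit S)"
      using kunit_unique[OF tensor_right_khom[OF S KK_kalgs]]
        kunit_unique[OF khom_compose[OF KK_kalgs kunit_khom[OF S] tensor_left_khom[OF S KK_kalgs]]] by simp
    have "f (KK, \<lambda>k\<in>carrier KK. k) \<alpha> = to_bidual K A KK \<alpha> (KK, \<lambda>k\<in>carrier KK. k) f"
      by (simp only: to_bidual_apply[OF \<alpha>(1) KK_kalgs i f] module_functorD(3)[OF mA KK_kalgs \<alpha>(1)])
    also have "\<dots> = F (KK, \<lambda>k\<in>carrier KK. k) f"
      by (simp only: \<alpha>(2) \<Phi>ap[OF KK_kalgs i f])
    also have "\<dots> = contract S KK l (tensor_left K S KK (f (S, kunit S) a))"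
      unfolding F_def fst_conv r
      using functions_onD(2)[OF module_homsD(1)[OF f] S kunit_khom[OF S] _ SK tensor_left_khom[OF S KK_kalgs]] a
      by simp
    also have "\<dots> = l (f (S, kunit S) a)"
    proof -
      interpret K: cring K by (rule cring_K)
      show ?thesis
        using fa linear_map_closed[OF l fa] by (simp add: tensor_left_apply contract_tp[OF S3 KK_kalgs l])
    qed
    finally show "f (KK, \<lambda>k\<in>carrier KK. k) \<alpha> = l (f (S, kunit S) a)" .
  qed
qed

text \<open>If \<open>f(a)\<close> were nonzero, there would be a functional \<open>l\<close> on
  \<open>S\<close> with \<open>l(f(a)) = 1\<close>, and the pushforward of \<open>a\<close> along
  \<open>l\<close> would be an element of \<open>A(K)\<close> on which \<open>f\<close> takes the
  value \<open>1\<close>.\<close>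

lemma reflexive_functional_zero:
  assumes A: "reflexive K A" and f: "f \<in> module_homs K A base_functor KK"
    and z: "\<And>\<alpha>. \<alpha> \<in> carrier (on_obj A KK) \<Longrightarrow> f (KK, \<lambda>k\<in>carrier KK. k) \<alpha> = \<zero>\<^bsub>K\<^esub>"
    and S: "S \<in> kalgs K" and a: "a \<in> carrier (on_obj A S)"
  shows "f (S, kunit S) a = \<zero>\<^bsub>S\<^esub>"
proof (rule ccontr)
  assume ne: "f (S, kunit S) a \<noteq> \<zero>\<^bsub>S\<^esub>"
  interpret field K by (rule field_K)
  interpret S: algebra K S by (rule kalgsD[OF S])
  have fa: "f (S, kunit S) a \<in> carrier S"
    using functions_onD(1)[OF module_homsD(1)[OF f] S kunit_khom[OF S]] a by simp
  have sub: "submodule {\<zero>\<^bsub>S\<^esub>} K S"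
    by (rule S.submoduleI) (auto simp: S.M.a_inv_zero)
  obtain l where l: "linear_map K S KK l" "\<And>x. x \<in> {\<zero>\<^bsub>S\<^esub>} \<Longrightarrow> l x = \<zero>\<^bsub>K\<^esub>" "l (f (S, kunit S) a) = \<one>\<^bsub>K\<^esub>"
    by (rule exists_functional[OF kalgsD(3)[OF S] sub fa]) (use ne in auto)
  show False
  proof (rule reflexive_linear_image[OF A S a l(1)])
    fix \<alpha> assume \<alpha>: "\<alpha> \<in> carrier (on_obj A KK)"
      "\<And>f. f \<in> module_homs K A base_functor KK \<Longrightarrow> f (KK, \<lambda>k\<in>carrier KK. k) \<alpha> = l (f (S, kunit S) a)"
    have "\<one>\<^bsub>K\<^esub> = \<zero>\<^bsub>K\<^esub>"
      using \<alpha>(2)[OF f] z[OF \<alpha>(1)] l(3) by (simp del: one_not_zero zero_not_one)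
    then show False by simp
  qed
qed

text \<open>The image of \<open>A(K)\<close>, where \<open>V \<otimes> K\<close> is identified with \<open>V\<close>.\<close>

definition rational_image :: "('u, 'v) mfunctor \<Rightarrow> 'u alg \<Rightarrow> ('u alg \<Rightarrow> 'v \<Rightarrow> 'u) \<Rightarrow> 'u set" where
  "rational_image A V \<phi> = {v \<in> carrier V. tp V KK v \<one>\<^bsub>K\<^esub> \<in> \<phi> KK ` carrier (on_obj A KK)}"

text \<open>The set is the preimage, under the linear map \<open>v \<mapsto> v \<otimes> 1\<close>,
  of the image of the linear map \<open>\<phi> KK\<close>.\<close>

lemma submodule_rational_image:
  assumes A: "module_functor K A" and V: "module K V" and \<phi>: "module_morphism K A (QC V) \<phi>"
  shows "submodule (rational_image A V \<phi>) K V"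
proof -
  interpret V: module K V by fact
  interpret A: module KK "on_obj A KK" by (rule module_functorD(1)[OF A KK_kalgs])
  note K3 = kalgsD(3)[OF KK_kalgs]
  note D = module_morphismD[OF \<phi> KK_kalgs, simplified]
  have add: "x \<oplus>\<^bsub>V\<^esub> y \<in> rational_image A V \<phi>" if x: "x \<in> rational_image A V \<phi>" and y: "y \<in> rational_image A V \<phi>" for x y
  proof -
    from x obtain \<alpha> where \<alpha>: "x \<in> carrier V" "\<alpha> \<in> carrier (on_obj A KK)" "tp V KK x \<one>\<^bsub>K\<^esub> = \<phi> KK \<alpha>"
      by (auto simp: rational_image_def)
    from y obtain \<beta> where \<beta>: "y \<in> carrier V" "\<beta> \<in> carrier (on_obj A KK)" "tp V KK y \<one>\<^bsub>K\<^esub> = \<phi> KK \<beta>"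
      by (auto simp: rational_image_def)
    have "tp V KK (x \<oplus>\<^bsub>V\<^esub> y) \<one>\<^bsub>K\<^esub> = \<phi> KK (\<alpha> \<oplus>\<^bsub>on_obj A KK\<^esub> \<beta>)"
      using tp_add_left[OF V K3 \<alpha>(1) \<beta>(1), of "\<one>\<^bsub>K\<^esub>"] D(2)[OF \<alpha>(2) \<beta>(2)] \<alpha>(3) \<beta>(3) by simp
    then show ?thesis
      using \<alpha> \<beta> by (auto simp: rational_image_def)
  qed
  have smult: "k \<odot>\<^bsub>V\<^esub> x \<in> rational_image A V \<phi>" if k: "k \<in> carrier K" and x: "x \<in> rational_image A V \<phi>" for k x
  proof -
    from x obtain \<alpha> where \<alpha>: "x \<in> carrier V" "\<alpha> \<in> carrier (on_obj A KK)" "tp V KK x \<one>\<^bsub>K\<^esub> = \<phi> KK \<alpha>"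
      by (auto simp: rational_image_def)
    have "tp V KK (k \<odot>\<^bsub>V\<^esub> x) \<one>\<^bsub>K\<^esub> = k \<odot>\<^bsub>on_obj (QC V) KK\<^esub> tp V KK x \<one>\<^bsub>K\<^esub>"
      using k \<alpha>(1) tp_smult[OF V K3 k \<alpha>(1), of "\<one>\<^bsub>K\<^esub>"] qc_smult_tp[OF V KK_kalgs, of k x "\<one>\<^bsub>K\<^esub>"] by simp
    also have "\<dots> = \<phi> KK (k \<odot>\<^bsub>on_obj A KK\<^esub> \<alpha>)"
      using D(3)[OF \<alpha>(2) k] by (simp add: \<alpha>(3))
    finally show ?thesis
      using \<alpha> k by (auto simp: rational_image_def)
  qed
  have sub: "rational_image A V \<phi> \<subseteq> carrier V" by (auto simp: rational_image_def)
  have zero: "\<zero>\<^bsub>V\<^esub> \<in> rational_image A V \<phi>"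
  proof -
    have am: "additive_map (on_obj A KK) (V \<otimes>\<^sub>K KK) (\<phi> KK)"
      using D(1,2) by (auto simp: additive_map_def)
    have "\<phi> KK \<zero>\<^bsub>on_obj A KK\<^esub> = \<zero>\<^bsub>V \<otimes>\<^sub>K KK\<^esub>"
      by (rule additive_map_zero[OF am A.M.abelian_group_axioms abelian_group_tensor[OF V K3]])
    also have "\<dots> = tp V KK \<zero>\<^bsub>V\<^esub> \<one>\<^bsub>K\<^esub>"
      by (rule tp_zero(1)[OF V K3 V.M.zero_closed, symmetric]) simp
    finally show ?thesis
      using imageI[OF A.M.zero_closed, of "\<phi> KK"] by (simp add: rational_image_def)
  qed
  show ?thesis
  proof (rule V.submoduleI[OF sub zero _ add smult])
    show "\<ominus>\<^bsub>V\<^esub> x \<in> rational_image A V \<phi>" if x: "x \<in> rational_image A V \<phi>" for x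
      using smult[of "\<ominus>\<^bsub>K\<^esub> \<one>\<^bsub>K\<^esub>" x] x sub by (auto simp: V.smult_l_minus)
  qed
qed

text \<open>A functional \<open>w\<close> on \<open>V\<close> that vanishes on the rational image
  turns \<open>\<phi>\<close> into a linear form on \<open>A\<close> that vanishes on
  \<open>A(K)\<close>, hence everywhere. So all contractions of \<open>\<phi> S a\<close> with such
  functionals are zero, and \<open>functionals_separate\<close> applies with \<open>D\<close> the
  image of \<open>W \<otimes> S\<close>.\<close>

lemma reflexive_image:
  assumes A: "reflexive K A" and V: "module K V" and \<phi>: "module_morphism K A (QC V) \<phi>"
    and S: "S \<in> kalgs K" and a: "a \<in> carrier (on_obj A S)"
  defines "W \<equiv> V\<lparr>carrier := rational_image A V \<phi>\<rparr>"
  shows "\<phi> S a \<in> tensor_map K W S V S (\<lambda>x. x) (\<lambda>s. s) ` carrier (W \<otimes>\<^sub>K S)" (is "_ \<in> ?i ` _")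
proof -
  have mA: "module_functor K A" using A by (simp add: reflexive_def)
  have sA: "set_functor K (underlying A)" using mA by (simp add: module_functor_def)
  note sub = submodule_rational_image[OF mA V \<phi>]
  note WD = submodule_D[OF V sub]
  have mW: "module K W"
    unfolding W_def by (rule submodule.submodule_is_module[OF sub V])
  have l: "linear_map K W V (\<lambda>x. x)"
    unfolding W_def by (rule submodule_linear_incl[OF WD(1)])
  note S3 = kalgsD(3)[OF S]
  interpret TW: abelian_group "W \<otimes>\<^sub>K S" by (rule abelian_group_tensor[OF mW S3])
  note ti = tensor_map_tp[OF mW S3 V S3 l linear_map_id] tensor_map_add[OF mW S3 V S3 l linear_map_id]
  show ?thesis
  proof (rule functionals_separate[OF V S sub, where F = "{w. linear_map K V KK w}"])
    show "\<exists>w\<in>{w. linear_map K V KK w}. (\<forall>x\<in>rational_image A V \<phi>. w x = \<zero>\<^bsub>K\<^esub>) \<and> w v = \<one>\<^bsub>K\<^esub>"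
      if v: "v \<in> carrier V" "v \<notin> rational_image A V \<phi>" for v
    proof -
      obtain w where "linear_map K V KK w" "\<And>x. x \<in> rational_image A V \<phi> \<Longrightarrow> w x = \<zero>\<^bsub>K\<^esub>" "w v = \<one>\<^bsub>K\<^esub>"
        using exists_functional[OF V sub v] by blast
      then show ?thesis by blast
    qed
    show "tp V S x s \<in> ?i ` carrier (W \<otimes>\<^sub>K S)" if "x \<in> rational_image A V \<phi>" "s \<in> carrier S" for x s
      using that ti(1)[of x s] tp_closed[OF mW S3, of x s] by (intro image_eqI[of _ _ "tp W S x s"]) (simp_all add: W_def)
    show "z \<oplus>\<^bsub>V \<otimes>\<^sub>K S\<^esub> z' \<in> ?i ` carrier (W \<otimes>\<^sub>K S)"
      if z: "z \<in> ?i ` carrier (W \<otimes>\<^sub>K S)" and z': "z' \<in> ?i ` carrier (W \<otimes>\<^sub>K S)" for z z'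
    proof -
      from z obtain y where "y \<in> carrier (W \<otimes>\<^sub>K S)" "z = ?i y" by blast
      moreover from z' obtain y' where "y' \<in> carrier (W \<otimes>\<^sub>K S)" "z' = ?i y'" by blast
      ultimately show ?thesis
        by (intro image_eqI[of _ _ "y \<oplus>\<^bsub>W \<otimes>\<^sub>K S\<^esub> y'"]) (simp_all add: ti)
    qed
    show "\<phi> S a \<in> carrier (V \<otimes>\<^sub>K S)"
      using module_morphismD(1)[OF \<phi> S a] by simp
    fix w assume "w \<in> {w. linear_map K V KK w}" and kill: "\<forall>x\<in>rational_image A V \<phi>. w x = \<zero>\<^bsub>K\<^esub>"
    then have w: "linear_map K V KK w" by simp
    define f where "f = (\<lambda>p\<in>salgs K KK. \<lambda>x\<in>on_obj (underlying A) (fst p). contract V (fst p) w (\<phi> (fst p) x))"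
    have fap: "f (T, h) x = contract V T w (\<phi> T x)"
      if "T \<in> kalgs K" "h \<in> khom K KK T" "x \<in> carrier (on_obj A T)" for T h x
      using that by (simp add: f_def salgs_iff)
    note \<phi>D = module_morphismD[OF \<phi>, simplified]
    have ff: "f \<in> functions_on K (underlying A) KK"
      unfolding f_def
    proof (rule functions_onI[OF _ _ sA KK_kalgs])
      fix T h x assume T: "T \<in> kalgs K" "h \<in> khom K KK T" "x \<in> on_obj (underlying A) T"
      then have x: "x \<in> carrier (on_obj A T)" by simp
      show "contract V (fst (T, h)) w (\<phi> (fst (T, h)) x) \<in> carrier T"
        using additive_map_closed[OF additive_contract[OF V T(1) w] \<phi>D(1)[OF T(1) x]] by simp
      fix T' g assume T': "T' \<in> kalgs K" and g: "g \<in> khom K T T'"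
      show "contract V (fst (T', compose (carrier KK) g h)) w (\<phi> (fst (T', compose (carrier KK) g h)) (on_hom (underlying A) T T' g x)) =
          g (contract V (fst (T, h)) w (\<phi> (fst (T, h)) x))"
        using contract_natural[OF V T(1) w T' g \<phi>D(1)[OF T(1) x]] \<phi>D(4)[OF T(1) x T' g] by simp
    qed
    have f: "f \<in> module_homs K A base_functor KK"
    proof (rule module_homsI[OF ff])
      fix T h x assume T: "T \<in> kalgs K" "h \<in> khom K KK T" and x: "x \<in> carrier (on_obj A T)"
      interpret A: module T "on_obj A T" by (rule module_functorD(1)[OF mA T(1)])
      show "f (T, h) (x \<oplus>\<^bsub>on_obj A T\<^esub> y) = f (T, h) x \<oplus>\<^bsub>T\<^esub> f (T, h) y" if y: "y \<in> carrier (on_obj A T)" for y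
        using additive_map_add[OF additive_contract[OF V T(1) w] \<phi>D(1)[OF T(1) x] \<phi>D(1)[OF T(1) y]] x y
        by (simp add: fap[OF T] \<phi>D(2)[OF T(1)])
      show "f (T, h) (t \<odot>\<^bsub>on_obj A T\<^esub> x) = t \<otimes>\<^bsub>T\<^esub> f (T, h) x" if t: "t \<in> carrier T" for t
        using contract_smult[OF V T(1) w t \<phi>D(1)[OF T(1) x]] x t
        by (simp add: fap[OF T] \<phi>D(3)[OF T(1)])
    qed
    have "f (KK, \<lambda>k\<in>carrier KK. k) \<alpha> = \<zero>\<^bsub>K\<^esub>" if \<alpha>: "\<alpha> \<in> carrier (on_obj A KK)" for \<alpha>
    proof -
      interpret K: cring K by (rule cring_K)
      \<comment> \<open>Every element of \<open>V \<otimes> K\<close> is of the form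
        \<open>v \<otimes> 1\<close>; here \<open>v\<close> lies in the rational image by definition
        and is therefore killed by \<open>w\<close>.\<close>
      obtain v where v: "v \<in> carrier V" "\<phi> KK \<alpha> = tp V KK v \<one>\<^bsub>K\<^esub>"
        using tp_KK_surj[OF V \<phi>D(1)[OF KK_kalgs \<alpha>]] .
      then have "tp V KK v \<one>\<^bsub>K\<^esub> \<in> \<phi> KK ` carrier (on_obj A KK)" using \<alpha> by (metis imageI)
      then have "w v = \<zero>\<^bsub>K\<^esub>"
        using kill v(1) by (simp add: rational_image_def)
      then show ?thesis
        unfolding fap[OF KK_kalgs khom_id[OF KK_kalgs] \<alpha>]
        using v by (simp add: contract_tp[OF V KK_kalgs w])
    qed
    then have "f (S, kunit S) a = \<zero>\<^bsub>S\<^esub>"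
      by (rule reflexive_functional_zero[OF A f _ S a])
    then show "contract V S w (\<phi> S a) = \<zero>\<^bsub>S\<^esub>"
      by (simp add: fap[OF S kunit_khom[OF S] a])
  qed simp
qed

section \<open>The image of a point of the spectrum as a quotient algebra\<close>

definition image_algebra :: "('u, 'v) mfunctor \<Rightarrow> 'u alg \<Rightarrow> ('u alg \<Rightarrow> 'v \<Rightarrow> 'u) \<Rightarrow> 'u alg" where
  "image_algebra A T x = T\<lparr>carrier := rational_image A T x\<rparr>"

text \<open>\<open>x\<close> is factored by inverting the inclusion of \<open>B \<otimes> S\<close>
  into \<open>T \<otimes> S\<close> on its values. This is meaningful because the inclusion is
  injective by flatness and its range contains the values of \<open>x\<close> by
  \<open>reflexive_image\<close>. The double restriction is the extensionality demanded by
  \<open>algebra_quotients\<close>.\<close>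

definition image_quotient :: "('u, 'v) mfunctor \<Rightarrow> 'u alg \<Rightarrow> ('u alg \<Rightarrow> 'v \<Rightarrow> 'u) \<Rightarrow> 'u alg \<Rightarrow> 'v \<Rightarrow> 'u" where
  "image_quotient A T x = (\<lambda>S\<in>kalgs K. \<lambda>a\<in>carrier (on_obj A S).
     the_inv_into (carrier (image_algebra A T x \<otimes>\<^sub>K S))
       (tensor_map K (image_algebra A T x) S T S (\<lambda>x. x) (\<lambda>s. s)) (x S a))"

context
  fixes A :: "('u, 'v) mfunctor" and T x
  assumes A: "reflexive K A" "algebra_functor K A" and T: "T \<in> kalgs K"
    and x: "algebra_morphism K A (QC T) x"
begin

private abbreviation "B \<equiv> image_algebra A T x"
private abbreviation "\<pi> \<equiv> image_quotient A T x"
private abbreviation "incl S \<equiv> tensor_map K B S T S (\<lambda>x. x) (\<lambda>s. s)"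

interpretation T: algebra K T by (rule kalgsD[OF T])
interpretation T: ring T by (rule kalgsD[OF T])

private lemma sub: "submodule (rational_image A T x) K T"
  by (rule submodule_rational_image[OF algebra_functorD(1)[OF A(2)] kalgsD(3)[OF T] algebra_morphism_imp_module_morphism[OF x]])

lemma image_algebra_simps [simp]:
  "carrier B = rational_image A T x" "\<one>\<^bsub>B\<^esub> = \<one>\<^bsub>T\<^esub>" "\<zero>\<^bsub>B\<^esub> = \<zero>\<^bsub>T\<^esub>"
  "y \<otimes>\<^bsub>B\<^esub> z = y \<otimes>\<^bsub>T\<^esub> z" "y \<oplus>\<^bsub>B\<^esub> z = y \<oplus>\<^bsub>T\<^esub> z" "k \<odot>\<^bsub>B\<^esub> z = k \<odot>\<^bsub>T\<^esub> z"
  by (simp_all add: image_algebra_def)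

lemma image_algebra_subset: "rational_image A T x \<subseteq> carrier T"
  by (auto simp: rational_image_def)

text \<open>The rational image is closed under products because \<open>x\<close> is multiplicative
  at \<open>KK\<close>. Its carrier is a subset of that of \<open>T\<close>, so it lies in the same
  universe and may occur as an index of the limit.\<close>

lemma image_algebra_kalgs: "B \<in> kalgs K"
proof -
  note as = kalgsD(2)[OF T] kalgsD(2)[OF KK_kalgs]
  interpret K: cring K by (rule cring_K)
  interpret A: ring "on_obj A KK" by (rule algebra_functorD(3)[OF A(2) KK_kalgs])
  note D = algebra_morphismD[OF x KK_kalgs, simplified]
  interpret B: module K B
    unfolding image_algebra_def by (rule submodule.submodule_is_module[OF sub kalgsD(3)[OF T]])
  note sb = subsetD[OF image_algebra_subset]
  have one: "\<one>\<^bsub>T\<^esub> \<in> rational_image A T x"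
    using D(2) tensor_one[OF as] A.one_closed by (auto simp: rational_image_def image_iff intro!: bexI[of _ "\<one>\<^bsub>on_obj A KK\<^esub>"])
  have mult: "y \<otimes>\<^bsub>T\<^esub> z \<in> rational_image A T x" if y: "y \<in> rational_image A T x" and z: "z \<in> rational_image A T x" for y z
  proof -
    from y obtain \<alpha> where \<alpha>: "y \<in> carrier T" "\<alpha> \<in> carrier (on_obj A KK)" "tp T KK y \<one>\<^bsub>K\<^esub> = x KK \<alpha>"
      by (auto simp: rational_image_def)
    from z obtain \<beta> where \<beta>: "z \<in> carrier T" "\<beta> \<in> carrier (on_obj A KK)" "tp T KK z \<one>\<^bsub>K\<^esub> = x KK \<beta>"
      by (auto simp: rational_image_def)
    have "tp T KK (y \<otimes>\<^bsub>T\<^esub> z) \<one>\<^bsub>K\<^esub> = x KK (\<alpha> \<otimes>\<^bsub>on_obj A KK\<^esub> \<beta>)"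
      using tp_mult[OF as \<alpha>(1) _ \<beta>(1), of "\<one>\<^bsub>K\<^esub>" "\<one>\<^bsub>K\<^esub>"] D(1)[OF \<alpha>(2) \<beta>(2)] \<alpha>(3) \<beta>(3) by simp
    then show ?thesis
      using \<alpha> \<beta> by (auto simp: rational_image_def)
  qed
  have cB: "cring B"
  proof (rule cringI[OF B.M.abelian_group_axioms])
    show "Group.comm_monoid B"
      by (rule comm_monoidI) (auto simp: one mult sb T.m_ac)
  qed (simp add: sb T.l_distr)
  show ?thesis
    unfolding kalgs_def
    using algebra.intro[OF B.module_axioms cB] by (auto simp: algebra_axioms_def sb T.smult_assoc2)
qed

lemma image_algebra_incl: "(\<lambda>b\<in>carrier B. b) \<in> khom K B T"
  by (rule restrict_khom[OF kalgsD(1)[OF image_algebra_kalgs]], rule algebra_mapI)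
     (use image_algebra_subset in \<open>auto simp: linear_map_def\<close>)

private lemma incl_algebra_map: "algebra_map K B T (\<lambda>b. b)"
  by (rule algebra_mapI) (use image_algebra_subset in \<open>auto simp: linear_map_def\<close>)

lemma image_incl_inj: "S \<in> kalgs K \<Longrightarrow> inj_on (incl S) (carrier (B \<otimes>\<^sub>K S))"
  unfolding image_algebra_def by (rule tensor_incl_inj[OF kalgsD(3)[OF T] _ sub])

lemma image_quotient_factor:
  assumes S: "S \<in> kalgs K" and a: "a \<in> carrier (on_obj A S)"
  shows "\<pi> S a \<in> carrier (B \<otimes>\<^sub>K S)" "incl S (\<pi> S a) = x S a"
proof -
  have "x S a \<in> incl S ` carrier (B \<otimes>\<^sub>K S)"
    unfolding image_algebra_def
    by (rule reflexive_image[OF A(1) kalgsD(3)[OF T] algebra_morphism_imp_module_morphism[OF x] S a])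
  then show "\<pi> S a \<in> carrier (B \<otimes>\<^sub>K S)" "incl S (\<pi> S a) = x S a"
    using S a by (simp_all add: image_quotient_def the_inv_into_into[OF image_incl_inj[OF S] _ order_refl]
        f_the_inv_into_f[OF image_incl_inj[OF S]])
qed

text \<open>The inclusion is injective, so an identity for the quotient map is tested in
  \<open>T \<otimes> S\<close>, where it becomes one for \<open>x\<close>.\<close>

lemma image_quotient_eqI:
  "S \<in> kalgs K \<Longrightarrow> a \<in> carrier (on_obj A S) \<Longrightarrow> z \<in> carrier (B \<otimes>\<^sub>K S) \<Longrightarrow> incl S z = x S a \<Longrightarrow> \<pi> S a = z"
  using image_quotient_factor[of S a] inj_onD[OF image_incl_inj[of S]] by metis

lemma image_quotient_morphism: "algebra_morphism K A (QC B) \<pi>"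
proof -
  note i = algebra_morphism_qc_map[OF kalgsD(2)[OF image_algebra_kalgs] kalgsD(2)[OF T] incl_algebra_map]
  note iD = module_morphismD[OF algebra_morphism_imp_module_morphism[OF i], simplified] algebra_morphismD[OF i, simplified]
  note xD = module_morphismD[OF algebra_morphism_imp_module_morphism[OF x]] algebra_morphismD[OF x]
  note f = image_quotient_factor
  note m = kalgsD(3)[OF image_algebra_kalgs]
  show ?thesis
    unfolding algebra_morphism_def set_morphism_def
  proof (intro conjI ballI)
    fix S assume S: "S \<in> kalgs K"
    interpret M: module S "on_obj A S" by (rule module_functorD(1)[OF algebra_functorD(1)[OF A(2)] S])
    interpret R: ring "on_obj A S" by (rule algebra_functorD(3)[OF A(2) S])
    interpret BS: ring "B \<otimes>\<^sub>K S" by (rule kalgsD(5)[OF tensor_kalgs[OF image_algebra_kalgs S]])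
    show "\<pi> S \<in> on_obj (underlying A) S \<rightarrow> on_obj (underlying (QC B)) S"
      using f(1)[OF S] by simp
    show "algebra_map S (on_obj A S) (on_obj (QC B) S) (\<pi> S)"
    proof (rule algebra_mapI)
      show "linear_map S (on_obj A S) (on_obj (QC B) S) (\<pi> S)"
        unfolding linear_map_def
      proof (intro conjI ballI)
        show "\<pi> S (s \<odot>\<^bsub>on_obj A S\<^esub> a) = s \<odot>\<^bsub>on_obj (QC B) S\<^esub> \<pi> S a"
          if "s \<in> carrier S" "a \<in> carrier (on_obj A S)" for s a
          using that f[OF S that(2)]
          by (intro image_quotient_eqI S) (simp_all add: iD(3)[OF S] xD(3)[OF S] qc_smult_closed[OF m S])
        show "\<pi> S (a \<oplus>\<^bsub>on_obj A S\<^esub> b) = \<pi> S a \<oplus>\<^bsub>on_obj (QC B) S\<^esub> \<pi> S b"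
          if "a \<in> carrier (on_obj A S)" "b \<in> carrier (on_obj A S)" for a b
          using that f[OF S that(1)] f[OF S that(2)]
          by (intro image_quotient_eqI S) (simp_all add: iD(2)[OF S] xD(2)[OF S])
      qed (use f(1)[OF S] in simp)
      show "\<pi> S (a \<otimes>\<^bsub>on_obj A S\<^esub> b) = \<pi> S a \<otimes>\<^bsub>on_obj (QC B) S\<^esub> \<pi> S b"
        if "a \<in> carrier (on_obj A S)" "b \<in> carrier (on_obj A S)" for a b
        using that f[OF S that(1)] f[OF S that(2)]
        by (intro image_quotient_eqI S) (simp_all add: iD(5)[OF S] xD(5)[OF S])
      show "\<pi> S \<one>\<^bsub>on_obj A S\<^esub> = \<one>\<^bsub>on_obj (QC B) S\<^esub>"
        by (intro image_quotient_eqI S) (simp_all add: iD(6)[OF S] xD(6)[OF S])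
    qed
    fix U h a assume U: "U \<in> kalgs K" and h: "h \<in> khom K S U" and "a \<in> on_obj (underlying A) S"
    then have a: "a \<in> carrier (on_obj A S)" by simp
    have "\<pi> U (on_hom A S U h a) = tensor_map K B S B U (\<lambda>x. x) h (\<pi> S a)"
    proof (rule image_quotient_eqI[OF U])
      show "on_hom A S U h a \<in> carrier (on_obj A U)"
        by (rule module_functorD(2)[OF algebra_functorD(1)[OF A(2)] S a U h])
      show "tensor_map K B S B U (\<lambda>x. x) h (\<pi> S a) \<in> carrier (B \<otimes>\<^sub>K U)"
        by (rule tensor_map_closed[OF m kalgsD(3)[OF S] m kalgsD(3)[OF U] linear_map_id khomD(2)[OF h] f(1)[OF S a]])
      show "incl U (tensor_map K B S B U (\<lambda>x. x) h (\<pi> S a)) = x U (on_hom A S U h a)"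
        using iD(4)[OF S f(1)[OF S a] U h] xD(4)[OF S a U h] by (simp add: f[OF S a])
    qed
    then show "\<pi> U (on_hom (underlying A) S U h a) = on_hom (underlying (QC B)) S U h (\<pi> S a)" by simp
  qed
qed

text \<open>Surjectivity is the point: \<open>b \<otimes> 1\<close> with \<open>b\<close> in the
  rational image comes from \<open>A(K)\<close> by definition, hence over \<open>S\<close> from
  \<open>A(S)\<close> by naturality along \<open>kunit S\<close>, and \<open>b \<otimes> s\<close>
  is a multiple of it.\<close>

lemma image_quotient_mem: "(B, \<pi>) \<in> algebra_quotients K A"
proof -
  note f = image_quotient_factor
  note m = kalgsD(3)[OF image_algebra_kalgs]
  note \<pi>D = module_morphismD[OF algebra_morphism_imp_module_morphism[OF image_quotient_morphism], simplified]
  have ext: "\<pi> \<in> (\<Pi>\<^sub>E S\<in>kalgs K. carrier (on_obj A S) \<rightarrow>\<^sub>E carrier (on_obj (QC B) S))"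
  proof (rule PiE_I)
    fix S assume S: "S \<in> kalgs K"
    show "\<pi> S \<in> carrier (on_obj A S) \<rightarrow>\<^sub>E carrier (on_obj (QC B) S)"
      using f(1)[OF S] S by (intro PiE_I) (auto simp: image_quotient_def)
  qed (simp add: image_quotient_def)
  have "carrier (B \<otimes>\<^sub>K S) \<subseteq> \<pi> S ` carrier (on_obj A S)" if S: "S \<in> kalgs K" for S
  proof
    interpret S: ring S by (rule kalgsD[OF S])
    interpret M: module S "on_obj A S" by (rule module_functorD(1)[OF algebra_functorD(1)[OF A(2)] S])
    note S3 = kalgsD(3)[OF S] and T3 = kalgsD(3)[OF T] and K3 = kalgsD(3)[OF KK_kalgs]
    fix z assume z: "z \<in> carrier (B \<otimes>\<^sub>K S)"
    then show "z \<in> \<pi> S ` carrier (on_obj A S)"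
    proof (induction rule: tensor_induct[OF m S3, consumes 1, case_names pure add])
      case (pure b s)
      then obtain \<alpha> where \<alpha>: "b \<in> carrier T" "\<alpha> \<in> carrier (on_obj A KK)" "tp T KK b \<one>\<^bsub>K\<^esub> = x KK \<alpha>"
        by (auto simp: rational_image_def)
      have a: "on_hom A KK S (kunit S) \<alpha> \<in> carrier (on_obj A S)"
        by (rule module_functorD(2)[OF algebra_functorD(1)[OF A(2)] KK_kalgs \<alpha>(2) S kunit_khom[OF S]])
      interpret K: cring K by (rule cring_K)
      have "\<pi> KK \<alpha> = tp B KK b \<one>\<^bsub>K\<^esub>"
        using pure \<alpha> tp_closed[OF m K3, of b "\<one>\<^bsub>K\<^esub>"]
          tensor_map_tp[OF m K3 T3 K3 algebra_mapD(1)[OF incl_algebra_map] linear_map_id, of b "\<one>\<^bsub>K\<^esub>"]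
        by (intro image_quotient_eqI KK_kalgs) simp_all
      then have "\<pi> S (on_hom A KK S (kunit S) \<alpha>) = tp B S b \<one>\<^bsub>S\<^esub>"
        using \<pi>D(4)[OF KK_kalgs \<alpha>(2) S kunit_khom[OF S]] khomD(7)[OF kunit_khom[OF S]] pure
          tensor_map_tp[OF m K3 m S3 linear_map_id khomD(2)[OF kunit_khom[OF S]], of b "\<one>\<^bsub>K\<^esub>"] by simp
      then have "tp B S b s = \<pi> S (s \<odot>\<^bsub>on_obj A S\<^esub> on_hom A KK S (kunit S) \<alpha>)"
        using \<pi>D(3)[OF S a pure(2)] qc_smult_tp[OF m S pure(2,1) S.one_closed] pure by simp
      then show ?case
        using a pure by blast
    next
      case (add z w)
      then obtain a b where "a \<in> carrier (on_obj A S)" "z = \<pi> S a" "b \<in> carrier (on_obj A S)" "w = \<pi> S b"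
        by blast
      then show ?case
        by (intro image_eqI[of _ _ "a \<oplus>\<^bsub>on_obj A S\<^esub> b"]) (simp_all add: \<pi>D(2)[OF S])
    qed
  qed
  then have surj: "\<pi> S ` carrier (on_obj A S) = carrier (on_obj (QC B) S)" if "S \<in> kalgs K" for S
    using f(1)[OF that] that by auto
  show ?thesis
    unfolding algebra_quotients_def
    using kalgsD(2)[OF image_algebra_kalgs] ext image_quotient_morphism surj by blast
qed

end

section \<open>Rules for copairings, and morphisms of quasi-coherent algebras\<close>

lemma copair_tensor_map:
  assumes "B \<in> kalgs K" "S \<in> kalgs K" "B' \<in> kalgs K" "S' \<in> kalgs K" "U \<in> kalgs K"
    and f: "f \<in> khom K B B'" and g: "g \<in> khom K S S'" and i: "i \<in> khom K B' U" and h: "h \<in> khom K S' U"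
    and z: "z \<in> carrier (B \<otimes>\<^sub>K S)"
  shows "copair K B' S' U i h (tensor_map K B S B' S' f g z) =
    copair K B S U (compose (carrier B) i f) (compose (carrier S) h g) z"
proof (rule tensor_eqI[OF kalgsD(3)[OF assms(1)] kalgsD(3)[OF assms(2)] _ _ _ z])
  note m = kalgsD(3)[OF assms(1)] kalgsD(3)[OF assms(2)] kalgsD(3)[OF assms(3)] kalgsD(3)[OF assms(4)]
  note c = khom_compose[OF assms(1) f i] khom_compose[OF assms(2) g h]
  show "additive_map (B \<otimes>\<^sub>K S) U (\<lambda>z. copair K B' S' U i h (tensor_map K B S B' S' f g z))"
    by (rule additive_map_compose[OF additive_tensor_map[OF m khomD(2)[OF f] khomD(2)[OF g]]
          additive_copair[OF assms(5,3,4) i h]])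
  show "additive_map (B \<otimes>\<^sub>K S) U (copair K B S U (compose (carrier B) i f) (compose (carrier S) h g))"
    by (rule additive_copair[OF assms(5,1,2) c])
  show "copair K B' S' U i h (tensor_map K B S B' S' f g (tp B S x y)) =
      copair K B S U (compose (carrier B) i f) (compose (carrier S) h g) (tp B S x y)"
    if "x \<in> carrier B" "y \<in> carrier S" for x y
    using that khomD(3)[OF f] khomD(3)[OF g]
    by (simp add: tensor_map_tp[OF m khomD(2)[OF f] khomD(2)[OF g]] copair_tp[OF assms(5,3,4) i h]
        copair_tp[OF assms(5,1,2) c] compose_apply)
qed

lemma copair_natural:
  assumes "B \<in> kalgs K" "S \<in> kalgs K" "T \<in> kalgs K" "U \<in> kalgs K"
    and i: "i \<in> khom K B T" and h: "h \<in> khom K S T" and g: "g \<in> khom K T U" and z: "z \<in> carrier (B \<otimes>\<^sub>K S)"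
  shows "copair K B S U (compose (carrier B) g i) (compose (carrier S) g h) z = g (copair K B S T i h z)"
proof (rule tensor_eqI[OF kalgsD(3)[OF assms(1)] kalgsD(3)[OF assms(2)] _ _ _ z])
  note c = khom_compose[OF assms(1) i g] khom_compose[OF assms(2) h g]
  show "additive_map (B \<otimes>\<^sub>K S) U (copair K B S U (compose (carrier B) g i) (compose (carrier S) g h))"
    by (rule additive_copair[OF assms(4,1,2) c])
  show "additive_map (B \<otimes>\<^sub>K S) U (\<lambda>z. g (copair K B S T i h z))"
    by (rule additive_map_compose[OF additive_copair[OF assms(3,1,2) i h] linear_map_additive[OF khomD(2)[OF g]]])
  show "copair K B S U (compose (carrier B) g i) (compose (carrier S) g h) (tp B S x y) =
      g (copair K B S T i h (tp B S x y))"
    if "x \<in> carrier B" "y \<in> carrier S" for x y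
    using that by (simp add: copair_tp[OF assms(4,1,2) c] copair_tp[OF assms(3,1,2) i h] compose_apply
        khomD(5)[OF g] khomD(3)[OF i] khomD(3)[OF h])
qed

text \<open>On pure tensors this is \<open>(x \<otimes> 1) (1 \<otimes> y) = x \<otimes> y\<close>.
  It lets the evaluation at the universal extension of a point return the tensor from which it was
  computed.\<close>

lemma copair_universal:
  assumes B: "B \<in> kalgs K" and S: "S \<in> kalgs K" and z: "z \<in> carrier (B \<otimes>\<^sub>K S)"
  shows "copair K B S (B \<otimes>\<^sub>K S) (tensor_left K B S) (tensor_right K B S) z = z"
proof (rule tensor_eqI[OF kalgsD(3)[OF B] kalgsD(3)[OF S] _ _ _ z])
  interpret B: ring B by (rule kalgsD(5)[OF B])
  interpret S: ring S by (rule kalgsD(5)[OF S])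
  note l = tensor_left_khom[OF B S] and r = tensor_right_khom[OF B S]
  show "additive_map (B \<otimes>\<^sub>K S) (B \<otimes>\<^sub>K S) (copair K B S (B \<otimes>\<^sub>K S) (tensor_left K B S) (tensor_right K B S))"
    by (rule additive_copair[OF tensor_kalgs[OF B S] B S l r])
  show "additive_map (B \<otimes>\<^sub>K S) (B \<otimes>\<^sub>K S) (\<lambda>z. z)" by (simp add: additive_map_def)
  show "copair K B S (B \<otimes>\<^sub>K S) (tensor_left K B S) (tensor_right K B S) (tp B S x y) = tp B S x y"
    if "x \<in> carrier B" "y \<in> carrier S" for x y
    using that by (simp add: copair_tp[OF tensor_kalgs[OF B S] B S l r] tensor_left_apply tensor_right_apply
        tp_mult[OF kalgsD(2)[OF B] kalgsD(2)[OF S]])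
qed

text \<open>A point with values in \<open>T\<close> is evaluated in \<open>T \<otimes> S\<close>. If
  it comes from a point with values in \<open>B\<close> along \<open>i\<close>, the evaluation can
  be carried out in \<open>B \<otimes> S\<close> instead.\<close>

lemma copair_id_tensor_map:
  assumes "B \<in> kalgs K" "S \<in> kalgs K" "T \<in> kalgs K" "i \<in> khom K B T" "h \<in> khom K S T" "z \<in> carrier (B \<otimes>\<^sub>K S)"
  shows "copair K T S T (\<lambda>t\<in>carrier T. t) h (tensor_map K B S T S i (\<lambda>s. s) z) = copair K B S T i h z"
proof -
  note m = kalgsD(3)[OF assms(1)] kalgsD(3)[OF assms(2)] kalgsD(3)[OF assms(3)]
  have "tensor_map K B S T S i (\<lambda>s. s) z = tensor_map K B S T S i (\<lambda>s\<in>carrier S. s) z"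
    by (rule tensor_map_cong[OF m(1,2,3,2) khomD(2)[OF assms(4)] linear_map_id khomD(2)[OF assms(4)]
          khomD(2)[OF khom_id[OF assms(2)]] _ _ assms(6)]) simp_all
  then show ?thesis
    using copair_tensor_map[OF assms(1,2,3,2,3,4) khom_id[OF assms(2)] khom_id[OF assms(3)] assms(5,6)]
    by (simp only: compose_id[OF assms(4)] compose_id[OF assms(5)])
qed

text \<open>\<open>qc_morphism\<close> supplies \<open>t\<close>. It is multiplicative because
  \<open>\<tau>\<close> is so at \<open>KK\<close>, and because
  \<open>x \<mapsto> x \<otimes> 1\<close> is multiplicative and injective.\<close>

lemma qc_algebra_morphism:
  assumes M: "assoc_algebra K M" and N: "assoc_algebra K N" and \<tau>: "algebra_morphism K (QC M) (QC N) \<tau>"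
  obtains t where "algebra_map K M N t"
    "\<And>S z. S \<in> kalgs K \<Longrightarrow> z \<in> carrier (M \<otimes>\<^sub>K S) \<Longrightarrow> \<tau> S z = tensor_map K M S N S t (\<lambda>s. s) z"
proof (rule qc_morphism[OF assoc_algebraD(1)[OF M] assoc_algebraD(1)[OF N] algebra_morphism_imp_module_morphism[OF \<tau>]])
  fix t assume t: "linear_map K M N t"
    and t1: "\<And>x. x \<in> carrier M \<Longrightarrow> \<tau> KK (tp M KK x \<one>\<^bsub>K\<^esub>) = tp N KK (t x) \<one>\<^bsub>K\<^esub>"
    and tS: "\<And>S z. S \<in> kalgs K \<Longrightarrow> z \<in> carrier (M \<otimes>\<^sub>K S) \<Longrightarrow> \<tau> S z = tensor_map K M S N S t (\<lambda>s. s) z"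
  interpret K: cring K by (rule cring_K)
  interpret M: ring M by (rule assoc_algebraD[OF M])
  interpret N: ring N by (rule assoc_algebraD[OF N])
  note aK = kalgsD(2)[OF KK_kalgs] and K3 = kalgsD(3)[OF KK_kalgs]
  note M3 = assoc_algebraD(1)[OF M] and N3 = assoc_algebraD(1)[OF N]
  note D = algebra_morphismD[OF \<tau> KK_kalgs, simplified]
  note tc = linear_map_closed[OF t]
  have tm: "tp P KK x \<one>\<^bsub>K\<^esub> \<otimes>\<^bsub>P \<otimes>\<^sub>K KK\<^esub> tp P KK y \<one>\<^bsub>K\<^esub> = tp P KK (x \<otimes>\<^bsub>P\<^esub> y) \<one>\<^bsub>K\<^esub>"
    if "assoc_algebra K P" "x \<in> carrier P" "y \<in> carrier P" for P x y
    using tp_mult[OF that(1) aK that(2) _ that(3), of "\<one>\<^bsub>K\<^esub>" "\<one>\<^bsub>K\<^esub>"] by simp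
  have tcl: "tp M KK x \<one>\<^bsub>K\<^esub> \<in> carrier (M \<otimes>\<^sub>K KK)" if "x \<in> carrier M" for x
    using tp_closed[OF M3 K3 that, of "\<one>\<^bsub>K\<^esub>"] by simp
  have "algebra_map K M N t"
  proof (rule algebra_mapI[OF t])
    show "t (x \<otimes>\<^bsub>M\<^esub> y) = t x \<otimes>\<^bsub>N\<^esub> t y" if xy: "x \<in> carrier M" "y \<in> carrier M" for x y
    proof (rule tp_KK_inj[OF N3])
      have "tp N KK (t (x \<otimes>\<^bsub>M\<^esub> y)) \<one>\<^bsub>K\<^esub> = \<tau> KK (tp M KK (x \<otimes>\<^bsub>M\<^esub> y) \<one>\<^bsub>K\<^esub>)"
        using xy by (intro t1[symmetric]) simp
      also have "\<dots> = \<tau> KK (tp M KK x \<one>\<^bsub>K\<^esub>) \<otimes>\<^bsub>N \<otimes>\<^sub>K KK\<^esub> \<tau> KK (tp M KK y \<one>\<^bsub>K\<^esub>)"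
        unfolding tm[OF M xy, symmetric] by (rule D(1)[OF tcl[OF xy(1)] tcl[OF xy(2)]])
      also have "\<dots> = tp N KK (t x \<otimes>\<^bsub>N\<^esub> t y) \<one>\<^bsub>K\<^esub>"
        unfolding t1[OF xy(1)] t1[OF xy(2)] by (rule tm[OF N tc[OF xy(1)] tc[OF xy(2)]])
      finally show "tp N KK (t (x \<otimes>\<^bsub>M\<^esub> y)) \<one>\<^bsub>K\<^esub> = tp N KK (t x \<otimes>\<^bsub>N\<^esub> t y) \<one>\<^bsub>K\<^esub>" .
    qed (use xy tc in auto)
    show "t \<one>\<^bsub>M\<^esub> = \<one>\<^bsub>N\<^esub>"
    proof (rule tp_KK_inj[OF N3])
      have "tp N KK (t \<one>\<^bsub>M\<^esub>) \<one>\<^bsub>K\<^esub> = \<tau> KK (tp M KK \<one>\<^bsub>M\<^esub> \<one>\<^bsub>K\<^esub>)"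
        by (rule t1[symmetric]) simp
      also have "\<dots> = tp N KK \<one>\<^bsub>N\<^esub> \<one>\<^bsub>K\<^esub>"
        using D(2) unfolding tensor_one[OF M aK] tensor_one[OF N aK] by simp
      finally show "tp N KK (t \<one>\<^bsub>M\<^esub>) \<one>\<^bsub>K\<^esub> = tp N KK \<one>\<^bsub>N\<^esub> \<one>\<^bsub>K\<^esub>" .
    qed (use tc in auto)
  qed
  then show thesis using that tS by blast
qed

section \<open>Proquasi-coherent algebras\<close>

lemma quotientD:
  assumes "(B, \<pi>) \<in> algebra_quotients K A"
  shows "assoc_algebra K B" "algebra_morphism K A (QC B) \<pi>"
    "S \<in> kalgs K \<Longrightarrow> \<pi> S ` carrier (on_obj A S) = carrier (B \<otimes>\<^sub>K S)"
    "\<pi> \<in> on_obj (Spec K A) B"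
  using assms by (auto simp: algebra_quotients_def Spec_simps)

text \<open>Quotients are only required to be associative algebras, but \<open>A(K)\<close> is
  commutative and maps onto \<open>B \<otimes> K\<close>, which is \<open>B\<close>. Being
  commutative, \<open>B\<close> is an object on which functors can be evaluated, and
  \<open>\<pi>\<close> becomes a point of \<open>Spec A\<close> with values in it.\<close>

lemma quotient_kalgs:
  assumes A: "comm_algebra_functor K A" and B: "(B, \<pi>) \<in> algebra_quotients K A"
  shows "B \<in> kalgs K"
proof -
  note b = quotientD(1)[OF B] and aK = kalgsD(2)[OF KK_kalgs] and K3 = kalgsD(3)[OF KK_kalgs]
  interpret K: cring K by (rule cring_K)
  interpret Bm: module K B by (rule assoc_algebraD[OF b])
  interpret B: ring B by (rule assoc_algebraD[OF b])
  interpret A: cring "on_obj A KK" using A KK_kalgs by (simp add: comm_algebra_functor_def)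
  note D = algebra_morphismD[OF quotientD(2)[OF B] KK_kalgs, simplified]
  have ex: "\<exists>\<alpha>\<in>carrier (on_obj A KK). \<pi> KK \<alpha> = tp B KK x \<one>\<^bsub>K\<^esub>" if "x \<in> carrier B" for x
  proof -
    have "tp B KK x \<one>\<^bsub>K\<^esub> \<in> carrier (B \<otimes>\<^sub>K KK)"
      using tp_closed[OF Bm.module_axioms K3 that, of "\<one>\<^bsub>K\<^esub>"] by simp
    then show ?thesis
      unfolding quotientD(3)[OF B KK_kalgs, symmetric] by auto
  qed
  have "x \<otimes>\<^bsub>B\<^esub> y = y \<otimes>\<^bsub>B\<^esub> x" if xy: "x \<in> carrier B" "y \<in> carrier B" for x y
  proof (rule tp_KK_inj[OF Bm.module_axioms])
    obtain \<alpha> where \<alpha>: "\<alpha> \<in> carrier (on_obj A KK)" "\<pi> KK \<alpha> = tp B KK x \<one>\<^bsub>K\<^esub>" using ex[OF xy(1)] by blast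
    obtain \<beta> where \<beta>: "\<beta> \<in> carrier (on_obj A KK)" "\<pi> KK \<beta> = tp B KK y \<one>\<^bsub>K\<^esub>" using ex[OF xy(2)] by blast
    have tm: "tp B KK x \<one>\<^bsub>K\<^esub> \<otimes>\<^bsub>B \<otimes>\<^sub>K KK\<^esub> tp B KK y \<one>\<^bsub>K\<^esub> = tp B KK (x \<otimes>\<^bsub>B\<^esub> y) \<one>\<^bsub>K\<^esub>"
      if "x \<in> carrier B" "y \<in> carrier B" for x y
      using tp_mult[OF b aK that(1) _ that(2), of "\<one>\<^bsub>K\<^esub>" "\<one>\<^bsub>K\<^esub>"] by simp
    show "tp B KK (x \<otimes>\<^bsub>B\<^esub> y) \<one>\<^bsub>K\<^esub> = tp B KK (y \<otimes>\<^bsub>B\<^esub> x) \<one>\<^bsub>K\<^esub>"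
      unfolding tm[OF xy, symmetric] tm[OF xy(2,1), symmetric] \<alpha>(2)[symmetric] \<beta>(2)[symmetric]
        D(1)[OF \<alpha>(1) \<beta>(1), symmetric] D(1)[OF \<beta>(1) \<alpha>(1), symmetric]
      by (simp only: A.m_comm[OF \<alpha>(1) \<beta>(1)])
  qed (use xy in auto)
  then have "Group.comm_monoid B"
    by (rule B.monoid_comm_monoidI)
  then have "cring B"
    by (simp add: cring_def B.ring_axioms)
  then show ?thesis
    unfolding kalgs_def using algebra.intro[OF Bm.module_axioms]
    by (auto simp: algebra_axioms_def assoc_algebraD(3)[OF b])
qed

lemma quotient_morphismI:
  assumes "assoc_algebra K B" "assoc_algebra K B'" "algebra_map K B B' t"
    and "\<And>S a. S \<in> kalgs K \<Longrightarrow> a \<in> carrier (on_obj A S) \<Longrightarrow> tensor_map K B S B' S t (\<lambda>s. s) (\<pi> S a) = \<pi>' S a"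
  shows "quotient_morphism K A (B, \<pi>) (B', \<pi>') (\<lambda>S. tensor_map K B S B' S t (\<lambda>s. s))"
  unfolding quotient_morphism_def using algebra_morphism_qc_map[OF assms(1-3)] assms(4) by simp

lemma limit_simps:
  "c \<in> carrier (on_obj (limit_of_quotients K A) S) \<longleftrightarrow>
     c \<in> (\<Pi>\<^sub>E i\<in>algebra_quotients K A. carrier (fst i \<otimes>\<^sub>K S)) \<and>
     (\<forall>i\<in>algebra_quotients K A. \<forall>j\<in>algebra_quotients K A. \<forall>\<tau>. quotient_morphism K A i j \<tau> \<longrightarrow> \<tau> S (c i) = c j)"
  "c \<oplus>\<^bsub>on_obj (limit_of_quotients K A) S\<^esub> d = (\<lambda>i\<in>algebra_quotients K A. c i \<oplus>\<^bsub>on_obj (QC (fst i)) S\<^esub> d i)"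
  "c \<otimes>\<^bsub>on_obj (limit_of_quotients K A) S\<^esub> d = (\<lambda>i\<in>algebra_quotients K A. c i \<otimes>\<^bsub>on_obj (QC (fst i)) S\<^esub> d i)"
  "s \<odot>\<^bsub>on_obj (limit_of_quotients K A) S\<^esub> c = (\<lambda>i\<in>algebra_quotients K A. s \<odot>\<^bsub>on_obj (QC (fst i)) S\<^esub> c i)"
  "\<one>\<^bsub>on_obj (limit_of_quotients K A) S\<^esub> = (\<lambda>i\<in>algebra_quotients K A. \<one>\<^bsub>on_obj (QC (fst i)) S\<^esub>)"
  "on_hom (limit_of_quotients K A) S T h c = (\<lambda>i\<in>algebra_quotients K A. on_hom (QC (fst i)) S T h (c i))"
  by (simp_all add: limit_of_quotients_def Let_def)

lemma limitD:
  assumes "c \<in> carrier (on_obj (limit_of_quotients K A) S)" "i \<in> algebra_quotients K A"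
  shows "c i \<in> carrier (fst i \<otimes>\<^sub>K S)"
    and "j \<in> algebra_quotients K A \<Longrightarrow> quotient_morphism K A i j \<tau> \<Longrightarrow> \<tau> S (c i) = c j"
  using assms by (auto simp: limit_simps)

lemma to_limit_morphism:
  assumes A: "algebra_functor K A"
  shows "algebra_morphism K A (limit_of_quotients K A) (\<lambda>S a. \<lambda>i\<in>algebra_quotients K A. snd i S a)"
proof -
  have \<pi>: "algebra_morphism K A (QC (fst i)) (snd i)" if "i \<in> algebra_quotients K A" for i
    using quotientD(2)[of "fst i" "snd i"] that by simp
  note D = module_morphismD[OF algebra_morphism_imp_module_morphism[OF \<pi>]] algebra_morphismD[OF \<pi>]
  have cl: "(\<lambda>i\<in>algebra_quotients K A. snd i S a) \<in> carrier (on_obj (limit_of_quotients K A) S)"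
    if "S \<in> kalgs K" "a \<in> carrier (on_obj A S)" for S a
    using D(1)[OF _ that] that by (auto simp: limit_simps quotient_morphism_def)
  show ?thesis
    unfolding algebra_morphism_def set_morphism_def
  proof (intro conjI ballI)
    fix S assume S: "S \<in> kalgs K"
    show "(\<lambda>a. \<lambda>i\<in>algebra_quotients K A. snd i S a) \<in> on_obj (underlying A) S \<rightarrow> on_obj (underlying (limit_of_quotients K A)) S"
      using cl[OF S] by simp
    show "algebra_map S (on_obj A S) (on_obj (limit_of_quotients K A) S) (\<lambda>a. \<lambda>i\<in>algebra_quotients K A. snd i S a)"
    proof (rule algebra_mapI)
      show "linear_map S (on_obj A S) (on_obj (limit_of_quotients K A) S) (\<lambda>a. \<lambda>i\<in>algebra_quotients K A. snd i S a)"
        unfolding linear_map_def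
      proof (intro conjI ballI)
        show "(\<lambda>a. \<lambda>i\<in>algebra_quotients K A. snd i S a) \<in> carrier (on_obj A S) \<rightarrow> carrier (on_obj (limit_of_quotients K A) S)"
          using cl[OF S] by simp
        show "(\<lambda>i\<in>algebra_quotients K A. snd i S (a \<oplus>\<^bsub>on_obj A S\<^esub> b)) =
            (\<lambda>i\<in>algebra_quotients K A. snd i S a) \<oplus>\<^bsub>on_obj (limit_of_quotients K A) S\<^esub> (\<lambda>i\<in>algebra_quotients K A. snd i S b)"
          if "a \<in> carrier (on_obj A S)" "b \<in> carrier (on_obj A S)" for a b
          unfolding limit_simps by (rule restrict_ext) (simp only: restrict_apply' D(2)[OF _ S that])
        show "(\<lambda>i\<in>algebra_quotients K A. snd i S (s \<odot>\<^bsub>on_obj A S\<^esub> a)) =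
            s \<odot>\<^bsub>on_obj (limit_of_quotients K A) S\<^esub> (\<lambda>i\<in>algebra_quotients K A. snd i S a)"
          if "s \<in> carrier S" "a \<in> carrier (on_obj A S)" for s a
          unfolding limit_simps by (rule restrict_ext) (simp only: restrict_apply' D(3)[OF _ S that(2,1)])
      qed
      show "(\<lambda>i\<in>algebra_quotients K A. snd i S (a \<otimes>\<^bsub>on_obj A S\<^esub> b)) =
          (\<lambda>i\<in>algebra_quotients K A. snd i S a) \<otimes>\<^bsub>on_obj (limit_of_quotients K A) S\<^esub> (\<lambda>i\<in>algebra_quotients K A. snd i S b)"
        if "a \<in> carrier (on_obj A S)" "b \<in> carrier (on_obj A S)" for a b
        unfolding limit_simps by (rule restrict_ext) (simp only: restrict_apply' D(5)[OF _ S that])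
      show "(\<lambda>i\<in>algebra_quotients K A. snd i S \<one>\<^bsub>on_obj A S\<^esub>) = \<one>\<^bsub>on_obj (limit_of_quotients K A) S\<^esub>"
        unfolding limit_simps by (rule restrict_ext) (simp only: D(6)[OF _ S])
    qed
    fix T h a assume T: "T \<in> kalgs K" and h: "h \<in> khom K S T" and a: "a \<in> on_obj (underlying A) S"
    show "(\<lambda>i\<in>algebra_quotients K A. snd i T (on_hom (underlying A) S T h a)) =
        on_hom (underlying (limit_of_quotients K A)) S T h (\<lambda>i\<in>algebra_quotients K A. snd i S a)"
      unfolding underlying_simps limit_simps
      by (rule restrict_ext) (simp only: restrict_apply' D(4)[OF _ S a[unfolded underlying_simps] T h])
  qed
qed

section \<open>Factorizations of points through quotients\<close>

context
  fixes A :: "('u, 'v) mfunctor"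
  assumes A: "reflexive K A" "comm_algebra_functor K A"
begin

private lemma A': "algebra_functor K A"
  using A(2) by (simp add: comm_algebra_functor_def)

text \<open>This is \<open>image_quotient_factor\<close> read as an equation between points of the
  spectrum; the inclusion only has to be replaced by its restriction to the carrier.\<close>

lemma Spec_image_factor:
  assumes T: "T \<in> kalgs K" and x: "x \<in> on_obj (Spec K A) T"
  shows "on_hom (Spec K A) (image_algebra A T x) T (\<lambda>b\<in>carrier (image_algebra A T x). b) (image_quotient A T x) = x"
proof -
  note I = A(1) A' T SpecD[OF x]
  note B = image_algebra_kalgs[OF I]
  note i = image_algebra_incl[OF I]
  note q = quotientD(4)[OF image_quotient_mem[OF I]]
  show ?thesis
  proof (rule Spec_eqI[OF Spec_on_hom_closed[OF A' B T i q] x])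
    fix S a assume S: "S \<in> kalgs K" and a: "a \<in> carrier (on_obj A S)"
    note f = image_quotient_factor[OF I S a]
    have li: "linear_map K (image_algebra A T x) T (\<lambda>b. b)"
      using khomD(2)[OF i] unfolding linear_map_def image_algebra_def rational_image_def by auto
    have "on_hom (Spec K A) (image_algebra A T x) T (\<lambda>b\<in>carrier (image_algebra A T x). b) (image_quotient A T x) S a =
        tensor_map K (image_algebra A T x) S T S (\<lambda>b. b) (\<lambda>s. s) (image_quotient A T x S a)"
      unfolding Spec_on_hom_apply[OF S a]
      by (rule tensor_map_cong[OF kalgsD(3)[OF B] kalgsD(3)[OF S] kalgsD(3)[OF T] kalgsD(3)[OF S]
            khomD(2)[OF i] linear_map_id li linear_map_id _ _ f(1)]) simp_all
    then show "on_hom (Spec K A) (image_algebra A T x) T (\<lambda>b\<in>carrier (image_algebra A T x). b) (image_quotient A T x) S a = x S a"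
      using f(2) by simp
  qed
qed

text \<open>The quotient of \<open>A\<close> given by the image of \<open>y\<close> is the smallest one through which \<open>y\<close>
  factors; hence a point of the limit takes the same value at \<open>y\<close> for all of them.\<close>

lemma limit_value_unique:
  assumes T: "T \<in> kalgs K" and S: "S \<in> kalgs K" and B: "(B, \<pi>) \<in> algebra_quotients K A" and i: "i \<in> khom K B T"
    and y: "y = on_hom (Spec K A) B T i \<pi>"
    and c: "c \<in> carrier (on_obj (limit_of_quotients K A) S)"
  shows "tensor_map K (image_algebra A T y) S T S (\<lambda>b. b) (\<lambda>s. s) (c (image_algebra A T y, image_quotient A T y)) =
    tensor_map K B S T S i (\<lambda>s. s) (c (B, \<pi>))"
proof -
  note BK = quotient_kalgs[OF A(2) B]
  have yS: "y \<in> on_obj (Spec K A) T"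
    unfolding y by (rule Spec_on_hom_closed[OF A' BK T i quotientD(4)[OF B]])
  note I = A(1) A' T SpecD[OF yS]
  let ?I = "image_algebra A T y" and ?q = "image_quotient A T y"
  note IK = image_algebra_kalgs[OF I] and Iq = image_quotient_mem[OF I]
  note B3 = kalgsD(3)[OF BK] and T3 = kalgsD(3)[OF T] and I3 = kalgsD(3)[OF IK] and K3 = kalgsD(3)[OF KK_kalgs]
  \<comment> \<open>Every \<open>b \<otimes> 1\<close> is \<open>\<pi> KK \<alpha>\<close> for some
    \<open>\<alpha>\<close>, as \<open>\<pi>\<close> is onto at \<open>KK\<close>. Then
    \<open>y\<close> sends \<open>\<alpha>\<close> to \<open>i(b) \<otimes> 1\<close>, so
    \<open>i\<close> maps \<open>B\<close> into the image of \<open>y\<close>.\<close>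
  have icl: "i b \<in> rational_image A T y" if b: "b \<in> carrier B" for b
  proof -
    interpret K: cring K by (rule cring_K)
    have "tp B KK b \<one>\<^bsub>K\<^esub> \<in> carrier (B \<otimes>\<^sub>K KK)"
      using tp_closed[OF B3 K3 b, of "\<one>\<^bsub>K\<^esub>"] by simp
    then obtain \<alpha> where \<alpha>: "\<alpha> \<in> carrier (on_obj A KK)" "tp B KK b \<one>\<^bsub>K\<^esub> = \<pi> KK \<alpha>"
      unfolding quotientD(3)[OF B KK_kalgs, symmetric] by blast
    have "y KK \<alpha> = tp T KK (i b) \<one>\<^bsub>K\<^esub>"
      unfolding y Spec_on_hom_apply[OF KK_kalgs \<alpha>(1)] \<alpha>(2)[symmetric]
      by (rule tensor_map_tp[OF B3 K3 T3 K3 khomD(2)[OF i] linear_map_id b]) simp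
    then have "tp T KK (i b) \<one>\<^bsub>K\<^esub> \<in> y KK ` carrier (on_obj A KK)"
      using imageI[OF \<alpha>(1), of "y KK"] by simp
    then show ?thesis
      using khomD(3)[OF i b] by (simp add: rational_image_def)
  qed
  have ti: "algebra_map K B ?I i"
    using icl khomD[OF i] by (intro algebra_mapI) (auto simp: linear_map_def image_algebra_def)
  have li: "linear_map K ?I T (\<lambda>b. b)"
    unfolding linear_map_def image_algebra_def rational_image_def by auto
  have comp: "tensor_map K ?I U T U (\<lambda>b. b) (\<lambda>s. s) (tensor_map K B U ?I U i (\<lambda>s. s) z) = tensor_map K B U T U i (\<lambda>s. s) z"
    if "U \<in> kalgs K" "z \<in> carrier (B \<otimes>\<^sub>K U)" for U z
    by (rule tensor_map_compose[OF B3 kalgsD(3)[OF that(1)] I3 kalgsD(3)[OF that(1)] T3 kalgsD(3)[OF that(1)]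
          algebra_mapD(1)[OF ti] linear_map_id li linear_map_id that(2)])
  \<comment> \<open>Compatibility of \<open>c\<close> along this one morphism, from \<open>B\<close>
    to the image of \<open>y\<close>, compares the two components.\<close>
  have "quotient_morphism K A (B, \<pi>) (?I, ?q) (\<lambda>S. tensor_map K B S ?I S i (\<lambda>s. s))"
  proof (rule quotient_morphismI[OF kalgsD(2)[OF BK] kalgsD(2)[OF IK] ti])
    fix U a assume U: "U \<in> kalgs K" and a: "a \<in> carrier (on_obj A U)"
    note pa = Spec_closed[OF quotientD(4)[OF B] U a]
    show "tensor_map K B U ?I U i (\<lambda>s. s) (\<pi> U a) = ?q U a"
    proof (rule image_quotient_eqI[OF I U a, symmetric])
      show "tensor_map K B U ?I U i (\<lambda>s. s) (\<pi> U a) \<in> carrier (?I \<otimes>\<^sub>K U)"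
        by (rule tensor_map_closed[OF B3 kalgsD(3)[OF U] I3 kalgsD(3)[OF U] algebra_mapD(1)[OF ti] linear_map_id pa])
      show "tensor_map K ?I U T U (\<lambda>b. b) (\<lambda>s. s) (tensor_map K B U ?I U i (\<lambda>s. s) (\<pi> U a)) = y U a"
      proof -
        have "y U a = tensor_map K B U T U i (\<lambda>s. s) (\<pi> U a)"
          unfolding y by (rule Spec_on_hom_apply[OF U a])
        then show ?thesis
          using comp[OF U pa] by simp
      qed
    qed
  qed
  from limitD(2)[OF c B Iq this] have "c (?I, ?q) = tensor_map K B S ?I S i (\<lambda>s. s) (c (B, \<pi>))" by simp
  moreover have "c (B, \<pi>) \<in> carrier (B \<otimes>\<^sub>K S)" using limitD(1)[OF c B] by simp
  ultimately show ?thesis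
    using comp[OF S] by simp
qed

end

section \<open>Affine functors have proquasi-coherent functions\<close>

text \<open>A point \<open>c\<close> of the limit gives a function: its value at \<open>x\<close> is
  read off from the component of \<open>c\<close> at the image of \<open>?\<theta> T x\<close>, and
  by \<open>limit_value_unique\<close> any other factorization gives the same value. To recover
  \<open>c\<close>, each quotient map \<open>\<pi>\<close> is written as
  \<open>?\<theta> B x\<close> with \<open>x\<close> in \<open>X(B)\<close>; the function takes the
  value \<open>c (B, \<pi>)\<close> at the universal extension of \<open>x\<close>.\<close>

lemma affine_imp_proquasi_coherent:
  fixes X :: "('u, 'w) sfunctor"
  assumes X: "affine_functor K X"
  shows "proquasi_coherent K (function_algebra K X)"
proof -
  let ?F = "function_algebra K X" and ?\<theta> = "to_Spec_functions K X"
  let ?Q = "algebra_quotients K ?F" and ?L = "limit_of_quotients K ?F"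
  have sX: "set_functor K X" and rF: "reflexive K ?F" and iso: "set_iso K X (Spec K ?F) ?\<theta>"
    using X by (auto simp: affine_functor_def)
  note cF = function_algebra_functor[OF sX]
  have aF: "algebra_functor K ?F" using cF by (simp add: comm_algebra_functor_def)
  note cF' = function_algebra_simps(1)
  let ?I = "\<lambda>T x. image_algebra ?F T (?\<theta> T x)" and ?q = "\<lambda>T x. image_quotient ?F T (?\<theta> T x)"
  let ?i = "\<lambda>S T x. tensor_map K (?I T x) S T S (\<lambda>b. b) (\<lambda>s. s)"
  have \<theta>: "?\<theta> T x \<in> on_obj (Spec K ?F) T" if "T \<in> kalgs K" "x \<in> on_obj X T" for T x
    by (rule to_Spec_functions_closed[OF sX that])
  have nat: "?\<theta> T' (on_hom X T T' g x) = on_hom (Spec K ?F) T T' g (?\<theta> T x)"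
    if "T \<in> kalgs K" "T' \<in> kalgs K" "g \<in> khom K T T'" "x \<in> on_obj X T" for T T' g x
    using to_Spec_functions_morphism[OF sX] that by (simp add: set_morphism_def)
  have q: "(?I T x, ?q T x) \<in> ?Q" if "T \<in> kalgs K" "x \<in> on_obj X T" for T x
    by (rule image_quotient_mem[OF rF aF that(1) SpecD[OF \<theta>[OF that]]])
  \<comment> \<open>Each value of \<open>f\<close> is computed from the class of \<open>f\<close> in
    a single quotient, the image of the point given by \<open>x\<close>. This yields
    injectivity.\<close>
  have val: "f (T, h) x = copair K T S T (\<lambda>t\<in>carrier T. t) h (?i S T x (?q T x S f))"
    if S: "S \<in> kalgs K" and T: "T \<in> kalgs K" and h: "h \<in> khom K S T" and x: "x \<in> on_obj X T"
      and f: "f \<in> functions_on K X S" for S T h x f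
  proof -
    have "f (T, h) x = copair K T S T (\<lambda>t\<in>carrier T. t) h (?\<theta> T x S f)"
      using function_value_universal[OF sX S T T h khom_id[OF T] x f]
      unfolding set_functorD(2)[OF sX T x] to_Spec_functions_apply[OF sX S f] .
    then show ?thesis
      using image_quotient_factor(2)[OF rF aF T SpecD[OF \<theta>[OF T x]] S] f by (simp add: cF')
  qed
  have "bij_betw (\<lambda>a. \<lambda>i\<in>?Q. snd i S a) (carrier (on_obj ?F S)) (carrier (on_obj ?L S))" if S: "S \<in> kalgs K" for S
  proof (rule bij_betwI')
    fix f g assume "f \<in> carrier (on_obj ?F S)" "g \<in> carrier (on_obj ?F S)"
    then have fg: "f \<in> functions_on K X S" "g \<in> functions_on K X S" by (simp_all add: cF')
    show "((\<lambda>i\<in>?Q. snd i S f) = (\<lambda>i\<in>?Q. snd i S g)) = (f = g)"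
    proof
      assume eq: "(\<lambda>i\<in>?Q. snd i S f) = (\<lambda>i\<in>?Q. snd i S g)"
      show "f = g"
      proof (rule functions_on_eqI[OF fg])
        fix T h x assume T: "T \<in> kalgs K" and h: "h \<in> khom K S T" and x: "x \<in> on_obj X T"
        have "?q T x S f = ?q T x S g"
          using fun_cong[OF eq, of "(?I T x, ?q T x)"] q[OF T x] by simp
        then show "f (T, h) x = g (T, h) x"
          by (simp add: val[OF S T h x fg(1)] val[OF S T h x fg(2)])
      qed
    qed simp
  next
    fix f assume "f \<in> carrier (on_obj ?F S)"
    then show "(\<lambda>i\<in>?Q. snd i S f) \<in> carrier (on_obj ?L S)"
      by (rule module_morphismD(1)[OF algebra_morphism_imp_module_morphism[OF to_limit_morphism[OF aF]] S])
  next
    fix c assume c: "c \<in> carrier (on_obj ?L S)"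
    define G where "G p x = copair K (fst p) S (fst p) (\<lambda>t\<in>carrier (fst p). t) (snd p)
        (?i S (fst p) x (c (?I (fst p) x, ?q (fst p) x)))" for p :: "'u alg \<times> ('u \<Rightarrow> 'u)" and x
    define f where "f = (\<lambda>p\<in>salgs K S. \<lambda>x\<in>on_obj X (fst p). G p x)"
    have cc: "c (B, \<pi>) \<in> carrier (B \<otimes>\<^sub>K S)" if "(B, \<pi>) \<in> ?Q" for B \<pi>
      using limitD(1)[OF c that] by simp
    \<comment> \<open>Any factorization of the point of \<open>x\<close> through a quotient may be
      used to compute \<open>G\<close>. Naturality follows, since \<open>x\<close> and its image
      over \<open>T'\<close> factor through the same quotient.\<close>
    have G: "G (T, h) x = copair K B S T i h (c (B, \<pi>))"
      if T: "T \<in> kalgs K" and h: "h \<in> khom K S T" and B: "(B, \<pi>) \<in> ?Q" and i: "i \<in> khom K B T"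
        and x: "?\<theta> T x = on_hom (Spec K ?F) B T i \<pi>" for T h x B \<pi> i
    proof -
      have "?i S T x (c (?I T x, ?q T x)) = tensor_map K B S T S i (\<lambda>s. s) (c (B, \<pi>))"
        by (rule limit_value_unique[OF rF cF T S B i x c])
      then show ?thesis
        using copair_id_tensor_map[OF quotient_kalgs[OF cF B] S T i h cc[OF B]] by (simp add: G_def)
    qed
    have incl: "(\<lambda>b\<in>carrier (?I T x). b) \<in> khom K (?I T x) T"
      and fac: "?\<theta> T x = on_hom (Spec K ?F) (?I T x) T (\<lambda>b\<in>carrier (?I T x). b) (?q T x)"
      and IK: "?I T x \<in> kalgs K"
      if T: "T \<in> kalgs K" and x: "x \<in> on_obj X T" for T x
      using image_algebra_incl[OF rF aF T SpecD[OF \<theta>[OF T x]]]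
        Spec_image_factor[OF rF cF T \<theta>[OF T x]] image_algebra_kalgs[OF rF aF T SpecD[OF \<theta>[OF T x]]] by simp_all
    have f: "f \<in> functions_on K X S"
      unfolding f_def
    proof (rule functions_onI[OF _ _ sX S])
      fix T h x assume T: "T \<in> kalgs K" and h: "h \<in> khom K S T" and x: "x \<in> on_obj X T"
      note Gx = G[OF T h q[OF T x] incl[OF T x] fac[OF T x]]
      note cx = cc[OF q[OF T x]]
      note ck = copair_khom[OF T IK[OF T x] S incl[OF T x] h]
      show "G (T, h) x \<in> carrier T"
        unfolding Gx by (rule khomD(3)[OF ck cx])
      fix T' g assume T': "T' \<in> kalgs K" and g: "g \<in> khom K T T'"
      note gi = khom_compose[OF IK[OF T x] incl[OF T x] g]
      have "?\<theta> T' (on_hom X T T' g x) = on_hom (Spec K ?F) T T' g (?\<theta> T x)"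
        by (rule nat[OF T T' g x])
      also have "\<dots> = on_hom (Spec K ?F) T T' g (on_hom (Spec K ?F) (?I T x) T (\<lambda>b\<in>carrier (?I T x). b) (?q T x))"
        using fac[OF T x] by simp
      also have "\<dots> = on_hom (Spec K ?F) (?I T x) T' (compose (carrier (?I T x)) g (\<lambda>b\<in>carrier (?I T x). b)) (?q T x)"
        by (rule set_functorD(3)[OF set_functor_Spec[OF aF] IK[OF T x] quotientD(4)[OF q[OF T x]] T T' incl[OF T x] g, symmetric])
      finally have e: "?\<theta> T' (on_hom X T T' g x) =
        on_hom (Spec K ?F) (?I T x) T' (compose (carrier (?I T x)) g (\<lambda>b\<in>carrier (?I T x). b)) (?q T x)" .
      show "G (T', compose (carrier S) g h) (on_hom X T T' g x) = g (G (T, h) x)"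
        unfolding G[OF T' khom_compose[OF S h g] q[OF T x] gi e] Gx
        by (rule copair_natural[OF IK[OF T x] S T T' incl[OF T x] h g cx])
    qed
    have "c = (\<lambda>i\<in>?Q. snd i S f)"
    proof
      fix j show "c j = (\<lambda>i\<in>?Q. snd i S f) j"
      proof (cases "j \<in> ?Q")
        case True
        obtain B \<pi> where j: "j = (B, \<pi>)" by force
        then have B: "(B, \<pi>) \<in> ?Q" using True by simp
        note BK = quotient_kalgs[OF cF B]
        note BS = tensor_kalgs[OF BK S] and l = tensor_left_khom[OF BK S] and r = tensor_right_khom[OF BK S]
        \<comment> \<open>This is where affineness is used beyond reflexivity: the quotient map
          comes from a point of \<open>X\<close>.\<close>
        have "?\<theta> B ` on_obj X B = on_obj (Spec K ?F) B"
          using iso BK by (simp add: set_iso_def bij_betw_def)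
        then obtain x where x: "x \<in> on_obj X B" "\<pi> = ?\<theta> B x"
          using quotientD(4)[OF B] by (metis imageE)
        note xl = set_functorD(1)[OF sX BK x(1) BS l]
        have e: "?\<theta> (B \<otimes>\<^sub>K S) (on_hom X B (B \<otimes>\<^sub>K S) (tensor_left K B S) x) =
            on_hom (Spec K ?F) B (B \<otimes>\<^sub>K S) (tensor_left K B S) \<pi>"
          unfolding x(2) by (rule nat[OF BK BS l x(1)])
        have "\<pi> S f = f (B \<otimes>\<^sub>K S, tensor_right K B S) (on_hom X B (B \<otimes>\<^sub>K S) (tensor_left K B S) x)"
          unfolding x(2) by (rule to_Spec_functions_apply[OF sX S f])
        also have "\<dots> = G (B \<otimes>\<^sub>K S, tensor_right K B S) (on_hom X B (B \<otimes>\<^sub>K S) (tensor_left K B S) x)"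
          using BS r xl by (simp add: f_def salgs_iff)
        also have "\<dots> = c (B, \<pi>)"
          unfolding G[OF BS r B l e] by (rule copair_universal[OF BK S cc[OF B]])
        finally show ?thesis
          using True by (simp add: j)
      next
        case False
        then show ?thesis
          using PiE_arb[OF conjunct1[OF iffD1[OF limit_simps(1) c]] False] by simp
      qed
    qed
    then show "\<exists>f\<in>carrier (on_obj ?F S). c = (\<lambda>i\<in>?Q. snd i S f)"
      using f by (auto simp: cF')
  qed
  then show ?thesis
    unfolding proquasi_coherent_def algebra_iso_def
    by (intro conjI ballI aF to_limit_morphism)
qed

end

section \<open>Invariance of reflexivity under isomorphism\<close>

text \<open>At each algebra the dual is a submodule of the functions on the underlying functor, with
  the same operations and the same base change, so the module axioms and functoriality are
  inherited.\<close>

lemma module_functor_dual: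
  assumes M: "module_functor K M"
  shows "module_functor K (dual K M)"
proof -
  let ?F = "function_algebra K (underlying M)"
  have sM: "set_functor K (underlying M)" using M by (simp add: module_functor_def)
  have F: "module_functor K ?F"
    using function_algebra_functor[OF sM] by (simp add: comm_algebra_functor_def algebra_functor_def)
  have e: "on_obj (dual K M) S = (on_obj ?F S)\<lparr>carrier := module_homs K M base_functor S\<rparr>" for S
    by (simp add: dual_def module_Hom_def function_algebra_def pointwise_def)
  have mS: "module S (on_obj (dual K M) S)" if S: "S \<in> kalgs K" for S
  proof -
    interpret F: module S "on_obj ?F S" by (rule module_functorD(1)[OF F S])
    note cl = dual_closed[OF M S]
    have sm: "s \<odot>\<^bsub>on_obj ?F S\<^esub> f \<in> module_homs K M base_functor S"
      if "s \<in> carrier S" "f \<in> module_homs K M base_functor S" for s f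
      using cl(2)[OF that(2,1)] by (simp add: e)
    have "submodule (module_homs K M base_functor S) S (on_obj ?F S)"
    proof (rule F.submoduleI)
      show sub: "module_homs K M base_functor S \<subseteq> carrier (on_obj ?F S)"
        by (auto simp: function_algebra_simps(1) dest: module_homsD)
      show "\<zero>\<^bsub>on_obj ?F S\<^esub> \<in> module_homs K M base_functor S"
      proof (rule module_homsI)
        show "\<zero>\<^bsub>on_obj ?F S\<^esub> \<in> functions_on K (underlying M) S"
          by (rule function_algebra_closed(5)[OF sM S])
        fix T h x assume T: "T \<in> kalgs K" and h: "h \<in> khom K S T" and x: "x \<in> carrier (on_obj M T)"
        interpret M: module T "on_obj M T" by (rule module_functorD(1)[OF M T])
        show "\<zero>\<^bsub>on_obj ?F S\<^esub> (T, h) (x \<oplus>\<^bsub>on_obj M T\<^esub> y) = \<zero>\<^bsub>on_obj ?F S\<^esub> (T, h) x \<oplus>\<^bsub>T\<^esub> \<zero>\<^bsub>on_obj ?F S\<^esub> (T, h) y"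
          if "y \<in> carrier (on_obj M T)" for y
          using x that by (simp add: function_algebra_apply[OF T h])
        show "\<zero>\<^bsub>on_obj ?F S\<^esub> (T, h) (t \<odot>\<^bsub>on_obj M T\<^esub> x) = t \<otimes>\<^bsub>T\<^esub> \<zero>\<^bsub>on_obj ?F S\<^esub> (T, h) x"
          if "t \<in> carrier T" for t
          using x that by (simp add: function_algebra_apply[OF T h])
      qed
      show "\<ominus>\<^bsub>on_obj ?F S\<^esub> f \<in> module_homs K M base_functor S" if f: "f \<in> module_homs K M base_functor S" for f
        using sm[of "\<ominus>\<^bsub>S\<^esub> \<one>\<^bsub>S\<^esub>" f] f sub by (auto simp: F.smult_l_minus)
      show "f \<oplus>\<^bsub>on_obj ?F S\<^esub> g \<in> module_homs K M base_functor S"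
        if "f \<in> module_homs K M base_functor S" "g \<in> module_homs K M base_functor S" for f g
        using cl(1)[OF that] by (simp add: e)
    qed (rule sm)
    then show ?thesis
      unfolding e by (rule submodule.submodule_is_module[OF _ F.module_axioms])
  qed
  show ?thesis
    unfolding module_functor_def
  proof (intro conjI ballI set_functor_dual[OF sM] mS)
    fix S T h f assume S: "S \<in> kalgs K" and T: "T \<in> kalgs K" and h: "h \<in> khom K S T"
      and f: "f \<in> carrier (on_obj (dual K M) S)"
    have car: "f \<in> carrier (on_obj ?F S)" if "f \<in> carrier (on_obj (dual K M) S)" for f
      using that by (auto simp: dual_simps function_algebra_simps(1) dest: module_homsD)
    have eh: "on_hom (dual K M) S T h = on_hom ?F S T h"
      by (simp add: dual_simps function_algebra_simps)
    show "on_hom (dual K M) S T h (f \<oplus>\<^bsub>on_obj (dual K M) S\<^esub> g) =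
        on_hom (dual K M) S T h f \<oplus>\<^bsub>on_obj (dual K M) T\<^esub> on_hom (dual K M) S T h g"
      if "g \<in> carrier (on_obj (dual K M) S)" for g
      using module_functorD(5)[OF F S car[OF f] car[OF that] T h] unfolding eh by (simp add: e)
    show "on_hom (dual K M) S T h (s \<odot>\<^bsub>on_obj (dual K M) S\<^esub> f) = h s \<odot>\<^bsub>on_obj (dual K M) T\<^esub> on_hom (dual K M) S T h f"
      if "s \<in> carrier S" for s
      using module_functorD(6)[OF F S that car[OF f] T h] unfolding eh by (simp add: e)
  qed
qed

section \<open>Transposes of module morphisms\<close>

definition precompose ::
  "'u ring \<Rightarrow> ('u, 'v) mfunctor \<Rightarrow> ('u alg \<Rightarrow> 'v \<Rightarrow> 'w) \<Rightarrow> 'u alg \<Rightarrow>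
   ('u alg \<times> ('u \<Rightarrow> 'u) \<Rightarrow> 'w \<Rightarrow> 'u) \<Rightarrow> ('u alg \<times> ('u \<Rightarrow> 'u) \<Rightarrow> 'v \<Rightarrow> 'u)" where
  "precompose K M \<psi> S f = (\<lambda>p\<in>salgs K S. \<lambda>x\<in>carrier (on_obj M (fst p)). f p (\<psi> (fst p) x))"

text \<open>Isomorphism is phrased through a two-sided inverse and not through bijectivity, because
  this form passes directly to transposes, and so twice to the bidual.\<close>

definition inverse_morphisms where
  "inverse_morphisms K M N \<psi> \<chi> \<longleftrightarrow> module_morphism K M N \<psi> \<and> module_morphism K N M \<chi> \<and>
     (\<forall>S\<in>kalgs K. (\<forall>x\<in>carrier (on_obj M S). \<chi> S (\<psi> S x) = x) \<and> (\<forall>y\<in>carrier (on_obj N S). \<psi> S (\<chi> S y) = y))"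

lemma precompose_apply:
  "T \<in> kalgs K \<Longrightarrow> h \<in> khom K S T \<Longrightarrow> x \<in> carrier (on_obj M T) \<Longrightarrow> precompose K M \<psi> S f (T, h) x = f (T, h) (\<psi> T x)"
  by (simp add: precompose_def salgs_iff)

lemma precompose_closed:
  assumes M: "module_functor K M" and \<psi>: "module_morphism K M N \<psi>" and S: "S \<in> kalgs K"
    and f: "f \<in> module_homs K N base_functor S"
  shows "precompose K M \<psi> S f \<in> module_homs K M base_functor S"
proof (rule module_homsI)
  have sM: "set_functor K (underlying M)" using M by (simp add: module_functor_def)
  note \<psi>D = module_morphismD[OF \<psi>]
  note fD = functions_onD[OF module_homsD(1)[OF f], unfolded underlying_simps]
  note fl = linear_mapD[OF module_homsD(2)[OF f], simplified]
  have "(\<lambda>p\<in>salgs K S. \<lambda>x\<in>on_obj (underlying M) (fst p). f p (\<psi> (fst p) x)) \<in> functions_on K (underlying M) S"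
  proof (rule functions_onI[OF _ _ sM S])
    fix T h x assume T: "T \<in> kalgs K" and h: "h \<in> khom K S T" and "x \<in> on_obj (underlying M) T"
    then have x: "x \<in> carrier (on_obj M T)" by simp
    show "f (T, h) (\<psi> (fst (T, h)) x) \<in> carrier T"
      using fD(1)[OF T h \<psi>D(1)[OF T x]] by simp
    fix T' g assume T': "T' \<in> kalgs K" and g: "g \<in> khom K T T'"
    show "f (T', compose (carrier S) g h) (\<psi> (fst (T', compose (carrier S) g h)) (on_hom (underlying M) T T' g x)) =
        g (f (T, h) (\<psi> (fst (T, h)) x))"
      using fD(2)[OF T h \<psi>D(1)[OF T x] T' g] by (simp add: \<psi>D(4)[OF T x T' g])
  qed
  then show "precompose K M \<psi> S f \<in> functions_on K (underlying M) S"
    by (simp add: precompose_def)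
  fix T h x assume T: "T \<in> kalgs K" and h: "h \<in> khom K S T" and x: "x \<in> carrier (on_obj M T)"
  interpret M: module T "on_obj M T" by (rule module_functorD(1)[OF M T])
  note ap = precompose_apply[OF T h, of _ M]
  show "precompose K M \<psi> S f (T, h) (x \<oplus>\<^bsub>on_obj M T\<^esub> y) = precompose K M \<psi> S f (T, h) x \<oplus>\<^bsub>T\<^esub> precompose K M \<psi> S f (T, h) y"
    if y: "y \<in> carrier (on_obj M T)" for y
    using x y by (simp add: ap \<psi>D(1,2)[OF T] fl[OF T h])
  show "precompose K M \<psi> S f (T, h) (t \<odot>\<^bsub>on_obj M T\<^esub> x) = t \<otimes>\<^bsub>T\<^esub> precompose K M \<psi> S f (T, h) x"
    if t: "t \<in> carrier T" for t
    using x t by (simp add: ap \<psi>D(1,3)[OF T] fl[OF T h])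
qed

lemma precompose_morphism:
  assumes M: "module_functor K M" and N: "module_functor K N" and \<psi>: "module_morphism K M N \<psi>"
  shows "module_morphism K (dual K N) (dual K M) (precompose K M \<psi>)"
  unfolding module_morphism_def set_morphism_def
proof (intro conjI ballI)
  note \<psi>D = module_morphismD[OF \<psi>]
  note cl = precompose_closed[OF M \<psi>]
  have sN: "set_functor K (underlying N)" using N by (simp add: module_functor_def)
  have sM: "set_functor K (underlying M)" using M by (simp add: module_functor_def)
  fix S assume S: "S \<in> kalgs K"
  note eq = functions_on_eqI[OF module_homsD(1) module_homsD(1), unfolded underlying_simps]
  show "precompose K M \<psi> S \<in> on_obj (underlying (dual K N)) S \<rightarrow> on_obj (underlying (dual K M)) S"
    using cl[OF S] by (simp add: dual_simps)
  show "linear_map S (on_obj (dual K N) S) (on_obj (dual K M) S) (precompose K M \<psi> S)"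
    unfolding linear_map_def
  proof (intro conjI ballI)
    show "precompose K M \<psi> S \<in> carrier (on_obj (dual K N) S) \<rightarrow> carrier (on_obj (dual K M) S)"
      using cl[OF S] by (simp add: dual_simps)
    show "precompose K M \<psi> S (f \<oplus>\<^bsub>on_obj (dual K N) S\<^esub> g) = precompose K M \<psi> S f \<oplus>\<^bsub>on_obj (dual K M) S\<^esub> precompose K M \<psi> S g"
      if "f \<in> carrier (on_obj (dual K N) S)" "g \<in> carrier (on_obj (dual K N) S)" for f g
    proof -
      have fg: "f \<in> module_homs K N base_functor S" "g \<in> module_homs K N base_functor S"
        using that by (simp_all add: dual_simps)
      show ?thesis
        by (rule eq[OF cl[OF S dual_closed(1)[OF N S fg]] dual_closed(1)[OF M S cl[OF S fg(1)] cl[OF S fg(2)]]])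
           (simp add: precompose_apply dual_apply \<psi>D(1))
    qed
    show "precompose K M \<psi> S (s \<odot>\<^bsub>on_obj (dual K N) S\<^esub> f) = s \<odot>\<^bsub>on_obj (dual K M) S\<^esub> precompose K M \<psi> S f"
      if s: "s \<in> carrier S" and "f \<in> carrier (on_obj (dual K N) S)" for s f
    proof -
      have f: "f \<in> module_homs K N base_functor S"
        using that by (simp_all add: dual_simps)
      show ?thesis
        by (rule eq[OF cl[OF S dual_closed(2)[OF N S f s]] dual_closed(2)[OF M S cl[OF S f] s]])
           (simp add: precompose_apply dual_apply \<psi>D(1))
    qed
  qed
  fix T g f assume T: "T \<in> kalgs K" and g: "g \<in> khom K S T" and "f \<in> on_obj (underlying (dual K N)) S"
  then have f: "f \<in> module_homs K N base_functor S" by (simp add: dual_simps)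
  have "precompose K M \<psi> T (base_change K S T g f) = base_change K S T g (precompose K M \<psi> S f)"
    by (rule eq[OF cl[OF T base_change_module_homs[OF f S T g sN]] base_change_module_homs[OF cl[OF S f] S T g sM]])
       (simp add: precompose_apply base_change_apply khom_compose[OF S g])
  then show "precompose K M \<psi> T (on_hom (underlying (dual K N)) S T g f) = on_hom (underlying (dual K M)) S T g (precompose K M \<psi> S f)"
    by (simp add: dual_simps)
qed

lemma inverse_morphisms_dual:
  assumes M: "module_functor K M" and N: "module_functor K N" and inv: "inverse_morphisms K M N \<psi> \<chi>"
  shows "inverse_morphisms K (dual K N) (dual K M) (precompose K M \<psi>) (precompose K N \<chi>)"
proof -
  have \<psi>: "module_morphism K M N \<psi>" and \<chi>: "module_morphism K N M \<chi>"
    using inv by (auto simp: inverse_morphisms_def)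
  have c1: "\<chi> S (\<psi> S x) = x" if "S \<in> kalgs K" "x \<in> carrier (on_obj M S)" for S x
    using inv that by (auto simp: inverse_morphisms_def)
  have c2: "\<psi> S (\<chi> S x) = x" if "S \<in> kalgs K" "x \<in> carrier (on_obj N S)" for S x
    using inv that by (auto simp: inverse_morphisms_def)
  note eq = functions_on_eqI[OF module_homsD(1) module_homsD(1), unfolded underlying_simps]
  have "precompose K N \<chi> S (precompose K M \<psi> S f) = f" if S: "S \<in> kalgs K" and f: "f \<in> module_homs K N base_functor S" for S f
    by (rule eq[OF precompose_closed[OF N \<chi> S precompose_closed[OF M \<psi> S f]] f])
       (simp add: precompose_apply module_morphismD(1)[OF \<chi>] c2)
  moreover have "precompose K M \<psi> S (precompose K N \<chi> S f) = f" if S: "S \<in> kalgs K" and f: "f \<in> module_homs K M base_functor S" for S f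
    by (rule eq[OF precompose_closed[OF M \<psi> S precompose_closed[OF N \<chi> S f]] f])
       (simp add: precompose_apply module_morphismD(1)[OF \<psi>] c1)
  ultimately show ?thesis
    unfolding inverse_morphisms_def
    using precompose_morphism[OF M N \<psi>] precompose_morphism[OF N M \<chi>] by (simp add: dual_simps)
qed

lemma module_morphism_cong:
  assumes eq: "\<And>S x. S \<in> kalgs K \<Longrightarrow> x \<in> carrier (on_obj M S) \<Longrightarrow> \<phi>' S x = \<phi> S x"
    and M: "module_functor K M" and \<phi>: "module_morphism K M N \<phi>"
  shows "module_morphism K M N \<phi>'"
  unfolding module_morphism_def set_morphism_def
proof (intro conjI ballI)
  note D = module_morphismD[OF \<phi>]
  fix S assume S: "S \<in> kalgs K"
  interpret M: module S "on_obj M S" by (rule module_functorD(1)[OF M S])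
  show "\<phi>' S \<in> on_obj (underlying M) S \<rightarrow> on_obj (underlying N) S"
    using D(1)[OF S] eq[OF S] by simp
  show "linear_map S (on_obj M S) (on_obj N S) (\<phi>' S)"
    by (simp add: linear_map_def eq[OF S] D[OF S])
  show "\<phi>' T (on_hom (underlying M) S T h x) = on_hom (underlying N) S T h (\<phi>' S x)"
    if "T \<in> kalgs K" "h \<in> khom K S T" "x \<in> on_obj (underlying M) S" for T h x
    using that S D(4)[OF S _ that(1,2)] module_functorD(2)[OF M S _ that(1,2)] by (simp add: eq)
qed

lemma module_iso_inverse:
  assumes M: "module_functor K M" and iso: "module_iso K M N \<psi>"
  defines "\<chi> \<equiv> \<lambda>S. the_inv_into (carrier (on_obj M S)) (\<psi> S)"
  shows "inverse_morphisms K M N \<psi> \<chi>"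
proof -
  have \<psi>: "module_morphism K M N \<psi>" and bij: "\<And>S. S \<in> kalgs K \<Longrightarrow> bij_betw (\<psi> S) (carrier (on_obj M S)) (carrier (on_obj N S))"
    using iso by (auto simp: module_iso_def)
  note D = module_morphismD[OF \<psi>]
  have c: "\<chi> S y \<in> carrier (on_obj M S)" "\<psi> S (\<chi> S y) = y" if "S \<in> kalgs K" "y \<in> carrier (on_obj N S)" for S y
    unfolding \<chi>_def using bij[OF that(1)] that(2)
    by (auto simp: bij_betw_def the_inv_into_into f_the_inv_into_f)
  have ci: "\<chi> S (\<psi> S x) = x" if "S \<in> kalgs K" "x \<in> carrier (on_obj M S)" for S x
    unfolding \<chi>_def using bij[OF that(1)] that(2) by (simp add: bij_betw_def the_inv_into_f_f)
  have "module_morphism K N M \<chi>"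
    unfolding module_morphism_def set_morphism_def
  proof (intro conjI ballI)
    fix S assume S: "S \<in> kalgs K"
    interpret M: module S "on_obj M S" by (rule module_functorD(1)[OF M S])
    show "\<chi> S \<in> on_obj (underlying N) S \<rightarrow> on_obj (underlying M) S"
      using c(1)[OF S] by simp
    show "linear_map S (on_obj N S) (on_obj M S) (\<chi> S)"
      unfolding linear_map_def
    proof (intro conjI ballI)
      show "\<chi> S (x \<oplus>\<^bsub>on_obj N S\<^esub> y) = \<chi> S x \<oplus>\<^bsub>on_obj M S\<^esub> \<chi> S y"
        if "x \<in> carrier (on_obj N S)" "y \<in> carrier (on_obj N S)" for x y
        using ci[OF S M.M.a_closed[OF c(1)[OF S that(1)] c(1)[OF S that(2)]]]
          D(2)[OF S c(1)[OF S that(1)] c(1)[OF S that(2)]] c(2)[OF S that(1)] c(2)[OF S that(2)] by simp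
      show "\<chi> S (s \<odot>\<^bsub>on_obj N S\<^esub> x) = s \<odot>\<^bsub>on_obj M S\<^esub> \<chi> S x"
        if "s \<in> carrier S" "x \<in> carrier (on_obj N S)" for s x
        using ci[OF S M.smult_closed[OF that(1) c(1)[OF S that(2)]]]
          D(3)[OF S c(1)[OF S that(2)] that(1)] c(2)[OF S that(2)] by simp
    qed (use c(1)[OF S] in simp)
    show "\<chi> T (on_hom (underlying N) S T h y) = on_hom (underlying M) S T h (\<chi> S y)"
      if T: "T \<in> kalgs K" and h: "h \<in> khom K S T" and "y \<in> on_obj (underlying N) S" for T h y
    proof -
      have y: "y \<in> carrier (on_obj N S)" using that by simp
      show ?thesis
        using ci[OF T module_functorD(2)[OF M S c(1)[OF S y] T h]] D(4)[OF S c(1)[OF S y] T h] c(2)[OF S y] by simp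
    qed
  qed
  then show ?thesis
    using \<psi> c(2) ci by (auto simp: inverse_morphisms_def)
qed

text \<open>The map from \<open>N\<close> to its bidual is the one of \<open>M\<close>, preceded by
  the inverse of \<open>\<psi>\<close> and followed by the double transpose of
  \<open>\<psi>\<close>. It is thus a composite of bijections. The value types of \<open>M\<close>
  and \<open>N\<close> may differ, so the two functors cannot simply be identified.\<close>

lemma reflexive_iso:
  assumes M: "reflexive K M" and N: "module_functor K N" and iso: "module_iso K M N \<psi>"
  shows "reflexive K N"
proof -
  have mM: "module_functor K M" and bM: "module_iso K M (dual K (dual K M)) (to_bidual K M)"
    using M by (auto simp: reflexive_def)
  define \<chi> where "\<chi> = (\<lambda>S. the_inv_into (carrier (on_obj M S)) (\<psi> S))"
  note inv = module_iso_inverse[OF mM iso, folded \<chi>_def]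
  note dM = module_functor_dual[OF mM] and dN = module_functor_dual[OF N]
  define P where "P = precompose K (dual K N) (precompose K M \<psi>)"
  define Q where "Q = precompose K (dual K M) (precompose K N \<chi>)"
  have PQ: "inverse_morphisms K (dual K (dual K M)) (dual K (dual K N)) P Q"
    unfolding P_def Q_def by (rule inverse_morphisms_dual[OF dN dM inverse_morphisms_dual[OF mM N inv]])
  have bm: "module_morphism K M (dual K (dual K M)) (to_bidual K M)"
    and bb: "\<And>S. S \<in> kalgs K \<Longrightarrow> bij_betw (to_bidual K M S) (carrier (on_obj M S)) (carrier (on_obj (dual K (dual K M)) S))"
    using bM by (auto simp: module_iso_def)
  have \<psi>: "module_morphism K M N \<psi>" and \<chi>: "module_morphism K N M \<chi>"
    and \<psi>\<chi>: "\<And>S y. S \<in> kalgs K \<Longrightarrow> y \<in> carrier (on_obj N S) \<Longrightarrow> \<psi> S (\<chi> S y) = y"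
    and \<chi>\<psi>: "\<And>S y. S \<in> kalgs K \<Longrightarrow> y \<in> carrier (on_obj M S) \<Longrightarrow> \<chi> S (\<psi> S y) = y"
    using inv by (auto simp: inverse_morphisms_def)
  have P: "module_morphism K (dual K (dual K M)) (dual K (dual K N)) P" and Q: "module_morphism K (dual K (dual K N)) (dual K (dual K M)) Q"
    and PQ1: "\<And>S y. S \<in> kalgs K \<Longrightarrow> y \<in> carrier (on_obj (dual K (dual K M)) S) \<Longrightarrow> Q S (P S y) = y"
    and PQ2: "\<And>S y. S \<in> kalgs K \<Longrightarrow> y \<in> carrier (on_obj (dual K (dual K N)) S) \<Longrightarrow> P S (Q S y) = y"
    using PQ by (auto simp: inverse_morphisms_def)
  \<comment> \<open>Evaluation is natural: \<open>w(y)\<close> is the value of the form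
    \<open>w \<psi>\<close> at \<open>\<chi>(y)\<close>, over every algebra.\<close>
  have eq: "to_bidual K N S y = P S (to_bidual K M S (\<chi> S y))" if S: "S \<in> kalgs K" and y: "y \<in> carrier (on_obj N S)" for S y
  proof -
    note m = module_morphismD(1)[OF \<chi> S y]
    have "w (fst p, \<lambda>t\<in>carrier (fst p). t) (on_hom N S (fst p) (snd p) y) =
        to_bidual K M S (\<chi> S y) p (precompose K M \<psi> (fst p) w)"
      if p: "p \<in> salgs K S" and "w \<in> carrier (on_obj (dual K N) (fst p))" for p w
    proof -
      have w: "w \<in> module_homs K N base_functor (fst p)" using that by (simp add: dual_simps)
      note ph = salgsD[OF p]
      note hm = module_functorD(2)[OF mM S m ph]
      have "to_bidual K M S (\<chi> S y) (fst p, snd p) (precompose K M \<psi> (fst p) w) =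
          precompose K M \<psi> (fst p) w (fst p, \<lambda>t\<in>carrier (fst p). t) (on_hom M S (fst p) (snd p) (\<chi> S y))"
        by (rule to_bidual_apply[OF m ph precompose_closed[OF mM \<psi> ph(1) w]])
      also have "\<dots> = w (fst p, \<lambda>t\<in>carrier (fst p). t) (\<psi> (fst p) (on_hom M S (fst p) (snd p) (\<chi> S y)))"
        by (rule precompose_apply[OF ph(1) khom_id[OF ph(1)] hm])
      also have "\<psi> (fst p) (on_hom M S (fst p) (snd p) (\<chi> S y)) = on_hom N S (fst p) (snd p) y"
        by (simp add: module_morphismD(4)[OF \<psi> S m ph] \<psi>\<chi>[OF S y])
      finally show ?thesis
        unfolding prod.collapse by (rule sym)
    qed
    then show ?thesis
      using y by (auto simp: P_def precompose_def to_bidual_def intro!: restrict_ext)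
  qed
  have mor: "module_morphism K N (dual K (dual K N)) (to_bidual K N)"
    by (rule module_morphism_cong[OF eq N module_morphism_compose[OF module_morphism_compose[OF \<chi> bm] P]])
  have "bij_betw (to_bidual K N S) (carrier (on_obj N S)) (carrier (on_obj (dual K (dual K N)) S))" if S: "S \<in> kalgs K" for S
  proof -
    have "bij_betw (\<chi> S) (carrier (on_obj N S)) (carrier (on_obj M S))"
      by (rule bij_betw_byWitness[of _ "\<psi> S"])
         (use \<psi>\<chi>[OF S] \<chi>\<psi>[OF S] module_morphismD(1)[OF \<psi> S] module_morphismD(1)[OF \<chi> S] in auto)
    moreover have "bij_betw (P S) (carrier (on_obj (dual K (dual K M)) S)) (carrier (on_obj (dual K (dual K N)) S))"
      by (rule bij_betw_byWitness[of _ "Q S"])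
         (use PQ1[OF S] PQ2[OF S] module_morphismD(1)[OF P S] module_morphismD(1)[OF Q S] in auto)
    ultimately have "bij_betw (P S \<circ> (to_bidual K M S \<circ> \<chi> S)) (carrier (on_obj N S)) (carrier (on_obj (dual K (dual K N)) S))"
      using bb[OF S] by (blast intro: bij_betw_trans)
    then show ?thesis
      by (rule iffD1[OF bij_betw_cong, rotated]) (simp add: eq[OF S])
  qed
  with mor N show ?thesis
    by (simp add: reflexive_def module_iso_def)
qed

section \<open>Spectra of proquasi-coherent algebras\<close>

context base_field
begin

text \<open>By naturality of \<open>x\<close> along \<open>h\<close>, moving \<open>a\<close> to
  \<open>A(T)\<close> and applying \<open>x\<close> at \<open>T\<close> is the same as applying
  \<open>x\<close> at \<open>S\<close> and then \<open>1 \<otimes> h\<close>. The evaluation becomes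
  a copairing, to which the rules for copairings apply.\<close>

lemma to_functions_Spec_apply:
  assumes S: "S \<in> kalgs K" and T: "T \<in> kalgs K" and h: "h \<in> khom K S T" and x: "x \<in> on_obj (Spec K A) T"
    and a: "a \<in> carrier (on_obj A S)"
  shows "to_functions_Spec K A S a (T, h) x = copair K T S T (\<lambda>t\<in>carrier T. t) h (x S a)"
proof -
  note m = kalgsD(3)[OF T] kalgsD(3)[OF S]
  note xa = Spec_closed[OF x S a]
  have "tensor_map K T S T T (\<lambda>t. t) h (x S a) = tensor_map K T S T T (\<lambda>t\<in>carrier T. t) h (x S a)"
    by (rule tensor_map_cong[OF m m(1,1) linear_map_id khomD(2)[OF h] khomD(2)[OF khom_id[OF T]] khomD(2)[OF h] _ _ xa]) simp_all
  moreover have "x T (on_hom A S T h a) = tensor_map K T S T T (\<lambda>t. t) h (x S a)"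
    using module_morphismD(4)[OF algebra_morphism_imp_module_morphism[OF SpecD[OF x]] S a T h] by simp
  ultimately show ?thesis
    using T h x xa by (simp add: to_functions_Spec_def salgs_iff copair_def)
qed

context
  fixes A :: "('u, 'v) mfunctor"
  assumes A: "algebra_functor K A"
begin

text \<open>Moving the point along \<open>g\<close> replaces the first leg of the copairing by
  \<open>g\<close>, and moving the structure morphism replaces the second by \<open>g h\<close>. The
  result is \<open>g\<close> after the original copairing.\<close>

lemma to_functions_Spec_closed:
  assumes S: "S \<in> kalgs K" and a: "a \<in> carrier (on_obj A S)"
  shows "to_functions_Spec K A S a \<in> functions_on K (Spec K A) S"
proof -
  define F where "F p x = tensor_codiagonal K (fst p) (x (fst p) (on_hom A S (fst p) (snd p) a))"
    for p :: "'u alg \<times> ('u \<Rightarrow> 'u)" and x :: "'u alg \<Rightarrow> 'v \<Rightarrow> 'u"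
  have F: "F (T, h) x = copair K T S T (\<lambda>t\<in>carrier T. t) h (x S a)"
    if "T \<in> kalgs K" "h \<in> khom K S T" "x \<in> on_obj (Spec K A) T" for T h x
    using to_functions_Spec_apply[OF S that a] that by (simp add: to_functions_Spec_def F_def salgs_iff)
  have "(\<lambda>p\<in>salgs K S. \<lambda>x\<in>on_obj (Spec K A) (fst p). F p x) \<in> functions_on K (Spec K A) S"
  proof (rule functions_onI[OF _ _ set_functor_Spec[OF A] S])
    fix T h x assume T: "T \<in> kalgs K" and h: "h \<in> khom K S T" and x: "x \<in> on_obj (Spec K A) T"
    note xa = Spec_closed[OF x S a] and i = khom_id[OF T]
    show "F (T, h) x \<in> carrier T"
      unfolding F[OF T h x] by (rule khomD(3)[OF copair_khom[OF T T S i h] xa])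
    fix T' g assume T': "T' \<in> kalgs K" and g: "g \<in> khom K T T'"
    have "F (T', compose (carrier S) g h) (on_hom (Spec K A) T T' g x) =
        copair K T' S T' (\<lambda>t\<in>carrier T'. t) (compose (carrier S) g h) (tensor_map K T S T' S g (\<lambda>s. s) (x S a))"
      unfolding F[OF T' khom_compose[OF S h g] Spec_on_hom_closed[OF A T T' g x]] Spec_on_hom_apply[OF S a] ..
    also have "\<dots> = copair K T S T' g (compose (carrier S) g h) (x S a)"
      by (rule copair_id_tensor_map[OF T S T' g khom_compose[OF S h g] xa])
    also have "\<dots> = g (F (T, h) x)"
      using copair_natural[OF T S T T' i h g xa] unfolding F[OF T h x] compose_id[OF g] .
    finally show "F (T', compose (carrier S) g h) (on_hom (Spec K A) T T' g x) = g (F (T, h) x)" .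
  qed
  then show ?thesis
    by (simp add: to_functions_Spec_def F_def)
qed

text \<open>For a fixed point \<open>x\<close> the value is \<open>x S a\<close> followed by a
  copairing, and both steps preserve the ring operations. A scalar \<open>s\<close> acts as
  \<open>1 \<otimes> s\<close>, which the copairing sends to \<open>h(s)\<close>.\<close>

lemma to_functions_Spec_morphism:
  "algebra_morphism K A (function_algebra K (Spec K A)) (to_functions_Spec K A)"
  unfolding algebra_morphism_def set_morphism_def
proof (intro conjI ballI)
  let ?X = "Spec K A" and ?\<psi> = "to_functions_Spec K A"
  note sX = set_functor_Spec[OF A]
  note cl = to_functions_Spec_closed
  fix S assume S: "S \<in> kalgs K"
  interpret M: module S "on_obj A S" by (rule module_functorD(1)[OF algebra_functorD(1)[OF A] S])
  interpret R: ring "on_obj A S" by (rule algebra_functorD(3)[OF A S])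
  note fcl = function_algebra_closed[OF sX S]
  note xD = module_morphismD[OF algebra_morphism_imp_module_morphism[OF SpecD] S] algebra_morphismD[OF SpecD S]
  have ck: "copair K T S T (\<lambda>t\<in>carrier T. t) h \<in> khom K (T \<otimes>\<^sub>K S) T" if "T \<in> kalgs K" "h \<in> khom K S T" for T h
    by (rule copair_khom[OF that(1,1) S khom_id[OF that(1)] that(2)])
  show "?\<psi> S \<in> on_obj (underlying A) S \<rightarrow> on_obj (underlying (function_algebra K ?X)) S"
    using cl[OF S] by (simp add: function_algebra_simps(1))
  show "algebra_map S (on_obj A S) (on_obj (function_algebra K ?X) S) (?\<psi> S)"
  proof (rule algebra_mapI)
    show "linear_map S (on_obj A S) (on_obj (function_algebra K ?X) S) (?\<psi> S)"
      unfolding linear_map_def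
    proof (intro conjI ballI)
      show "?\<psi> S \<in> carrier (on_obj A S) \<rightarrow> carrier (on_obj (function_algebra K ?X) S)"
        using cl[OF S] by (simp add: function_algebra_simps(1))
      show "?\<psi> S (a \<oplus>\<^bsub>on_obj A S\<^esub> b) = ?\<psi> S a \<oplus>\<^bsub>on_obj (function_algebra K ?X) S\<^esub> ?\<psi> S b"
        if a: "a \<in> carrier (on_obj A S)" and b: "b \<in> carrier (on_obj A S)" for a b
      proof (rule functions_on_eqI[OF cl[OF S M.M.a_closed[OF a b]] fcl(1)[OF cl[OF S a] cl[OF S b]]])
        fix T h x assume T: "T \<in> kalgs K" and h: "h \<in> khom K S T" and x: "x \<in> on_obj ?X T"
        show "?\<psi> S (a \<oplus>\<^bsub>on_obj A S\<^esub> b) (T, h) x = (?\<psi> S a \<oplus>\<^bsub>on_obj (function_algebra K ?X) S\<^esub> ?\<psi> S b) (T, h) x"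
          unfolding function_algebra_apply[OF T h x] to_functions_Spec_apply[OF S T h x a] to_functions_Spec_apply[OF S T h x b]
            to_functions_Spec_apply[OF S T h x M.M.a_closed[OF a b]] xD(2)[OF x a b] qc_simps
          by (rule khomD(4)[OF ck[OF T h] Spec_closed[OF x S a] Spec_closed[OF x S b]])
      qed
      show "?\<psi> S (s \<odot>\<^bsub>on_obj A S\<^esub> a) = s \<odot>\<^bsub>on_obj (function_algebra K ?X) S\<^esub> ?\<psi> S a"
        if s: "s \<in> carrier S" and a: "a \<in> carrier (on_obj A S)" for s a
      proof (rule functions_on_eqI[OF cl[OF S M.smult_closed[OF s a]] fcl(3)[OF s cl[OF S a]]])
        fix T h x assume T: "T \<in> kalgs K" and h: "h \<in> khom K S T" and x: "x \<in> on_obj ?X T"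
        note xa = Spec_closed[OF x S a]
        have r: "copair K T S T (\<lambda>t\<in>carrier T. t) h (tensor_right K T S s) = h s"
          using fun_cong[OF copair_right[OF T T S khom_id[OF T] h], of s] s by (simp add: compose_apply)
        have "copair K T S T (\<lambda>t\<in>carrier T. t) h (s \<odot>\<^bsub>on_obj (QC T) S\<^esub> x S a) =
            h s \<otimes>\<^bsub>T\<^esub> copair K T S T (\<lambda>t\<in>carrier T. t) h (x S a)"
          unfolding qc_smult_alg[OF T S s xa]
            khomD(5)[OF ck[OF T h] khomD(3)[OF tensor_right_khom[OF T S] s] xa] r ..
        then show "?\<psi> S (s \<odot>\<^bsub>on_obj A S\<^esub> a) (T, h) x = (s \<odot>\<^bsub>on_obj (function_algebra K ?X) S\<^esub> ?\<psi> S a) (T, h) x"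
          unfolding function_algebra_apply[OF T h x] to_functions_Spec_apply[OF S T h x a]
            to_functions_Spec_apply[OF S T h x M.smult_closed[OF s a]] xD(3)[OF x a s] .
      qed
    qed
    show "?\<psi> S (a \<otimes>\<^bsub>on_obj A S\<^esub> b) = ?\<psi> S a \<otimes>\<^bsub>on_obj (function_algebra K ?X) S\<^esub> ?\<psi> S b"
      if a: "a \<in> carrier (on_obj A S)" and b: "b \<in> carrier (on_obj A S)" for a b
    proof (rule functions_on_eqI[OF cl[OF S R.m_closed[OF a b]] fcl(2)[OF cl[OF S a] cl[OF S b]]])
      fix T h x assume T: "T \<in> kalgs K" and h: "h \<in> khom K S T" and x: "x \<in> on_obj ?X T"
      show "?\<psi> S (a \<otimes>\<^bsub>on_obj A S\<^esub> b) (T, h) x = (?\<psi> S a \<otimes>\<^bsub>on_obj (function_algebra K ?X) S\<^esub> ?\<psi> S b) (T, h) x"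
        unfolding function_algebra_apply[OF T h x] to_functions_Spec_apply[OF S T h x a] to_functions_Spec_apply[OF S T h x b]
          to_functions_Spec_apply[OF S T h x R.m_closed[OF a b]] xD(5)[OF x a b] qc_simps
        by (rule khomD(5)[OF ck[OF T h] Spec_closed[OF x S a] Spec_closed[OF x S b]])
    qed
    show "?\<psi> S \<one>\<^bsub>on_obj A S\<^esub> = \<one>\<^bsub>on_obj (function_algebra K ?X) S\<^esub>"
    proof (rule functions_on_eqI[OF cl[OF S R.one_closed] fcl(4)])
      fix T h x assume T: "T \<in> kalgs K" and h: "h \<in> khom K S T" and x: "x \<in> on_obj ?X T"
      show "?\<psi> S \<one>\<^bsub>on_obj A S\<^esub> (T, h) x = \<one>\<^bsub>on_obj (function_algebra K ?X) S\<^esub> (T, h) x"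
        unfolding function_algebra_apply[OF T h x] to_functions_Spec_apply[OF S T h x R.one_closed] xD(6)[OF x] qc_simps
        by (rule khomD(7)[OF ck[OF T h]])
    qed
  qed
  fix S' g a assume S': "S' \<in> kalgs K" and g: "g \<in> khom K S S'" and "a \<in> on_obj (underlying A) S"
  then have a: "a \<in> carrier (on_obj A S)" by simp
  note ga = module_functorD(2)[OF algebra_functorD(1)[OF A] S a S' g]
  have "?\<psi> S' (on_hom A S S' g a) = base_change K S S' g (?\<psi> S a)"
  proof (rule functions_on_eqI[OF cl[OF S' ga] base_change_closed[OF cl[OF S a] S S' g sX]])
    fix T h x assume T: "T \<in> kalgs K" and h: "h \<in> khom K S' T" and x: "x \<in> on_obj ?X T"
    note hg = khom_compose[OF S g h] and i = khom_id[OF T] and xa = Spec_closed[OF x S a]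
    note m = kalgsD(3)[OF T] kalgsD(3)[OF S] kalgsD(3)[OF S']
    have "?\<psi> S' (on_hom A S S' g a) (T, h) x = copair K T S' T (\<lambda>t\<in>carrier T. t) h (tensor_map K T S T S' (\<lambda>t. t) g (x S a))"
      unfolding to_functions_Spec_apply[OF S' T h x ga] xD(4)[OF x a S' g] qc_simps ..
    also have "tensor_map K T S T S' (\<lambda>t. t) g (x S a) = tensor_map K T S T S' (\<lambda>t\<in>carrier T. t) g (x S a)"
      by (rule tensor_map_cong[OF m(1,2,1,3) linear_map_id khomD(2)[OF g] khomD(2)[OF i] khomD(2)[OF g] _ _ xa]) simp_all
    also have "copair K T S' T (\<lambda>t\<in>carrier T. t) h \<dots> = copair K T S T (\<lambda>t\<in>carrier T. t) (compose (carrier S) h g) (x S a)"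
      unfolding copair_tensor_map[OF T S T S' T i g i h xa] compose_id[OF i] ..
    also have "\<dots> = base_change K S S' g (?\<psi> S a) (T, h) x"
      unfolding base_change_apply[OF T h] by (rule to_functions_Spec_apply[OF S T hg x a, symmetric])
    finally show "?\<psi> S' (on_hom A S S' g a) (T, h) x = base_change K S S' g (?\<psi> S a) (T, h) x" .
  qed
  then show "?\<psi> S' (on_hom (underlying A) S S' g a) = on_hom (underlying (function_algebra K ?X)) S S' g (?\<psi> S a)"
    by (simp add: function_algebra_simps(7))
qed

text \<open>By \<open>copair_id_tensor_map\<close> the evaluation is the copairing of both
  coprojections, which is the identity. This is the triangle identity between the two canonical
  morphisms.\<close>

lemma to_functions_Spec_universal:
  assumes S: "S \<in> kalgs K" and B: "B \<in> kalgs K" and x: "x \<in> on_obj (Spec K A) B" and a: "a \<in> carrier (on_obj A S)"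
  shows "to_functions_Spec K A S a (B \<otimes>\<^sub>K S, tensor_right K B S)
      (on_hom (Spec K A) B (B \<otimes>\<^sub>K S) (tensor_left K B S) x) = x S a"
proof -
  note BS = tensor_kalgs[OF B S] and l = tensor_left_khom[OF B S] and r = tensor_right_khom[OF B S]
  note xa = Spec_closed[OF x S a]
  show ?thesis
    unfolding to_functions_Spec_apply[OF S BS r Spec_on_hom_closed[OF A B BS l x] a] Spec_on_hom_apply[OF S a]
      copair_id_tensor_map[OF B S BS l r xa]
    by (rule copair_universal[OF B S xa])
qed

end

text \<open>The function of \<open>a\<close> takes the values \<open>\<pi> S a\<close> at the
  universal extensions of the quotients, and these determine \<open>a\<close> in the limit. For
  surjectivity, two functions that agree at these extensions agree everywhere, because every point
  factors through a quotient.\<close>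

lemma to_functions_Spec_iso:
  fixes A :: "('u, 'v) mfunctor"
  assumes cA: "comm_algebra_functor K A" and rA: "reflexive K A" and pA: "proquasi_coherent K A"
  shows "algebra_iso K A (function_algebra K (Spec K A)) (to_functions_Spec K A)"
proof -
  let ?X = "Spec K A" and ?\<psi> = "to_functions_Spec K A" and ?Q = "algebra_quotients K A"
  have A: "algebra_functor K A" using cA by (simp add: comm_algebra_functor_def)
  note sX = set_functor_Spec[OF A]
  have lim: "bij_betw (\<lambda>a. \<lambda>i\<in>?Q. snd i S a) (carrier (on_obj A S)) (carrier (on_obj (limit_of_quotients K A) S))"
    if "S \<in> kalgs K" for S
    using pA that by (simp add: proquasi_coherent_def algebra_iso_def)
  have "bij_betw (?\<psi> S) (carrier (on_obj A S)) (functions_on K ?X S)" if S: "S \<in> kalgs K" for S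
  proof (rule bij_betwI')
    show "?\<psi> S a \<in> functions_on K ?X S" if "a \<in> carrier (on_obj A S)" for a
      by (rule to_functions_Spec_closed[OF A S that])
    fix a b assume ab: "a \<in> carrier (on_obj A S)" "b \<in> carrier (on_obj A S)"
    show "(?\<psi> S a = ?\<psi> S b) = (a = b)"
    proof
      assume eq: "?\<psi> S a = ?\<psi> S b"
      have "snd i S a = snd i S b" if i: "i \<in> ?Q" for i
      proof -
        obtain B \<pi> where i': "i = (B, \<pi>)" by force
        then have B: "(B, \<pi>) \<in> ?Q" using i by simp
        note BK = quotient_kalgs[OF cA B]
        show ?thesis
          using to_functions_Spec_universal[OF A S BK quotientD(4)[OF B] ab(1)]
            to_functions_Spec_universal[OF A S BK quotientD(4)[OF B] ab(2)] by (simp add: i' eq)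
      qed
      then have "(\<lambda>i\<in>?Q. snd i S a) = (\<lambda>i\<in>?Q. snd i S b)"
        by (rule restrict_ext)
      then show "a = b"
        using inj_onD[OF bij_betw_imp_inj_on[OF lim[OF S]] _ ab] by simp
    qed simp
  next
    fix f assume f: "f \<in> functions_on K ?X S"
    define v where "v B \<pi> = f (B \<otimes>\<^sub>K S, tensor_right K B S) (on_hom ?X B (B \<otimes>\<^sub>K S) (tensor_left K B S) \<pi>)" for B \<pi>
    define c where "c = (\<lambda>i\<in>?Q. v (fst i) (snd i))"
    have vc: "v B \<pi> \<in> carrier (B \<otimes>\<^sub>K S)" if B: "(B, \<pi>) \<in> ?Q" for B \<pi>
    proof -
      note BK = quotient_kalgs[OF cA B]
      show ?thesis
        unfolding v_def
        by (rule functions_onD(1)[OF f tensor_kalgs[OF BK S] tensor_right_khom[OF BK S]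
              Spec_on_hom_closed[OF A BK tensor_kalgs[OF BK S] tensor_left_khom[OF BK S] quotientD(4)[OF B]]])
    qed
    \<comment> \<open>A morphism of quotients is induced by an algebra map \<open>t\<close> from
      \<open>B\<close> to \<open>B'\<close>, and \<open>t\<close> carries the point
      \<open>\<pi>\<close> to \<open>\<pi>'\<close>. Compatibility of the values is thus naturality
      of \<open>f\<close>.\<close>
    have nat: "\<tau> S (v B \<pi>) = v B' \<pi>'"
      if B: "(B, \<pi>) \<in> ?Q" and B': "(B', \<pi>') \<in> ?Q" and \<tau>: "quotient_morphism K A (B, \<pi>) (B', \<pi>') \<tau>" for B \<pi> B' \<pi>' \<tau>
    proof (rule qc_algebra_morphism[OF quotientD(1)[OF B] quotientD(1)[OF B']])
      show "algebra_morphism K (QC B) (QC B') \<tau>" using \<tau> by (simp add: quotient_morphism_def)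
      fix t assume t: "algebra_map K B B' t"
        and \<tau>t: "\<And>S z. S \<in> kalgs K \<Longrightarrow> z \<in> carrier (B \<otimes>\<^sub>K S) \<Longrightarrow> \<tau> S z = tensor_map K B S B' S t (\<lambda>s. s) z"
      note BK = quotient_kalgs[OF cA B] and BK' = quotient_kalgs[OF cA B']
      note t' = restrict_khom[OF kalgsD(1)[OF BK] t]
      let ?t = "restrict t (carrier B)"
      have \<tau>': "\<tau> U z = tensor_map K B U B' U ?t (\<lambda>s. s) z" if "U \<in> kalgs K" "z \<in> carrier (B \<otimes>\<^sub>K U)" for U z
        unfolding \<tau>t[OF that]
        by (rule tensor_map_cong[OF kalgsD(3)[OF BK] kalgsD(3)[OF that(1)] kalgsD(3)[OF BK'] kalgsD(3)[OF that(1)]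
              algebra_mapD(1)[OF t] linear_map_id khomD(2)[OF t'] linear_map_id _ _ that(2)]) simp_all
      have p: "on_hom ?X B B' ?t \<pi> = \<pi>'"
      proof (rule Spec_eqI[OF Spec_on_hom_closed[OF A BK BK' t' quotientD(4)[OF B]] quotientD(4)[OF B']])
        fix U a assume U: "U \<in> kalgs K" and a: "a \<in> carrier (on_obj A U)"
        show "on_hom ?X B B' ?t \<pi> U a = \<pi>' U a"
          unfolding Spec_on_hom_apply[OF U a] \<tau>'[OF U Spec_closed[OF quotientD(4)[OF B] U a], symmetric]
          using \<tau> U a by (simp add: quotient_morphism_def)
      qed
      note BS' = tensor_kalgs[OF BK' S] and l' = tensor_left_khom[OF BK' S] and r' = tensor_right_khom[OF BK' S]
      note i = khom_compose[OF BK t' l']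
      have "v B' \<pi>' = f (B' \<otimes>\<^sub>K S, tensor_right K B' S) (on_hom ?X B (B' \<otimes>\<^sub>K S) (compose (carrier B) (tensor_left K B' S) ?t) \<pi>)"
        unfolding v_def p[symmetric] set_functorD(3)[OF sX BK quotientD(4)[OF B] BK' BS' t' l'] ..
      also have "\<dots> = copair K B S (B' \<otimes>\<^sub>K S) (compose (carrier B) (tensor_left K B' S) ?t) (tensor_right K B' S) (v B \<pi>)"
        unfolding v_def by (rule function_value_universal[OF sX S BS' BK r' i quotientD(4)[OF B] f])
      also have "\<dots> = copair K B' S (B' \<otimes>\<^sub>K S) (tensor_left K B' S) (tensor_right K B' S)
          (tensor_map K B S B' S ?t (\<lambda>s\<in>carrier S. s) (v B \<pi>))"
        unfolding copair_tensor_map[OF BK S BK' S BS' t' khom_id[OF S] l' r' vc[OF B]] compose_id[OF r'] ..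
      also have "tensor_map K B S B' S ?t (\<lambda>s\<in>carrier S. s) (v B \<pi>) = tensor_map K B S B' S ?t (\<lambda>s. s) (v B \<pi>)"
        by (rule tensor_map_cong[OF kalgsD(3)[OF BK] kalgsD(3)[OF S] kalgsD(3)[OF BK'] kalgsD(3)[OF S]
              khomD(2)[OF t'] khomD(2)[OF khom_id[OF S]] khomD(2)[OF t'] linear_map_id _ _ vc[OF B]]) simp_all
      also have "copair K B' S (B' \<otimes>\<^sub>K S) (tensor_left K B' S) (tensor_right K B' S) \<dots> = \<dots>"
        by (rule copair_universal[OF BK' S tensor_map_closed[OF kalgsD(3)[OF BK] kalgsD(3)[OF S] kalgsD(3)[OF BK'] kalgsD(3)[OF S]
                khomD(2)[OF t'] linear_map_id vc[OF B]]])
      also have "\<dots> = \<tau> S (v B \<pi>)"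
        by (rule \<tau>'[OF S vc[OF B], symmetric])
      finally show "\<tau> S (v B \<pi>) = v B' \<pi>'" ..
    qed
    have compat: "\<tau> S (c i) = c j" if "i \<in> ?Q" "j \<in> ?Q" "quotient_morphism K A i j \<tau>" for i j \<tau>
      using nat[of "fst i" "snd i" "fst j" "snd j" \<tau>] that by (simp add: c_def)
    have "c \<in> (\<Pi>\<^sub>E i\<in>?Q. carrier (fst i \<otimes>\<^sub>K S))"
      unfolding c_def using vc by (intro restrict_PiE_iff[THEN iffD2] ballI) simp
    then have "c \<in> carrier (on_obj (limit_of_quotients K A) S)"
      unfolding limit_simps(1) using compat by (intro conjI ballI allI impI)
    then have "c \<in> (\<lambda>a. \<lambda>i\<in>?Q. snd i S a) ` carrier (on_obj A S)"
      unfolding bij_betw_imp_surj_on[OF lim[OF S]] .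
    then obtain a where a2: "c = (\<lambda>i\<in>?Q. snd i S a)" and a: "a \<in> carrier (on_obj A S)"
      by (rule imageE)
    have va: "v B \<pi> = \<pi> S a" if "(B, \<pi>) \<in> ?Q" for B \<pi>
      using fun_cong[OF a2, of "(B, \<pi>)"] that by (simp add: c_def)
    \<comment> \<open>Both functions are determined at \<open>x\<close> by their values at the
      universal extension of one quotient, the image of \<open>x\<close>.\<close>
    have "f = ?\<psi> S a"
    proof (rule functions_on_eqI[OF f to_functions_Spec_closed[OF A S a]])
      fix T h x assume T: "T \<in> kalgs K" and h: "h \<in> khom K S T" and x: "x \<in> on_obj ?X T"
      note I = rA A T SpecD[OF x]
      let ?B = "image_algebra A T x" and ?q = "image_quotient A T x"
      let ?i = "\<lambda>b\<in>carrier ?B. b"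
      note BK = image_algebra_kalgs[OF I] and q = image_quotient_mem[OF I] and i = image_algebra_incl[OF I]
      have e: "x = on_hom ?X ?B T ?i ?q"
        by (rule Spec_image_factor[OF rA cA T x, symmetric])
      have "f (T, h) (on_hom ?X ?B T ?i ?q) = copair K ?B S T ?i h (v ?B ?q)"
        unfolding v_def by (rule function_value_universal[OF sX S T BK h i quotientD(4)[OF q] f])
      also have "\<dots> = ?\<psi> S a (T, h) (on_hom ?X ?B T ?i ?q)"
        unfolding va[OF q] function_value_universal[OF sX S T BK h i quotientD(4)[OF q] to_functions_Spec_closed[OF A S a]]
          to_functions_Spec_universal[OF A S BK quotientD(4)[OF q] a] ..
      finally show "f (T, h) x = ?\<psi> S a (T, h) x"
        unfolding e[symmetric] .
    qed
    then show "\<exists>a\<in>carrier (on_obj A S). f = ?\<psi> S a" using a by blast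
  qed
  then show ?thesis
    unfolding algebra_iso_def function_algebra_simps(1)
    by (intro conjI ballI to_functions_Spec_morphism[OF A])
qed

text \<open>Composition with \<open>to_functions_Spec\<close> inverts
  \<open>to_Spec_functions\<close>: the triangle identity \<open>ev\<close> settles this on
  functions that come from \<open>A\<close>, and all functions do. Reflexivity of the functions is
  obtained from that of \<open>A\<close> through the same isomorphism.\<close>

lemma affine_Spec:
  fixes A :: "('u, 'v) mfunctor"
  assumes cA: "comm_algebra_functor K A" and rA: "reflexive K A" and pA: "proquasi_coherent K A"
  shows "affine_functor K (Spec K A)"
proof -
  let ?X = "Spec K A" and ?\<psi> = "to_functions_Spec K A"
  let ?F = "function_algebra K ?X"
  have A: "algebra_functor K A" using cA by (simp add: comm_algebra_functor_def)
  note sX = set_functor_Spec[OF A]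
  have aF: "algebra_functor K ?F" using function_algebra_functor[OF sX] by (simp add: comm_algebra_functor_def)
  note iso = to_functions_Spec_iso[OF assms]
  note mor = to_functions_Spec_morphism[OF A]
  have bij: "bij_betw (?\<psi> S) (carrier (on_obj A S)) (functions_on K ?X S)" if "S \<in> kalgs K" for S
    using iso that by (simp add: algebra_iso_def function_algebra_simps(1))
  have "module_iso K A ?F ?\<psi>"
    using iso algebra_morphism_imp_module_morphism[OF mor] by (simp add: module_iso_def algebra_iso_def)
  then have rF: "reflexive K ?F"
    by (rule reflexive_iso[OF rA algebra_functorD(1)[OF aF]])
  have ev: "to_Spec_functions K ?X S x T (?\<psi> T a) = x T a"
    if S: "S \<in> kalgs K" and T: "T \<in> kalgs K" and x: "x \<in> on_obj ?X S" and a: "a \<in> carrier (on_obj A T)" for S T x a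
    unfolding to_Spec_functions_apply[OF sX T to_functions_Spec_closed[OF A T a]]
    by (rule to_functions_Spec_universal[OF A T S x a])
  have "bij_betw (to_Spec_functions K ?X S) (on_obj ?X S) (on_obj (Spec K ?F) S)" if S: "S \<in> kalgs K" for S
  proof (rule bij_betwI')
    show "to_Spec_functions K ?X S x \<in> on_obj (Spec K ?F) S" if "x \<in> on_obj ?X S" for x
      by (rule to_Spec_functions_closed[OF sX S that])
    show "(to_Spec_functions K ?X S x = to_Spec_functions K ?X S y) = (x = y)"
      if x: "x \<in> on_obj ?X S" and y: "y \<in> on_obj ?X S" for x y
    proof
      assume eq: "to_Spec_functions K ?X S x = to_Spec_functions K ?X S y"
      show "x = y"
      proof (rule Spec_eqI[OF x y])
        fix T a assume T: "T \<in> kalgs K" and a: "a \<in> carrier (on_obj A T)"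
        show "x T a = y T a"
          using ev[OF S T x a] ev[OF S T y a] by (simp only: eq)
      qed
    qed simp
    fix y assume y: "y \<in> on_obj (Spec K ?F) S"
    define x where "x = (\<lambda>T\<in>kalgs K. \<lambda>a\<in>carrier (on_obj A T). y T (?\<psi> T a))"
    have x: "x \<in> on_obj ?X S"
      unfolding x_def by (rule SpecI[OF A algebra_morphism_compose[OF mor SpecD[OF y]]])
    have "y = to_Spec_functions K ?X S x"
    proof (rule Spec_eqI[OF y to_Spec_functions_closed[OF sX S x]])
      fix T f assume T: "T \<in> kalgs K" and "f \<in> carrier (on_obj ?F T)"
      then have "f \<in> ?\<psi> T ` carrier (on_obj A T)"
        using bij_betw_imp_surj_on[OF bij[OF T]] by (simp add: function_algebra_simps(1))
      then obtain a where a: "a \<in> carrier (on_obj A T)" "f = ?\<psi> T a" by blast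
      show "y T f = to_Spec_functions K ?X S x T f"
        unfolding a(2) ev[OF S T x a(1)] using T a(1) by (simp add: x_def)
    qed
    then show "\<exists>x\<in>on_obj ?X S. y = to_Spec_functions K ?X S x"
      using x by (rule bexI)
  qed
  then show ?thesis
    unfolding affine_functor_def set_iso_def
    by (intro conjI ballI sX rF to_Spec_functions_morphism[OF sX])
qed

end

theorem theorem0p2:
  fixes K :: "'u ring"
  assumes "infinite (UNIV :: 'u set)"
    and "field K"
  shows "(\<forall>A :: ('u, 'v) mfunctor.
            comm_algebra_functor K A \<longrightarrow> reflexive K A \<longrightarrow> proquasi_coherent K A \<longrightarrow>
              affine_functor K (Spec K A) \<and>
              algebra_iso K A (function_algebra K (Spec K A)) (to_functions_Spec K A)) \<and>
         (\<forall>X :: ('u, 'w) sfunctor.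
            affine_functor K X \<longrightarrow> proquasi_coherent K (function_algebra K X))"
proof -
  interpret base_field K using assms by (rule base_field.intro)
  show ?thesis
    by (intro conjI allI impI affine_Spec to_functions_Spec_iso affine_imp_proquasi_coherent)
qed

end
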